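(* Let $d\ge 3$ be odd, $0<a_0<a_1$, $b\in\mathbb{R}^{d-1}$ with positive entries, and $r\ge 0$. Let $\Psi\in L_1(\mathbb{R}^d)\cap L_2(\mathbb{R}^d)$ be an admissible shearlet which is a Schwartz function with $$\operatorname{supp}\hat\Psi\subseteq([-a_1,-a_0]\cup[a_0,a_1])\times Q_b,\qquad Q_b=\prod_{i=1}^{d-1}[-b_i,b_i].$$ Let $\Phi\in L_1(\mathbb{R}^d)\cap L_2(\mathbb{R}^d)$ be given by $$\hat\Phi(\xi)=\xi_1^{\frac{d-1}{2}}\Bigl(\int_{\mathbb{R}\setminus[-|\xi_1|,|\xi_1|]}\frac{|\hat\Psi(\omega_1,\tilde\xi)|^2}{|\omega_1|^d}\,d\omega_1\Bigr)^{1/2},\qquad \xi=(\xi_1,\tilde\xi)\in\mathbb{R}\times\mathbb{R}^{d-1},$$ such that $$\int_{\mathbb{R}^{d-1}}\frac{|\hat\Phi(y,\sigma)|^2}{|y|^{d-1}}\,d\sigma+\int_{\mathbb{R}^{d-1}}\int_{-|y|}^{|y|}\frac{|\hat\Psi(\xi_1,\tilde\xi)|^2}{|\xi_1|^d}\,d\xi_1\,d\tilde\xi=1\quad\text{for almost every }y\in\mathbb{R},$$ and assume additionally that $\hat\Phi\in C_0^\infty(\mathbb{R}^d)$ (smooth with compact support). Then for every $q>1$ the kernel $R_{\mathfrak{F}}(x,y)=\langle\psi_y,\psi_x\rangle_{L_2(\mathbb{R}^d)}$, $x,y\in X$, of the inhomogeneous shearlet frame $\mathfrak{F}=\{\psi_x\}_{x\in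 X}$ generated by $\Phi,\Psi$ satisfies $R_{\mathfrak{F}}\in\mathcal{A}_{q,m_{v_r}}$.
   Context: Fourier transform: $\hat f(\omega)=\int_{\mathbb{R}^d}f(x)e^{-2\pi i\omega\cdot x}\,dx$. A function $\Psi\in L_2(\mathbb{R}^d)$ is an admissible shearlet if $\int_{\mathbb{R}^d}|\hat\Psi(\omega)|^2|\omega_1|^{-d}\,d\omega<\infty$. For $a\in\mathbb{R}\setminus\{0\}$ let $A_a=\begin{pmatrix}a&0\\0&\operatorname{sign}(a)|a|^{1/d}I_{d-1}\end{pmatrix}$ and for $s\in\mathbb{R}^{d-1}$ let $S_s=\begin{pmatrix}1&s^T\\0&I_{d-1}\end{pmatrix}$. Parameter space: $X=(\{\infty\}\times\mathbb{R}^{d-1}\times\mathbb{R}^d)\cup([-1,1]^*\times\mathbb{R}^{d-1}\times\mathbb{R}^d)$, where $[-1,1]^*=[-1,1]\setminus\{0\}$ and $\infty$ is an isolated point, with the Borel measure $\mu$ given by $$\int_XF\,d\mu=\int_{\mathbb{R}^d}\int_{\mathbb{R}^{d-1}}F(\infty,s,t)\,ds\,dt+\int_{\mathbb{R}^d}\int_{\mathbb{R}^{d-1}}\int_{-1}^1F(a,s,t)\,\frac{da}{|a|^{d+1}}\,ds\,dt.$$ The system generated by $\Phi,\Psi$: $\psi_{(\infty,s,t)}=\Phi(S_s^{-1}(\cdot-t))$ and $\psi_{(a,s,t)}=|\det A_a|^{-1/2}\Psi(A_a^{-1}S_s^{-1}(\cdot-t))$ for $a\in[-1,1]^*$. Weights: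 $v_r(\infty,s,t)=1$, $v_r(a,s,t)=|a|^{-r}$ for $a\in[-1,1]^*$; for a weight $v$ on $X$, $m_v(x,y)=\max\{v(x)/v(y),v(y)/v(x)\}$. Kernel spaces: for measurable $K:X\times X\to\mathbb{C}$, $$\|K\|_{\mathcal{A}_q}=\max\Bigl\{\operatorname*{ess\,sup}_{x\in X}\Bigl(\int_X|K(x,y)|^q\,d\mu(y)\Bigr)^{1/q},\ \operatorname*{ess\,sup}_{y\in X}\Bigl(\int_X|K(x,y)|^q\,d\mu(x)\Bigr)^{1/q}\Bigr\},$$ and $K\in\mathcal{A}_{q,m_v}$ iff $\|K\cdot m_v\|_{\mathcal{A}_q}<\infty$. *)

theory Defs
  imports "HOL-Probability.Essential_Supremum"
begin

section \<open>Coordinates, smooth functions and the Fourier transform\<close>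

text \<open>
  The space \<open>\<real>\<^sup>d\<close> is \<^typ>\<open>real ^ 'n option\<close> with \<open>d - 1 = CARD('n)\<close>: the index \<^term>\<open>None\<close> is the
  distinguished first coordinate and the indices \<^term>\<open>Some i\<close> are the remaining ones, so that
  \<open>\<real>\<^sup>d = \<real> \<times> \<real>\<^bsup>d-1\<^esup>\<close> and \<open>d = CARD('n option)\<close>.
\<close>

definition cons_vec :: "real \<Rightarrow> real ^ 'n \<Rightarrow> real ^ 'n option" where
  "cons_vec x y = (\<chi> i. case i of None \<Rightarrow> x | Some k \<Rightarrow> y $ k)"

definition tail_vec :: "real ^ 'n option \<Rightarrow> real ^ 'n" where
  "tail_vec x = (\<chi> k. x $ Some k)"

fun iterated_partial :: "'m list \<Rightarrow> (real ^ 'm::finite \<Rightarrow> complex) \<Rightarrow> real ^ 'm \<Rightarrow> complex" where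
  "iterated_partial [] f = f"
| "iterated_partial (i # is) f =
     (\<lambda>x. frechet_derivative (iterated_partial is f) (at x) (axis i 1))"

text \<open>If all iterated partial derivatives are differentiable, they are all continuous as well, so
  this is \<open>C\<^sup>\<infinity>\<close>.\<close>

definition smooth :: "(real ^ 'm::finite \<Rightarrow> complex) \<Rightarrow> bool" where
  "smooth f \<longleftrightarrow> (\<forall>is x. iterated_partial is f differentiable (at x))"

definition schwartz :: "(real ^ 'm::finite \<Rightarrow> complex) \<Rightarrow> bool" where
  "schwartz f \<longleftrightarrow> smooth f \<and>
     (\<forall>k is. bounded (range (\<lambda>x. norm x ^ k *\<^sub>R iterated_partial is f x)))"

definition supp :: "('a::topological_space \<Rightarrow> complex) \<Rightarrow> 'a set" where
  "supp f = closure (support_on UNIV f)"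

definition smooth_compact_support :: "(real ^ 'm::finite \<Rightarrow> complex) \<Rightarrow> bool" where
  "smooth_compact_support f \<longleftrightarrow> smooth f \<and> compact (supp f)"

text \<open>Representatives of elements of \<open>L\<^sub>1\<close> and \<open>L\<^sub>2\<close> are only required to be Lebesgue measurable.\<close>

definition in_L1 :: "('a::euclidean_space \<Rightarrow> complex) \<Rightarrow> bool" where
  "in_L1 f \<longleftrightarrow> integrable lebesgue f"

definition in_L2 :: "('a::euclidean_space \<Rightarrow> complex) \<Rightarrow> bool" where
  "in_L2 f \<longleftrightarrow> f \<in> borel_measurable lebesgue \<and> integrable lebesgue (\<lambda>x. (norm (f x))\<^sup>2)"

definition L2_inner :: "('a::euclidean_space \<Rightarrow> complex) \<Rightarrow> ('a \<Rightarrow> complex) \<Rightarrow> complex" where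
  "L2_inner f g = (LINT x|lebesgue. f x * cnj (g x))"

definition fourier :: "('a::euclidean_space \<Rightarrow> complex) \<Rightarrow> 'a \<Rightarrow> complex" where
  "fourier f \<omega> = (LINT x|lebesgue. f x * cis (- 2 * pi * (\<omega> \<bullet> x)))"

section \<open>Shearlets\<close>

text \<open>The Fourier integral represents the \<open>L\<^sub>2\<close> Fourier transform on \<open>L\<^sub>1 \<inter> L\<^sub>2\<close> only, so this
  is the admissibility of \<open>\<Psi> \<in> L\<^sub>2\<close> for \<open>\<Psi>\<close> that are also in \<open>L\<^sub>1\<close>.\<close>

definition admissible_shearlet :: "(real ^ 'n::finite option \<Rightarrow> complex) \<Rightarrow> bool" where
  "admissible_shearlet \<Psi> \<longleftrightarrow> in_L2 \<Psi> \<and>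
     (\<integral>\<^sup>+ \<omega>. ennreal ((norm (fourier \<Psi> \<omega>))\<^sup>2 / \<bar>\<omega> $ None\<bar> ^ CARD('n option)) \<partial>lborel) < \<infinity>"

definition dilation_matrix :: "real \<Rightarrow> real ^ 'n::finite option ^ 'n option" where
  "dilation_matrix a = (\<chi> i j. if i \<noteq> j then 0
     else if i = None then a else sgn a * \<bar>a\<bar> powr (1 / CARD('n option)))"

definition shear_matrix :: "real ^ 'n::finite \<Rightarrow> real ^ 'n option ^ 'n option" where
  "shear_matrix s = (\<chi> i j. if i = j then 1
     else case (i, j) of (None, Some k) \<Rightarrow> s $ k | _ \<Rightarrow> 0)"

text \<open>The scale parameter, an element of \<open>{\<infinity>} \<union> [-1,1]\<^sup>*\<close>, is an extended real; in this subspace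
  of \<^typ>\<open>ereal\<close> the point \<open>\<infinity>\<close> is isolated.\<close>

type_synonym 'n param = "ereal \<times> (real ^ 'n) \<times> (real ^ 'n option)"

definition param_space :: "'n::finite param set" where
  "param_space = ({\<infinity>} \<union> ereal ` ({-1..1} - {0})) \<times> UNIV \<times> UNIV"

definition param_measure :: "'n::finite param measure" where
  "param_measure = measure_of param_space (sets (restrict_space borel param_space))
     (\<lambda>E. (\<integral>\<^sup>+ t. \<integral>\<^sup>+ s. indicator E (\<infinity>, s, t) \<partial>lborel \<partial>lborel) +
          (\<integral>\<^sup>+ t. \<integral>\<^sup>+ s. \<integral>\<^sup>+ a. indicator E (ereal a, s, t)
             * ennreal (1 / \<bar>a\<bar> ^ (CARD('n option) + 1)) * indicator ({-1..1} - {0}) a \<partial>lborel \<partial>lborel \<partial>lborel))"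

definition shearlet_system ::
  "(real ^ 'n::finite option \<Rightarrow> complex) \<Rightarrow> (real ^ 'n option \<Rightarrow> complex) \<Rightarrow>
     'n param \<Rightarrow> real ^ 'n option \<Rightarrow> complex" where
  "shearlet_system \<Phi> \<Psi> = (\<lambda>(a, s, t) x.
     if a = \<infinity> then \<Phi> (matrix_inv (shear_matrix s) *v (x - t))
     else let A = dilation_matrix (real_of_ereal a) in
       of_real (\<bar>det A\<bar> powr (- 1 / 2)) *
         \<Psi> (matrix_inv A *v (matrix_inv (shear_matrix s) *v (x - t))))"

definition frame_kernel ::
  "('x \<Rightarrow> 'a::euclidean_space \<Rightarrow> complex) \<Rightarrow> 'x \<Rightarrow> 'x \<Rightarrow> complex" where
  "frame_kernel \<psi> x y = L2_inner (\<psi> y) (\<psi> x)"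

section \<open>Weights and kernel spaces\<close>

definition scale_weight :: "real \<Rightarrow> 'n::finite param \<Rightarrow> real" where
  "scale_weight r = (\<lambda>(a, s, t). if a = \<infinity> then 1 else \<bar>real_of_ereal a\<bar> powr (- r))"

definition kernel_weight :: "('x \<Rightarrow> real) \<Rightarrow> 'x \<Rightarrow> 'x \<Rightarrow> real" where
  "kernel_weight v x y = max (v x / v y) (v y / v x)"

text \<open>For positive exponents only.\<close>

definition ennreal_powr :: "ennreal \<Rightarrow> real \<Rightarrow> ennreal" where
  "ennreal_powr c p = (if c = \<infinity> then \<infinity> else ennreal (enn2real c powr p))"

definition kernel_norm :: "'x measure \<Rightarrow> real \<Rightarrow> ('x \<Rightarrow> 'x \<Rightarrow> complex) \<Rightarrow> ennreal" where
  "kernel_norm M q K = max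
     (esssup M (\<lambda>x. ennreal_powr (\<integral>\<^sup>+ y. ennreal (norm (K x y) powr q) \<partial>M) (1 / q)))
     (esssup M (\<lambda>y. ennreal_powr (\<integral>\<^sup>+ x. ennreal (norm (K x y) powr q) \<partial>M) (1 / q)))"

definition weighted_kernel_space ::
  "'x measure \<Rightarrow> real \<Rightarrow> ('x \<Rightarrow> 'x \<Rightarrow> real) \<Rightarrow> ('x \<Rightarrow> 'x \<Rightarrow> complex) set" where
  "weighted_kernel_space M q m =
     {K. (\<lambda>(x, y). K x y) \<in> borel_measurable (M \<Otimes>\<^sub>M M) \<and>
         kernel_norm M q (\<lambda>x y. K x y * of_real (m x y)) < \<infinity>}"

section \<open>The measure on the parameter space\<close>

lemma param_space_borel [measurable]: "param_space \<in> sets borel"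
proof -
  have "ereal ` ({-1..1} - {0}) = {ereal (-1)..ereal 1} - {0}"
  proof (intro equalityI subsetI)
    fix x :: ereal
    assume "x \<in> {ereal (-1)..ereal 1} - {0}"
    thus "x \<in> ereal ` ({-1..1} - {0})"
      by (cases x) (auto simp: one_ereal_def)
  qed (auto simp: one_ereal_def)
  hence "ereal ` ({-1..1} - {0}) \<in> sets borel" by simp
  hence "param_space \<in> sets (borel \<Otimes>\<^sub>M (borel \<Otimes>\<^sub>M borel))"
    unfolding param_space_def by (intro pair_measureI sets.Un) auto
  thus ?thesis by (simp only: borel_prod)
qed

lemma space_param_measure [simp]: "space param_measure = param_space"
proof -
  have "sets (restrict_space borel (param_space :: 'a param set)) \<subseteq> Pow param_space"
    using sets.space_closed[of "restrict_space borel (param_space :: 'a param set)"]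
    by (simp add: space_restrict_space)
  thus ?thesis by (simp add: param_measure_def space_measure_of)
qed

lemma sets_param_measure:
  "sets (param_measure :: 'n::finite param measure) = sets (restrict_space borel param_space)"
proof -
  have "sigma_algebra param_space (sets (restrict_space borel (param_space :: 'n param set)))"
    using sets.sigma_algebra_axioms[of "restrict_space borel (param_space :: 'n param set)"]
    by (simp add: space_restrict_space)
  thus ?thesis by (simp add: param_measure_def sigma_algebra.sets_measure_of_eq)
qed

text \<open>The set function in the definition of the measure is indeed countably additive.\<close>

lemma emeasure_param_measure:
  fixes E :: "'n::finite param set"
  assumes "E \<in> sets param_measure"
  shows "emeasure param_measure E =
    (\<integral>\<^sup>+ t. \<integral>\<^sup>+ s. indicator E (\<infinity>, s, t) \<partial>lborel \<partial>lborel) +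
    (\<integral>\<^sup>+ t. \<integral>\<^sup>+ s. \<integral>\<^sup>+ a. indicator E (ereal a, s, t)
       * ennreal (1 / \<bar>a\<bar> ^ (CARD('n option) + 1)) * indicator ({-1..1} - {0}) a
         \<partial>lborel \<partial>lborel \<partial>lborel)"
proof -
  let ?B = "lborel \<Otimes>\<^sub>M lborel :: ((real ^ 'n option) \<times> (real ^ 'n)) measure"
  let ?S = "borel \<Otimes>\<^sub>M (borel \<Otimes>\<^sub>M borel) :: 'n param measure"
  let ?w = "\<lambda>a::real. ennreal (1 / \<bar>a\<bar> ^ (CARD('n option) + 1)) * indicator ({-1..1} - {0}) a"
  let ?f = "\<lambda>x. (\<infinity>, snd x, fst x)" and ?g = "\<lambda>x. (ereal (snd x), snd (fst x), fst (fst x))"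
  define M1 where "M1 = distr ?B ?S ?f"
  define M2 where "M2 = distr (density (?B \<Otimes>\<^sub>M lborel) (\<lambda>x. ?w (snd x))) ?S ?g"
  interpret B: pair_sigma_finite "lborel :: (real ^ 'n option) measure" "lborel :: (real ^ 'n) measure" ..
  interpret B': pair_sigma_finite ?B "lborel :: real measure" ..
  have S: "A \<in> sets ?S" if "A \<in> sets param_measure" for A :: "'n param set"
    using that sets_restrict_space_iff[of param_space "borel :: 'n param measure" A]
    unfolding borel_prod by (simp add: sets_param_measure)
  have M1: "emeasure M1 A = (\<integral>\<^sup>+ t. \<integral>\<^sup>+ s. indicator A (\<infinity>, s, t) \<partial>lborel \<partial>lborel)"
    if [measurable]: "A \<in> sets ?S" for A
  proof -
    have "emeasure M1 A = (\<integral>\<^sup>+ x. indicator A x \<partial>M1)"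
      using that by (simp add: M1_def)
    also have "\<dots> = (\<integral>\<^sup>+ x. indicator A (?f x) \<partial>?B)"
      unfolding M1_def by (rule nn_integral_distr) measurable
    also have "\<dots> = (\<integral>\<^sup>+ t. \<integral>\<^sup>+ s. indicator A (\<infinity>, s, t) \<partial>lborel \<partial>lborel)"
      by (subst lborel.nn_integral_fst[symmetric]) simp_all
    finally show ?thesis .
  qed
  have M2: "emeasure M2 A = (\<integral>\<^sup>+ t. \<integral>\<^sup>+ s. \<integral>\<^sup>+ a. indicator A (ereal a, s, t) * ?w a
      \<partial>lborel \<partial>lborel \<partial>lborel)" if [measurable]: "A \<in> sets ?S" for A
  proof -
    have "emeasure M2 A = (\<integral>\<^sup>+ x. indicator A x \<partial>M2)"
      using that by (simp add: M2_def)
    also have "\<dots> = (\<integral>\<^sup>+ x. indicator A (?g x) \<partial>density (?B \<Otimes>\<^sub>M lborel) (\<lambda>x. ?w (snd x)))"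
      unfolding M2_def by (rule nn_integral_distr) measurable
    also have "\<dots> = (\<integral>\<^sup>+ x. indicator A (?g x) * ?w (snd x) \<partial>(?B \<Otimes>\<^sub>M lborel))"
      by (subst nn_integral_density) (simp_all add: mult.commute)
    also have "\<dots> = (\<integral>\<^sup>+ x. \<integral>\<^sup>+ a. indicator A (?g (x, a)) * ?w a \<partial>lborel \<partial>?B)"
      by (subst lborel.nn_integral_fst[symmetric]) simp_all
    also have "\<dots> = (\<integral>\<^sup>+ t. \<integral>\<^sup>+ s. \<integral>\<^sup>+ a. indicator A (ereal a, s, t) * ?w a
        \<partial>lborel \<partial>lborel \<partial>lborel)"
      by (subst lborel.nn_integral_fst[symmetric]) simp_all
    finally show ?thesis .
  qed
  let ?R = "restrict_space borel param_space :: 'n param measure"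
  let ?\<mu> = "\<lambda>A. (\<integral>\<^sup>+ t. \<integral>\<^sup>+ s. indicator A (\<infinity>, s, t) \<partial>lborel \<partial>lborel) +
    (\<integral>\<^sup>+ t. \<integral>\<^sup>+ s. \<integral>\<^sup>+ a. indicator A (ereal a, s, t)
       * ennreal (1 / \<bar>a\<bar> ^ (CARD('n option) + 1)) * indicator ({-1..1} - {0}) a
         \<partial>lborel \<partial>lborel \<partial>lborel)"
  have \<mu>: "?\<mu> A = emeasure M1 A + emeasure M2 A" if "A \<in> sets param_measure" for A
    by (simp only: M1[OF S[OF that]] M2[OF S[OF that]] mult.assoc)
  show ?thesis
  proof (rule emeasure_measure_of)
    show "(param_measure :: 'n param measure) = measure_of param_space (sets ?R) ?\<mu>"
      by (simp only: param_measure_def)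
    show "sets ?R \<subseteq> Pow param_space"
      using sets.space_closed[of ?R] by (simp add: space_restrict_space)
    show "E \<in> sets param_measure" by fact
    show "positive (sets (param_measure :: 'n param measure)) ?\<mu>"
      by (simp add: positive_def)
    show "countably_additive (sets (param_measure :: 'n param measure)) ?\<mu>"
    proof (rule countably_additiveI)
      fix A :: "nat \<Rightarrow> 'n param set"
      assume A: "range A \<subseteq> sets param_measure" "disjoint_family A" "(\<Union>i. A i) \<in> sets param_measure"
      have "range A \<subseteq> sets M1" "range A \<subseteq> sets M2"
        using A(1) S by (auto simp: M1_def M2_def)
      hence "(\<Sum>i. emeasure M1 (A i) + emeasure M2 (A i)) =
          emeasure M1 (\<Union>i. A i) + emeasure M2 (\<Union>i. A i)"
        using A(2) by (simp add: suminf_add[symmetric] suminf_emeasure)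
      moreover have "A i \<in> sets param_measure" for i
        using A(1) by blast
      ultimately show "(\<Sum>i. ?\<mu> (A i)) = ?\<mu> (\<Union>i. A i)"
        by (simp only: \<mu> A(3))
    qed
  qed
qed

end

theory Submission
  imports Defs "HOL-Probability.Characteristic_Functions"
begin

text \<open>
  By Fourier inversion and Parseval, the kernel is, up to a power of the determinants, an oscillatory
  integral \<open>J\<^sub>L(\<tau>) = \<integral> f(L \<eta>) g(\<eta>) exp(-2 \<pi> i \<tau> \<cdot> \<eta>) d\<eta>\<close>, where \<open>f\<close> and \<open>g\<close> are the Fourier
  transforms of the generators (one of them conjugated), \<open>L\<close> is the transpose of the relative matrix of
  the two parameters, and \<open>\<tau>\<close> is their relative translation. A partial derivative of the integrand
  is a combination of integrands of the same form with coefficients bounded by the entries of \<open>L\<close>, so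
  repeated integration by parts gives \<open>|J\<^sub>L(\<tau>)| \<le> C \<Prod>\<^sub>j 1 / max(1, |\<tau>\<^sub>j|)\<close> uniformly for bounded \<open>L\<close>; the
  \<open>q\<close>-th power of this bound is integrable for \<open>q > 1\<close>. If at least one scale is finite, the supports
  force the relative scale and shear into a bounded set. If both scales are \<open>\<infinity>\<close>, then
  \<open>\<Phi>\<close> satisfies \<open>\<Phi>(\<kappa> u, v) = \<kappa>\<^sup>m \<Phi>(u, v)\<close> on the Fourier side for small \<open>u\<close>, with \<open>2 m = d - 1\<close>,
  which rescales a large relative shear \<open>s\<close> to a bounded one at the gain of a factor
  \<open>|s|\<^bsup>-d\<^esup>\<close>; the integral over \<open>s\<close> and \<open>\<tau>\<close> converges because \<open>d q - 1 > d - 1\<close>.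
  The kernel is hermitian, so only one of the two suprema has to be estimated.
\<close>

text \<open>The homogeneity of \<open>fourier \<Phi>\<close> comes from the gap of
  \<open>fourier \<Psi>\<close> around first frequency 0: for |xi_1| < a0 the excluded interval
  [-|xi_1|, |xi_1|] carries none of the integrand, so the square root does not depend on xi_1 and
  only the monomial xi_1^m is left, with m an integer since d is odd.

  The same gap is what bounds shears. A relative shear enters a frequency only through a multiple of
  its first coordinate, so supports bound it only where that coordinate stays away from 0. For two
  copies of \<open>\<Phi>\<close> nothing ensures this, and that pair needs the rescaling: each
  factor gives \<kappa>^m and the Jacobian \<kappa>, together \<kappa>^d, while the q-th power
  integrated over the translation loses one power again, as one coordinate of \<tau> is compressed
  by \<kappa>.

  For two finite scales the obstacle is uniformity as the scale tends to 0. The supports confine the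
  shear to a ball whose volume, with the Jacobian of the translation and the density of the scales,
  makes all powers of the scale cancel.\<close>

lemma borel_measurable_cis [measurable]:
  "f \<in> borel_measurable M \<Longrightarrow> (\<lambda>x. cis (f x)) \<in> borel_measurable M"
  unfolding cis_conv_exp by measurable

lemma borel_measurable_matrix_vector [measurable]:
  "(*v) (A :: real ^ 'm::finite ^ 'k::finite) \<in> borel_measurable borel"
  by (intro borel_measurable_continuous_onI linear_continuous_on)
     (simp add: linear_conv_bounded_linear[symmetric])

text \<open>The change of variables formula of the library needs a well-ordered index type, which
  \<^typ>\<open>'n option\<close> is not. Shears and diagonal matrices generate all the matrices used here.\<close>

definition scales_lborel :: "real ^ 'm::finite ^ 'm \<Rightarrow> real \<Rightarrow> bool" where
  "scales_lborel A c \<longleftrightarrow> c > 0 \<and> lborel = density (distr lborel borel ((*v) A)) (\<lambda>_. ennreal c)"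

lemma scales_lborel_pos: "scales_lborel A c \<Longrightarrow> c > 0"
  by (simp add: scales_lborel_def)

text \<open>Tested on Borel sets, the identity of measures becomes one about preimages; products and
  inverses of matrices then turn into compositions and cancellations of preimages.\<close>

lemma scales_lborel_iff_emeasure:
  fixes A :: "real ^ 'm::finite ^ 'm"
  shows "scales_lborel A c \<longleftrightarrow> c > 0 \<and>
    (\<forall>E\<in>sets borel. emeasure lborel E = ennreal c * emeasure lborel ((*v) A -` E))"
proof -
  have e: "emeasure (density (distr lborel borel ((*v) A)) (\<lambda>_. ennreal c)) E =
      ennreal c * emeasure lborel ((*v) A -` E)" if "E \<in> sets borel" for E
    using that by (simp add: emeasure_density nn_integral_cmult_indicator emeasure_distr)
  show ?thesis
    unfolding scales_lborel_def
  proof (intro conj_cong refl iffI ballI)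
    fix E :: "(real ^ 'm) set"
    assume "lborel = density (distr lborel borel ((*v) A)) (\<lambda>_. ennreal c)" "E \<in> sets borel"
    thus "emeasure lborel E = ennreal c * emeasure lborel ((*v) A -` E)"
      using e by metis
  next
    assume "\<forall>E\<in>sets borel. emeasure lborel E = ennreal c * emeasure lborel ((*v) A -` E)"
    thus "lborel = density (distr lborel borel ((*v) A)) (\<lambda>_. ennreal c)"
      by (intro measure_eqI) (simp_all add: e)
  qed
qed

lemma scales_lborel_mult:
  assumes "scales_lborel A c" and "scales_lborel B d"
  shows "scales_lborel (A ** B) (c * d)"
  unfolding scales_lborel_iff_emeasure
proof (intro conjI ballI)
  show "0 < c * d" using assms by (simp add: scales_lborel_pos)
  fix E :: "(real ^ 'a) set"
  assume [measurable]: "E \<in> sets borel"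
  have [measurable]: "(*v) A -` E \<in> sets borel"
    using measurable_sets[OF borel_measurable_matrix_vector, of E A] by simp
  have "(*v) (A ** B) -` E = (*v) B -` ((*v) A -` E)"
    by (auto simp: matrix_vector_mul_assoc)
  moreover have "emeasure lborel E = ennreal c * emeasure lborel ((*v) A -` E)"
    using assms \<open>E \<in> sets borel\<close> unfolding scales_lborel_iff_emeasure by blast
  moreover have "emeasure lborel ((*v) A -` E) = ennreal d * emeasure lborel ((*v) B -` ((*v) A -` E))"
    using assms \<open>(*v) A -` E \<in> sets borel\<close> unfolding scales_lborel_iff_emeasure by blast
  ultimately show "emeasure lborel E = ennreal (c * d) * emeasure lborel ((*v) (A ** B) -` E)"
    using assms[THEN scales_lborel_pos] by (simp add: ennreal_mult mult.assoc)
qed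

lemma scales_lborel_inverse:
  assumes "scales_lborel A c" and "A ** B = mat 1" and "B ** A = mat 1"
  shows "scales_lborel B (1 / c)"
  unfolding scales_lborel_iff_emeasure
proof (intro conjI ballI)
  have c: "c > 0" using assms by (simp add: scales_lborel_pos)
  thus "0 < 1 / c" by simp
  fix E :: "(real ^ 'a) set"
  assume E: "E \<in> sets borel"
  have m: "(*v) B -` E \<in> sets borel"
    using measurable_sets[OF borel_measurable_matrix_vector, of E B] E by simp
  have "(*v) A -` ((*v) B -` E) = E"
    by (simp add: set_eq_iff matrix_vector_mul_assoc assms(3))
  hence "emeasure lborel ((*v) B -` E) = ennreal c * emeasure lborel E"
    using m assms(1) by (simp add: scales_lborel_iff_emeasure)
  thus "emeasure lborel E = ennreal (1 / c) * emeasure lborel ((*v) B -` E)"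
    using c by (simp add: mult.assoc[symmetric] ennreal_mult[symmetric])
qed

section \<open>Change of variables under matrices and translations\<close>

lemma nn_integral_lborel_matrix:
  assumes "scales_lborel A c" and [measurable]: "f \<in> borel_measurable borel"
  shows "(\<integral>\<^sup>+x. f x \<partial>lborel) = ennreal c * (\<integral>\<^sup>+x. f (A *v x) \<partial>lborel)"
proof -
  have "lborel = density (distr lborel borel ((*v) A)) (\<lambda>_. ennreal c)"
    using assms by (simp add: scales_lborel_def)
  hence "(\<integral>\<^sup>+x. f x \<partial>lborel) = (\<integral>\<^sup>+x. f x \<partial>density (distr lborel borel ((*v) A)) (\<lambda>_. ennreal c))"
    by simp
  thus ?thesis by (simp add: nn_integral_density nn_integral_distr nn_integral_cmult)
qed

lemma integrable_lborel_matrix: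
  fixes f :: "real ^ 'm::finite \<Rightarrow> 'b::{banach, second_countable_topology}"
  assumes A: "scales_lborel A c" and f: "integrable lborel f"
  shows "integrable lborel (\<lambda>x. f (A *v x))"
proof -
  have [measurable]: "f \<in> borel_measurable borel" using f by auto
  have c: "c > 0" using A by (rule scales_lborel_pos)
  have "integrable (density (distr lborel borel ((*v) A)) (\<lambda>_. ennreal c)) f"
    using f A by (simp add: scales_lborel_def)
  hence "integrable lborel (\<lambda>x. c *\<^sub>R f (A *v x))"
    using c by (subst (asm) integrable_density) (auto simp: integrable_distr_eq)
  hence "integrable lborel (\<lambda>x. (1 / c) *\<^sub>R c *\<^sub>R f (A *v x))"
    by (rule integrable_scaleR_right)
  thus ?thesis using c by simp
qed

lemma integral_lborel_matrix:
  fixes f :: "real ^ 'm::finite \<Rightarrow> 'b::{banach, second_countable_topology}"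
  assumes A: "scales_lborel A c" and [measurable]: "f \<in> borel_measurable borel"
  shows "(LINT x|lborel. f x) = c *\<^sub>R (LINT x|lborel. f (A *v x))"
proof -
  have "lborel = density (distr lborel borel ((*v) A)) (\<lambda>_. ennreal c)" "c > 0"
    using assms by (simp_all add: scales_lborel_def)
  hence "(LINT x|lborel. f x) = (LINT x|density (distr lborel borel ((*v) A)) (\<lambda>_. ennreal c). f x)"
    by simp
  thus ?thesis using \<open>c > 0\<close> by (simp add: integral_density integral_distr)
qed

lemma nn_integral_lborel_translate:
  fixes c :: "'a::euclidean_space"
  assumes [measurable]: "f \<in> borel_measurable borel"
  shows "(\<integral>\<^sup>+x. f (x - c) \<partial>lborel) = (\<integral>\<^sup>+x. f x \<partial>lborel)"
proof -
  have "(\<integral>\<^sup>+x. f x \<partial>lborel) = (\<integral>\<^sup>+x. f x \<partial>distr lborel borel ((+) (- c)))"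
    by (simp add: lborel_distr_plus)
  also have "\<dots> = (\<integral>\<^sup>+x. f (x - c) \<partial>lborel)"
    by (subst nn_integral_distr) simp_all
  finally show ?thesis by simp
qed

lemma integral_lborel_translate:
  fixes c :: "'a::euclidean_space" and f :: "'a \<Rightarrow> 'b::{banach, second_countable_topology}"
  assumes [measurable]: "f \<in> borel_measurable borel"
  shows "(LINT x|lborel. f (x - c)) = (LINT x|lborel. f x)"
proof -
  have "(LINT x|lborel. f x) = (LINT x|distr lborel borel ((+) (- c)). f x)"
    by (simp add: lborel_distr_plus)
  also have "\<dots> = (LINT x|lborel. f (x - c))"
    by (subst integral_distr) simp_all
  finally show ?thesis by simp
qed

lemma integrable_lborel_translate:
  fixes c :: "'a::euclidean_space" and f :: "'a \<Rightarrow> 'b::{banach, second_countable_topology}"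
  assumes "integrable lborel f"
  shows "integrable lborel (\<lambda>x. f (x - c))"
proof -
  have "integrable (distr lborel borel ((+) (- c))) f"
    using assms by (simp add: lborel_distr_plus)
  thus ?thesis by (subst (asm) integrable_distr_eq) (use assms in auto)
qed

section \<open>Fourier inversion\<close>

text \<open>A product over coordinates makes the Fourier transform factorise. With the phase t . x,
  free of 2 pi, this Gaussian is a multiple of its own transform.\<close>

definition gauss :: "'a::euclidean_space \<Rightarrow> real" where
  "gauss x = (\<Prod>b\<in>Basis. std_normal_density (x \<bullet> b))"

lemma gauss_borel [measurable]: "gauss \<in> borel_measurable borel"
  unfolding gauss_def[abs_def] by measurable

lemma gauss_nonneg: "gauss x \<ge> 0"
  unfolding gauss_def by (intro prod_nonneg) simp

text \<open>Lebesgue measure is the image of the product measure over the basis, so Fubini for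
  finite products applies.\<close>

lemma lborel_integral_prod:
  fixes f :: "'a::euclidean_space \<Rightarrow> real \<Rightarrow> 'b::{real_normed_field, banach, second_countable_topology}"
  assumes "\<And>b. b \<in> Basis \<Longrightarrow> integrable lborel (f b)"
  shows "(LINT x|lborel. (\<Prod>b\<in>Basis. f b (x \<bullet> b))) = (\<Prod>b\<in>Basis. LINT t|lborel. f b t)"
    and "integrable lborel (\<lambda>x::'a. \<Prod>b\<in>Basis. f b (x \<bullet> b))"
proof -
  interpret product_sigma_finite "\<lambda>_::'a. lborel :: real measure" ..
  have [measurable]: "f b \<in> borel_measurable borel" if "b \<in> Basis" for b
    using assms[OF that] by auto
  let ?T = "\<lambda>g::'a \<Rightarrow> real. \<Sum>b\<in>Basis. g b *\<^sub>R b"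
  have T: "(\<Prod>b\<in>Basis. f b (?T g \<bullet> b)) = (\<Prod>b\<in>Basis. f b (g b))" for g
    by (intro prod.cong refl) (simp add: inner_sum_left inner_Basis if_distrib cong: if_cong)
  have L: "(lborel :: 'a measure) = distr (\<Pi>\<^sub>M b\<in>Basis. lborel) borel ?T"
    by (subst lborel_def) (simp add: lborel_eq_real)
  have "(LINT x|lborel. (\<Prod>b\<in>Basis. f b (x \<bullet> b))) =
      (LINT g|(\<Pi>\<^sub>M b\<in>Basis. lborel). (\<Prod>b\<in>Basis. f b (?T g \<bullet> b)))"
    unfolding L by (subst integral_distr) (auto intro!: borel_measurable_prod)
  also have "\<dots> = (\<Prod>b\<in>Basis. LINT t|lborel. f b t)"
    unfolding T using assms by (intro product_integral_prod) auto
  finally show "(LINT x|lborel. (\<Prod>b\<in>Basis. f b (x \<bullet> b))) = (\<Prod>b\<in>Basis. LINT t|lborel. f b t)" .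
  have "integrable (\<Pi>\<^sub>M b\<in>Basis. lborel) (\<lambda>g. \<Prod>b\<in>Basis. f b (g b))"
    using assms by (intro product_integrable_prod) auto
  thus "integrable lborel (\<lambda>x::'a. \<Prod>b\<in>Basis. f b (x \<bullet> b))"
    unfolding L by (subst integrable_distr_eq) (auto simp: T intro!: borel_measurable_prod)
qed

text \<open>The left side is the characteristic function of the standard normal
  distribution.\<close>

lemma fourier_std_normal_density:
  "(LINT x|lborel. complex_of_real (std_normal_density x) * cis (t * x)) = exp (- (t\<^sup>2) / 2)"
proof -
  have "char std_normal_distribution t = (LINT x|lborel. std_normal_density x *\<^sub>R iexp (t * x))"
    unfolding char_def by (subst integral_density) auto
  thus ?thesis
    by (simp add: char_std_normal_distribution scaleR_conv_of_real cis_conv_exp)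
qed

lemma fourier_gauss:
  "(LINT x|lborel. complex_of_real (gauss x) * cis (t \<bullet> x)) =
     (2 * pi) powr (DIM('a) / 2) * gauss (t :: 'a::euclidean_space)"
  and integrable_gauss: "integrable lborel (gauss :: 'a \<Rightarrow> real)"
proof -
  have i: "integrable lborel (\<lambda>x. complex_of_real (std_normal_density x) * cis (t \<bullet> b * x))" for b :: 'a
  proof (rule Bochner_Integration.integrable_bound)
    show "integrable lborel std_normal_density" by simp
  qed (auto simp: norm_mult cis_conv_exp)
  have "gauss x * cis (t \<bullet> x) = (\<Prod>b\<in>Basis. complex_of_real (std_normal_density (x \<bullet> b)) * cis (t \<bullet> b * (x \<bullet> b)))" for x
    by (simp add: gauss_def prod.distrib cis_conv_exp exp_sum[symmetric] euclidean_inner[of t x]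
        sum_distrib_left)
  hence "(LINT x|lborel. complex_of_real (gauss x) * cis (t \<bullet> x)) =
    (\<Prod>b\<in>Basis. LINT x|lborel. complex_of_real (std_normal_density x) * cis (t \<bullet> b * x))"
    using lborel_integral_prod(1)[where f="\<lambda>b x. complex_of_real (std_normal_density x) * cis (t \<bullet> b * x)"] i
    by simp
  also have "\<dots> = (\<Prod>b\<in>Basis. complex_of_real ((2 * pi) powr (1/2) * std_normal_density (t \<bullet> b)))"
    unfolding fourier_std_normal_density
    by (intro prod.cong refl) (simp add: std_normal_density_def powr_half_sqrt flip: exp_of_real)
  also have "\<dots> = (2 * pi) powr (DIM('a) / 2) * gauss t"
  proof -
    have "((2 * pi) powr (1/2)) ^ DIM('a) = (2 * pi) powr (DIM('a) / 2)"
      by (simp add: powr_power)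
    thus ?thesis
      by (simp add: prod.distrib gauss_def flip: of_real_power)
  qed
  finally show "(LINT x|lborel. complex_of_real (gauss x) * cis (t \<bullet> x)) =
     (2 * pi) powr (DIM('a) / 2) * gauss t" .
  show "integrable lborel (gauss :: 'a \<Rightarrow> real)"
    unfolding gauss_def by (rule lborel_integral_prod(2)) simp
qed

lemma integral_gauss: "(LINT x|lborel. gauss (x::'a::euclidean_space)) = 1"
proof -
  have "(LINT x|lborel. gauss (x::'a)) = (\<Prod>b\<in>(Basis::'a set). LINT x|lborel. std_normal_density x)"
    unfolding gauss_def by (rule lborel_integral_prod(1)) simp
  thus ?thesis by (simp add: prob_space.prob_space)
qed


text \<open>As \<open>ennreal\<close> cuts off negative values, the two densities in the proof are
  the positive and the negative part of \<open>h\<close>. Their measures agree on boxes, which are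
  closed under intersection, generate the Borel sets and exhaust the space with finite measure.
  Hence the two parts agree almost everywhere, and then both vanish.\<close>

lemma AE_eq_zero_if_box_integrals_eq_zero:
  fixes h :: "'a::euclidean_space \<Rightarrow> real"
  assumes [measurable]: "h \<in> borel_measurable borel"
    and int: "\<And>l u. integrable lborel (\<lambda>x. indicator (box l u) x *\<^sub>R h x)"
    and zero: "\<And>l u. (LINT x|lborel. indicator (box l u) x *\<^sub>R h x) = 0"
  shows "AE x in lborel. h x = 0"
proof -
  let ?M = "density lborel (\<lambda>x. ennreal (h x))" and ?N = "density lborel (\<lambda>x. ennreal (- h x))"
  let ?E = "range (\<lambda>(a, b). box a b :: 'a set)"
  have M: "emeasure ?M (box l u) = (\<integral>\<^sup>+x. ennreal (indicator (box l u) x *\<^sub>R h x) \<partial>lborel)" for l u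
    by (simp add: emeasure_density) (intro nn_integral_cong, auto split: split_indicator)
  have N: "emeasure ?N (box l u) = (\<integral>\<^sup>+x. ennreal (- (indicator (box l u) x *\<^sub>R h x)) \<partial>lborel)" for l u
    by (simp add: emeasure_density) (intro nn_integral_cong, auto split: split_indicator)
  have fin: "emeasure ?M (box l u) \<noteq> \<infinity>" "emeasure ?N (box l u) \<noteq> \<infinity>" for l u
    using int[of l u] unfolding M N real_integrable_def by auto
  have eq: "emeasure ?M (box l u) = emeasure ?N (box l u)" for l u
  proof -
    have "enn2real (emeasure ?M (box l u)) = enn2real (emeasure ?N (box l u))"
      using zero[of l u] real_lebesgue_integral_def[OF int[of l u]] unfolding M N by simp
    thus ?thesis using fin[of l u] by (metis ennreal_enn2real infinity_ennreal_def top.not_eq_extremum)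
  qed
  have "?M = ?N"
  proof (rule measure_eqI_generator_eq)
    let ?A = "\<lambda>n::nat. box (- (real n *\<^sub>R One)) (real n *\<^sub>R One) :: 'a set"
    show "Int_stable ?E" by (auto simp: Int_stable_def box_Int_box)
    show "?E \<subseteq> Pow UNIV" "sets ?M = sigma_sets UNIV ?E" "sets ?N = sigma_sets UNIV ?E"
      by (simp_all add: borel_eq_box)
    show "range ?A \<subseteq> ?E" "(\<Union>i. ?A i) = UNIV"
      unfolding UN_box_eq_UNIV by auto
    show "emeasure ?M (?A i) \<noteq> \<infinity>" for i by (rule fin)
    show "emeasure ?M X = emeasure ?N X" if "X \<in> ?E" for X
      using that eq by auto
  qed
  hence "AE x in lborel. ennreal (h x) = ennreal (- h x)"
    by (intro sigma_finite_measure.density_unique[OF sigma_finite_lborel]) simp_all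
  thus ?thesis
  proof eventually_elim
    case (elim x)
    thus ?case by (cases "h x \<ge> 0") (auto simp: ennreal_neg ennreal_eq_0_iff)
  qed
qed

lemma integrable_lborel_pair_mult:
  fixes f :: "'a::euclidean_space \<Rightarrow> complex" and g :: "'b::euclidean_space \<Rightarrow> complex"
  assumes "integrable lborel f" and "integrable lborel g"
  shows "integrable (lborel \<Otimes>\<^sub>M lborel) (\<lambda>(x, y). f x * g y)"
proof -
  have [measurable]: "f \<in> borel_measurable borel" "g \<in> borel_measurable borel"
    using assms by auto
  show ?thesis
  proof (rule lborel_pair.Fubini_integrable)
    show "integrable lborel (\<lambda>x. LINT y|lborel. norm (case (x, y) of (x, y) \<Rightarrow> f x * g y))"
      using assms by (simp add: norm_mult)
  qed (use assms in auto)
qed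

lemma gauss_le_1: "gauss x \<le> 1"
proof -
  have "std_normal_density t \<le> 1" for t
  proof -
    have "sqrt (2 * pi) \<ge> sqrt 1" using pi_ge_two by (intro real_sqrt_le_mono) simp
    hence "1 / sqrt (2 * pi) \<le> 1" by simp
    hence "1 / sqrt (2 * pi) * exp (- t\<^sup>2 / 2) \<le> 1 * 1"
      by (intro mult_mono) simp_all
    thus ?thesis by (simp add: std_normal_density_def)
  qed
  thus ?thesis unfolding gauss_def by (intro prod_le_1) auto
qed

lemma isCont_gauss: "isCont gauss x"
  unfolding gauss_def[abs_def] std_normal_density_def by (intro continuous_intros) auto

text \<open>Normalises the damping factor of the inversion theorem to the value 1 at frequency
  0.\<close>

lemma gauss_0: "(2 * pi) powr (DIM('a) / 2) * gauss (0 :: 'a::euclidean_space) = 1"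
proof -
  have "gauss (0 :: 'a) = ((2 * pi) powr (- 1 / 2)) ^ DIM('a)"
    by (simp add: gauss_def std_normal_density_def powr_minus powr_half_sqrt divide_simps)
  also have "\<dots> = (2 * pi) powr (- (DIM('a) / 2))" by (simp add: powr_power)
  finally show ?thesis by (simp add: powr_add[symmetric])
qed

lemma lborel_integral_scale:
  fixes f :: "'a::euclidean_space \<Rightarrow> 'b::{banach, second_countable_topology}"
  assumes [measurable]: "f \<in> borel_measurable borel" and c: "c > 0"
  shows "(LINT x|lborel. f x) = c ^ DIM('a) *\<^sub>R (LINT x|lborel. f (c *\<^sub>R x + t))"
  using c
  by (subst lborel_affine[of c t])
     (simp_all add: integral_density integral_distr add.commute)

text \<open>Gaussian summation: damping \<open>F\<close> by \<open>D n\<close> turns the inversion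
  integral into a convolution of \<open>f\<close> with a Gaussian of width \<open>e n\<close>. The
  damped integrals converge everywhere by dominated convergence, as \<open>F\<close> is integrable.
  Convergence of the convolutions is tested only against indicators of boxes, where the Gaussian can
  be moved from \<open>f\<close> to the indicator; box integrals determine a function almost
  everywhere.\<close>

theorem fourier_inversion:
  fixes f :: "'a::euclidean_space \<Rightarrow> complex"
  defines "F \<equiv> (\<lambda>\<omega>. LINT x|lborel. f x * cis (- 2 * pi * (\<omega> \<bullet> x)))"
  assumes f: "integrable lborel f" and F: "integrable lborel F"
  shows "AE x in lborel. f x = (LINT \<omega>|lborel. F \<omega> * cis (2 * pi * (\<omega> \<bullet> x)))"
proof -
  let ?c = "\<lambda>(\<omega> :: 'a) x. cis (2 * pi * (\<omega> \<bullet> x))" and ?n = "\<lambda>(\<omega> :: 'a) x. cis (- 2 * pi * (\<omega> \<bullet> x))"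
  define C where "C = (2 * pi) powr (DIM('a) / 2)"
  define e where "e n = 1 / real (Suc n)" for n
  \<comment> \<open>The factor 2 pi \<open>e n\<close> matches the phase 2 pi (\<omega> . x), so
    that the transform of \<open>D n\<close> is the Gaussian density of width \<open>e n\<close>;
    the factor \<open>C\<close> makes \<open>D n\<close> tend to 1.\<close>
  define D where "D n \<omega> = C * gauss ((2 * pi * e n) *\<^sub>R \<omega>)" for n and \<omega> :: 'a
  define psi where "psi x = (LINT \<omega>|lborel. F \<omega> * cis (2 * pi * (\<omega> \<bullet> x)))" for x
  have [measurable]: "f \<in> borel_measurable borel" "F \<in> borel_measurable borel"
    using f F by auto
  have box_int: "integrable lborel (indicator (box l u) :: 'a \<Rightarrow> real)" for l u
    by (rule integrable_real_indicator[OF _ emeasure_lborel_box_finite]) simp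
  have C: "C > 0" by (simp add: C_def)
  have e: "e n > 0" for n by (simp add: e_def)
  have e0: "e \<longlonglongrightarrow> 0" unfolding e_def[abs_def] by (rule LIMSEQ_Suc[OF lim_1_over_n])
  let ?g = "\<lambda>n (v :: 'a). gauss (v /\<^sub>R e n) / e n ^ DIM('a)"
  have [measurable]: "D n \<in> borel_measurable borel" for n
    unfolding D_def[abs_def] by measurable
  have D_bd: "norm (D n \<omega>) \<le> C" for n \<omega>
    using C by (simp add: D_def abs_mult gauss_nonneg gauss_le_1 mult_left_le)
  have D_lim: "(\<lambda>n. D n \<omega>) \<longlonglongrightarrow> 1" for \<omega>
  proof -
    have "(\<lambda>n. (2 * pi * e n) *\<^sub>R \<omega>) \<longlonglongrightarrow> 0"
      by (rule tendsto_eq_intros e0 refl | simp)+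
    hence "(\<lambda>n. gauss ((2 * pi * e n) *\<^sub>R \<omega>)) \<longlonglongrightarrow> gauss (0 :: 'a)"
      by (rule isCont_tendsto_compose[OF isCont_gauss])
    hence "(\<lambda>n. D n \<omega>) \<longlonglongrightarrow> C * gauss (0 :: 'a)"
      unfolding D_def by (intro tendsto_intros)
    thus ?thesis by (simp add: C_def gauss_0)
  qed
  have D_int: "integrable lborel (\<lambda>\<omega>. complex_of_real (D n \<omega>))" for n
  proof -
    have c: "2 * pi * e n > 0" using e[of n] by simp
    have "integrable (density (distr lborel borel (\<lambda>x::'a. 0 + (2 * pi * e n) *\<^sub>R x)) (\<lambda>_. \<bar>2 * pi * e n\<bar> ^ DIM('a))) gauss"
      using lborel_affine[of "2 * pi * e n" "0 :: 'a"] c integrable_gauss by (metis less_irrefl)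
    hence "integrable lborel (\<lambda>x::'a. (2 * pi * e n) ^ DIM('a) * gauss ((2 * pi * e n) *\<^sub>R x))"
      using c by (subst (asm) integrable_density) (auto simp: integrable_distr_eq)
    hence "integrable lborel (\<lambda>x::'a. gauss ((2 * pi * e n) *\<^sub>R x))"
      using c e[of n] by simp
    thus ?thesis unfolding D_def by simp
  qed
  have D_fourier: "(LINT \<omega>|lborel. D n \<omega> * cis (2 * pi * (\<omega> \<bullet> v))) = gauss (v /\<^sub>R e n) / e n ^ DIM('a)"
    for n and v :: 'a
  proof -
    have c: "1 / (2 * pi * e n) > 0" using e[of n] by simp
    have "(LINT \<omega>|lborel. D n \<omega> * cis (2 * pi * (\<omega> \<bullet> v))) =
      (1 / (2 * pi * e n)) ^ DIM('a) *\<^sub>R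
        (LINT x|lborel. C * (gauss x * cis ((v /\<^sub>R e n) \<bullet> x)))"
      using e[of n]
      by (subst lborel_integral_scale[OF _ c, where t = 0])
         (auto simp: D_def inner_commute field_simps)
    also have "\<dots> = (1 / (2 * pi * e n)) ^ DIM('a) * C * (C * gauss (v /\<^sub>R e n))"
      by (simp only: integral_mult_right_zero fourier_gauss scaleR_conv_of_real C_def of_real_mult mult.assoc)
    also have "\<dots> = gauss (v /\<^sub>R e n) / e n ^ DIM('a)"
    proof -
      have "C * C = (2 * pi) ^ DIM('a)"
        by (simp add: C_def powr_add[symmetric] powr_realpow)
      moreover have "(1 / (2 * pi * e n)) ^ DIM('a) = 1 / ((2 * pi) ^ DIM('a) * e n ^ DIM('a))"
        by (simp only: power_one_over power_mult_distrib)
      ultimately have "(1 / (2 * pi * e n)) ^ DIM('a) * (C * C) = 1 / e n ^ DIM('a)"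
        by simp
      thus ?thesis by (simp only: mult.assoc[symmetric]) simp
    qed
    finally show ?thesis .
  qed
  define psin where "psin n y = (LINT \<omega>|lborel. F \<omega> * D n \<omega> * ?c \<omega> y)" for n y
  \<comment> \<open>The definition of \<open>F\<close> is inserted and the integrals are exchanged,
    which is allowed because \<open>f\<close> and \<open>D n\<close> are integrable in separate
    variables.\<close>
  have psin: "psin n y = (LINT x|lborel. f x * (?g n (y - x)))" for n y
  proof -
    have int: "integrable (lborel \<Otimes>\<^sub>M lborel) (\<lambda>(x, \<omega>). f x * D n \<omega> * ?c \<omega> (y - x))"
    proof (rule Bochner_Integration.integrable_bound)
      show "integrable (lborel \<Otimes>\<^sub>M lborel) (\<lambda>(x, \<omega>). f x * complex_of_real (D n \<omega>))"
        by (intro integrable_lborel_pair_mult f D_int)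
      show "(\<lambda>(x, \<omega>). f x * D n \<omega> * ?c \<omega> (y - x)) \<in> borel_measurable (lborel \<Otimes>\<^sub>M lborel)"
        by measurable
    qed (auto simp: norm_mult)
    have "psin n y = (LINT \<omega>|lborel. LINT x|lborel. f x * D n \<omega> * ?c \<omega> (y - x))"
      unfolding psin_def F_def
    proof (intro Bochner_Integration.integral_cong refl)
      fix \<omega> :: 'a
      have "(LINT x|lborel. f x * ?n \<omega> x) * D n \<omega> * ?c \<omega> y =
        (LINT x|lborel. f x * ?n \<omega> x * (D n \<omega> * ?c \<omega> y))"
        by (subst integral_mult_left_zero) (rule mult.assoc)
      also have "\<dots> = (LINT x|lborel. f x * D n \<omega> * ?c \<omega> (y - x))"
      proof (intro Bochner_Integration.integral_cong refl)
        fix x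
        have "?c \<omega> (y - x) = ?c \<omega> y * ?n \<omega> x"
          by (simp add: cis_mult inner_diff_right right_diff_distrib)
        thus "f x * ?n \<omega> x * (D n \<omega> * ?c \<omega> y) =
            f x * D n \<omega> * ?c \<omega> (y - x)"
          by (simp only: mult_ac)
      qed
      finally show "(LINT x|lborel. f x * ?n \<omega> x) * D n \<omega> * ?c \<omega> y =
        (LINT x|lborel. f x * D n \<omega> * ?c \<omega> (y - x))" .
    qed
    also have "\<dots> = (LINT x|lborel. LINT \<omega>|lborel. f x * D n \<omega> * ?c \<omega> (y - x))"
      by (rule lborel_pair.Fubini_integral[OF int])
    also have "\<dots> = (LINT x|lborel. f x * (?g n (y - x)))"
      by (intro Bochner_Integration.integral_cong refl) (simp only: mult.assoc[of "f x" for x] integral_mult_right_zero D_fourier)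
    finally show ?thesis .
  qed
  have FD: "norm (F \<omega> * D n \<omega> * cis t) \<le> C * norm (F \<omega>)" for n \<omega> t
    using mult_left_mono[OF D_bd, of "norm (F \<omega>)" n \<omega>] by (simp add: norm_mult mult.commute)
  have psin_lim: "(\<lambda>n. psin n y) \<longlonglongrightarrow> psi y" for y
    unfolding psin_def psi_def
  proof (rule integral_dominated_convergence[where w = "\<lambda>\<omega>. C * norm (F \<omega>)"])
    show "AE \<omega> in lborel. (\<lambda>n. F \<omega> * D n \<omega> * ?c \<omega> y) \<longlonglongrightarrow> F \<omega> * ?c \<omega> y"
    proof (rule AE_I2)
      fix \<omega> :: 'a
      have "(\<lambda>n. F \<omega> * of_real (D n \<omega>) * ?c \<omega> y) \<longlonglongrightarrow> F \<omega> * of_real 1 * ?c \<omega> y"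
        by (intro tendsto_intros D_lim)
      thus "(\<lambda>n. F \<omega> * D n \<omega> * ?c \<omega> y) \<longlonglongrightarrow> F \<omega> * ?c \<omega> y" by simp
    qed
    show "AE \<omega> in lborel. norm (F \<omega> * D n \<omega> * ?c \<omega> y) \<le> C * norm (F \<omega>)" for n
      by (intro AE_I2 FD)
    show "(\<lambda>\<omega>. F \<omega> * D n \<omega> * ?c \<omega> y) \<in> borel_measurable lborel" for n
      by measurable
    show "(\<lambda>\<omega>. F \<omega> * ?c \<omega> y) \<in> borel_measurable lborel"
      by measurable
  qed (use F in simp)
  have Fcis: "integrable lborel (\<lambda>\<omega>. F \<omega> * ?c \<omega> y)" for y
    by (rule Bochner_Integration.integrable_bound[OF F]) (auto simp: norm_mult cis_conv_exp)
  have psin_bd: "norm (psin n y) \<le> C * (LINT \<omega>|lborel. norm (F \<omega>))" for n y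
  proof -
    have "norm (psin n y) \<le> (LINT \<omega>|lborel. norm (F \<omega> * D n \<omega> * ?c \<omega> y))"
      unfolding psin_def by (rule integral_norm_bound)
    also have "\<dots> \<le> (LINT \<omega>|lborel. C * norm (F \<omega>))"
      using F C by (intro integral_mono_AE' AE_I2 FD) auto
    finally show ?thesis by simp
  qed
  have psi_bd: "norm (psi y) \<le> C * (LINT \<omega>|lborel. norm (F \<omega>))" for y
    by (rule LIMSEQ_le_const2[OF tendsto_norm[OF psin_lim]]) (use psin_bd in blast)
  have psi_m [measurable]: "psi \<in> borel_measurable borel"
    unfolding psi_def[abs_def] by measurable
  have psin_m [measurable]: "psin n \<in> borel_measurable borel" for n
    unfolding psin_def[abs_def] by measurable
  have ind: "integrable lborel (\<lambda>x. indicator (box l u) x *\<^sub>R g x)"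
    if [measurable]: "g \<in> borel_measurable borel" and "\<And>x. norm (g x) \<le> B" for g :: "'a \<Rightarrow> complex" and l u B
  proof (rule Bochner_Integration.integrable_bound)
    show "integrable lborel (\<lambda>x. indicator (box l u) x *\<^sub>R B)"
      by (intro integrable_scaleR_left box_int)
    have "B \<ge> 0" using norm_ge_zero that(2) order_trans by blast
    thus "AE x in lborel. norm (indicator (box l u) x *\<^sub>R g x) \<le> norm (indicator (box l u) x *\<^sub>R B)"
      using that by (auto split: split_indicator)
  qed simp
  have box: "(LINT x|lborel. indicator (box l u) x *\<^sub>R f x) = (LINT x|lborel. indicator (box l u) x *\<^sub>R psi x)"
    for l u
  proof -
    let ?I = "\<lambda>x. indicator (box l u) x :: real"
    \<comment> \<open>The indicator of the box, mollified at width \<open>e n\<close>; substituting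
      y = x + \<open>e n\<close> z gives its convolution form.\<close>
    define phi where "phi n x = (LINT z|lborel. gauss z * ?I (x + e n *\<^sub>R z))" for n x
    have phi: "phi n x = (LINT y|lborel. ?g n (y - x) * ?I y)" for n x
      using e[of n] unfolding phi_def
      by (subst (2) lborel_integral_scale[OF _ e[of n], where t = x]) (auto simp: add.commute)
    have lim1: "(\<lambda>n. LINT y|lborel. ?I y *\<^sub>R psin n y) \<longlonglongrightarrow> (LINT y|lborel. ?I y *\<^sub>R psi y)"
    proof (rule integral_dominated_convergence)
      let ?B = "C * (LINT \<omega>|lborel. norm (F \<omega>))"
      show "integrable lborel (\<lambda>x. ?I x *\<^sub>R ?B)"
        by (intro integrable_scaleR_left box_int)
      show "AE x in lborel. norm (?I x *\<^sub>R psin n x) \<le> ?I x *\<^sub>R ?B" for n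
        using psin_bd by (intro AE_I2) (auto split: split_indicator)
      show "AE x in lborel. (\<lambda>n. ?I x *\<^sub>R psin n x) \<longlonglongrightarrow> ?I x *\<^sub>R psi x"
        by (intro AE_I2 tendsto_intros psin_lim)
    qed auto
    have eq: "(LINT y|lborel. ?I y *\<^sub>R psin n y) = (LINT x|lborel. f x * phi n x)" for n
    proof -
      have int: "integrable (lborel \<Otimes>\<^sub>M lborel) (\<lambda>(x, y). f x * (?I y * (?g n (y - x))))"
      proof (rule Bochner_Integration.integrable_bound)
        have "integrable lborel (\<lambda>y. complex_of_real (?I y / e n ^ DIM('a)))"
          by (intro integrable_of_real integrable_divide box_int)
        thus "integrable (lborel \<Otimes>\<^sub>M lborel) (\<lambda>(x, y). f x * complex_of_real (?I y / e n ^ DIM('a)))"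
          by (intro integrable_lborel_pair_mult f)
        show "AE z in lborel \<Otimes>\<^sub>M lborel. norm (case z of (x, y) \<Rightarrow> f x * (?I y * (?g n (y - x)))) \<le>
            norm (case z of (x, y) \<Rightarrow> f x * complex_of_real (?I y / e n ^ DIM('a)))"
          using e[of n]
          by (intro AE_I2)
             (auto simp: norm_mult norm_divide norm_power gauss_nonneg gauss_le_1
               intro!: divide_right_mono mult_left_le split: split_indicator)
      qed measurable
      have "(LINT y|lborel. ?I y *\<^sub>R psin n y) =
          (LINT y|lborel. LINT x|lborel. f x * (?I y * (?g n (y - x))))"
        unfolding psin scaleR_conv_of_real
        by (intro Bochner_Integration.integral_cong refl) (simp add: integral_mult_right_zero[symmetric] mult_ac del: integral_mult_right_zero integral_mult_left_zero)
      also have "\<dots> = (LINT x|lborel. LINT y|lborel. f x * (?I y * (?g n (y - x))))"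
        by (rule lborel_pair.Fubini_integral[OF int])
      also have "\<dots> = (LINT x|lborel. f x * phi n x)"
        unfolding phi
        by (intro Bochner_Integration.integral_cong refl)
           (simp add: integral_complex_of_real[symmetric] mult_ac del: integral_complex_of_real)
      finally show ?thesis .
    qed
    \<comment> \<open>Off the boundary of the box the indicator is constant near x, so it is
      eventually constant along x + \<open>e n\<close> z. The boundary is a null set.\<close>
    have phi_lim: "(\<lambda>n. phi n x) \<longlonglongrightarrow> ?I x" if x: "x \<notin> cbox l u - box l u" for x
    proof -
      have "(\<lambda>n. phi n x) \<longlonglongrightarrow> (LINT z|lborel. gauss (z::'a) * ?I x)"
        unfolding phi_def
      proof (rule integral_dominated_convergence[where w = gauss])
        show "AE z in lborel. (\<lambda>n. gauss z * ?I (x + e n *\<^sub>R z)) \<longlonglongrightarrow> gauss z * ?I x"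
        proof (intro AE_I2 tendsto_intros)
          fix z :: 'a
          have l: "(\<lambda>n. x + e n *\<^sub>R z) \<longlonglongrightarrow> x"
            by (rule tendsto_eq_intros e0 refl | simp)+
          have "x \<in> box l u \<or> x \<in> - cbox l u" using x by blast
          thus "(\<lambda>n. ?I (x + e n *\<^sub>R z)) \<longlonglongrightarrow> ?I x"
          proof
            assume "x \<in> box l u"
            hence "eventually (\<lambda>n. x + e n *\<^sub>R z \<in> box l u) sequentially"
              by (intro topological_tendstoD[OF l open_box])
            hence "eventually (\<lambda>n. ?I (x + e n *\<^sub>R z) = ?I x) sequentially"
              by eventually_elim (use \<open>x \<in> box l u\<close> in simp)
            thus ?thesis by (rule tendsto_eventually)
          next
            assume xc: "x \<in> - cbox l u"
            hence xb: "x \<notin> box l u" using box_subset_cbox by blast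
            have "eventually (\<lambda>n. x + e n *\<^sub>R z \<in> - cbox l u) sequentially"
              by (intro topological_tendstoD[OF l _ xc] open_Compl closed_cbox)
            hence "eventually (\<lambda>n. ?I (x + e n *\<^sub>R z) = ?I x) sequentially"
            proof eventually_elim
              case (elim n)
              hence "x + e n *\<^sub>R z \<notin> box l u" using box_subset_cbox by blast
              thus ?case using xb by simp
            qed
            thus ?thesis by (rule tendsto_eventually)
          qed
        qed
        show "AE z in lborel. norm (gauss z * ?I (x + e n *\<^sub>R z)) \<le> gauss z" for n
          by (intro AE_I2) (auto simp: gauss_nonneg split: split_indicator)
      qed (auto simp: integrable_gauss)
      thus ?thesis by (simp add: integral_gauss)
    qed
    have phi_bd: "norm (phi n x) \<le> 1" for n x
    proof -
      have "norm (phi n x) \<le> (LINT z|lborel. norm (gauss z * ?I (x + e n *\<^sub>R z)))"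
        unfolding phi_def by (rule integral_norm_bound)
      also have "\<dots> \<le> (LINT z|lborel. gauss (z :: 'a))"
        by (intro integral_mono_AE' AE_I2 integrable_gauss) (auto simp: gauss_nonneg split: split_indicator)
      finally show ?thesis by (simp add: integral_gauss)
    qed
    have "AE x in lborel. x \<notin> cbox l u - box l u"
      using negligible_frontier_interval[of l u]
      by (subst AE_iff_null_sets[symmetric]) (auto simp: negligible_iff_null_sets null_sets_completion_iff)
    hence "(\<lambda>n. LINT x|lborel. f x * phi n x) \<longlonglongrightarrow> (LINT x|lborel. f x * ?I x)"
    proof (intro integral_dominated_convergence[where w = "\<lambda>x. norm (f x)"])
      show "AE x in lborel. (\<lambda>n. f x * phi n x) \<longlonglongrightarrow> f x * ?I x"
        using \<open>AE x in lborel. x \<notin> cbox l u - box l u\<close>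
        by eventually_elim (intro tendsto_intros phi_lim)
      show "AE x in lborel. norm (f x * phi n x) \<le> norm (f x)" for n
        using phi_bd by (intro AE_I2) (simp add: norm_mult mult_left_le)
      show "(\<lambda>x. f x * complex_of_real (phi n x)) \<in> borel_measurable lborel" for n
        unfolding phi_def by measurable
    qed (use f in auto)
    hence "(LINT x|lborel. f x * ?I x) = (LINT x|lborel. ?I x *\<^sub>R psi x)"
      using lim1 unfolding eq by (rule LIMSEQ_unique)
    thus ?thesis by (simp add: scaleR_conv_of_real mult.commute)
  qed
  have fi: "integrable lborel (\<lambda>x. indicator (box l u) x *\<^sub>R f x)" for l u
    by (rule Bochner_Integration.integrable_bound[OF f]) (auto split: split_indicator)
  have h: "integrable lborel (\<lambda>x. indicator (box l u) x *\<^sub>R (f x - psi x))"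
    "(LINT x|lborel. indicator (box l u) x *\<^sub>R (f x - psi x)) = 0" for l u
    using fi[of l u] ind[OF psi_m psi_bd, of l u] box[of l u] by (simp_all add: scaleR_diff_right)
  \<comment> \<open>The uniqueness criterion is for real functions, so it is applied to the real and
    to the imaginary part of the difference.\<close>
  have re: "AE x in lborel. L (f x - psi x) = 0" if L: "bounded_linear L" for L :: "complex \<Rightarrow> real"
  proof (rule AE_eq_zero_if_box_integrals_eq_zero)
    have [measurable]: "L \<in> borel_measurable borel"
      by (intro borel_measurable_continuous_onI linear_continuous_on L)
    show "(\<lambda>x. L (f x - psi x)) \<in> borel_measurable borel" by measurable
    fix l u :: 'a
    have eq: "indicator (box l u) x *\<^sub>R L (f x - psi x) = L (indicator (box l u) x *\<^sub>R (f x - psi x))" for x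
      by (rule linear_cmul[OF bounded_linear.linear[OF L], symmetric])
    show "integrable lborel (\<lambda>x. indicator (box l u) x *\<^sub>R L (f x - psi x))"
      unfolding eq by (rule integrable_bounded_linear[OF L h(1)])
    show "(LINT x|lborel. indicator (box l u) x *\<^sub>R L (f x - psi x)) = 0"
      unfolding eq integral_bounded_linear[OF L h(1)] h(2) by (rule linear_0[OF bounded_linear.linear[OF L]])
  qed
  show ?thesis
    using re[OF bounded_linear_Re] re[OF bounded_linear_Im]
    unfolding psi_def[symmetric] by eventually_elim (simp add: complex_eq_iff)
qed


section \<open>Shears and dilations\<close>

lemma prod_option: "(\<Prod>i\<in>UNIV. f i) = f None * (\<Prod>k\<in>UNIV. f (Some k))"
  for f :: "'n::finite option \<Rightarrow> 'b::comm_monoid_mult"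
  by (simp add: UNIV_option_conv prod.reindex)

lemma sum_option: "(\<Sum>i\<in>UNIV. f i) = f None + (\<Sum>k\<in>UNIV. f (Some k))"
  for f :: "'n::finite option \<Rightarrow> 'b::comm_monoid_add"
  by (simp add: UNIV_option_conv sum.reindex)

lemma cons_vec_nth [simp]: "cons_vec x y $ None = x" "cons_vec x y $ Some k = y $ k"
  by (simp_all add: cons_vec_def)

lemma tail_vec_nth [simp]: "tail_vec x $ k = x $ Some k"
  by (simp add: tail_vec_def)

lemma tail_cons_vec [simp]: "tail_vec (cons_vec x y) = y"
  by (simp add: vec_eq_iff)

lemma vec_option_eq_iff: "x = y \<longleftrightarrow> x $ None = y $ None \<and> tail_vec x = tail_vec y"
  for x y :: "real ^ 'n::finite option"
  by (auto simp: vec_eq_iff split_option_all)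

lemma cons_tail_vec [simp]: "cons_vec (x $ None) (tail_vec x) = x"
  by (simp add: vec_option_eq_iff)

lemma inner_option: "x \<bullet> y = x $ None * y $ None + tail_vec x \<bullet> tail_vec y"
  for x y :: "real ^ 'n::finite option"
  by (simp add: inner_vec_def sum_option)

lemma shear_matrix_mult: "shear_matrix s *v x = cons_vec (x $ None + s \<bullet> tail_vec x) (tail_vec x)"
  for s :: "real ^ 'n::finite"
proof -
  have "(shear_matrix s *v x) $ Some k = x $ Some k" for k
  proof -
    have "(shear_matrix s *v x) $ Some k = (\<Sum>j\<in>UNIV. shear_matrix s $ Some k $ j * x $ j)"
      by (simp add: matrix_vector_mult_def)
    also have "\<dots> = (\<Sum>j\<in>UNIV. if j = Some k then x $ j else 0)"
      by (intro sum.cong refl) (auto simp: shear_matrix_def)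
    finally show ?thesis by simp
  qed
  thus ?thesis
    by (simp add: vec_option_eq_iff vec_eq_iff[of "tail_vec _"])
       (simp add: matrix_vector_mult_def shear_matrix_def sum_option inner_vec_def)
qed

text \<open>The diagonal entry shared by the last d - 1 coordinates of a dilation matrix; the type
  argument only carries d. It is multiplicative in the scale, so products of dilations are dilations
  again.\<close>

definition dil :: "'n::finite itself \<Rightarrow> real \<Rightarrow> real" where
  "dil _ a = sgn a * \<bar>a\<bar> powr (1 / CARD('n option))"

text \<open>The two diagonal entries are independent because the rescaling of large shears acts on
  the first coordinate alone, which no dilation except the identity does.\<close>

definition scale_matrix :: "real \<Rightarrow> real \<Rightarrow> real ^ 'n::finite option ^ 'n option" where
  "scale_matrix a b = (\<chi> i j. if i \<noteq> j then 0 else if i = None then a else b)"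

lemma dilation_matrix_eq_scale_matrix:
  "dilation_matrix a = (scale_matrix a (dil TYPE('n) a) :: real ^ 'n::finite option ^ 'n option)"
  unfolding dilation_matrix_def scale_matrix_def dil_def by simp

lemma scale_matrix_mult: "scale_matrix a b *v x = cons_vec (a * x $ None) (b *\<^sub>R tail_vec x)"
  for x :: "real ^ 'n::finite option"
proof -
  have "(scale_matrix a b *v x) $ i = (if i = None then a else b) * x $ i" for i
  proof -
    have "(scale_matrix a b *v x) $ i = (\<Sum>j\<in>UNIV. scale_matrix a b $ i $ j * x $ j)"
      by (simp add: matrix_vector_mult_def)
    also have "\<dots> = (\<Sum>j\<in>UNIV. if j = i then (if i = None then a else b) * x $ j else 0)"
      by (intro sum.cong refl) (auto simp: scale_matrix_def)
    finally show ?thesis by simp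
  qed
  thus ?thesis by (simp add: vec_option_eq_iff vec_eq_iff[of "tail_vec _"])
qed

lemma dilation_matrix_mult:
  "dilation_matrix a *v x = cons_vec (a * x $ None) (dil TYPE('n) a *\<^sub>R tail_vec x)"
  for x :: "real ^ 'n::finite option"
  by (simp add: dilation_matrix_eq_scale_matrix scale_matrix_mult)

text \<open>The absolute determinant of a dilation as a single power: 2 - 1/d = 1 + (d -
  1)/d.\<close>

definition dil_det :: "'n::finite itself \<Rightarrow> real \<Rightarrow> real" where
  "dil_det _ a = \<bar>a\<bar> powr (2 - 1 / CARD('n option))"

lemma dil_det_eq: "dil_det TYPE('n::finite) a = \<bar>a\<bar> * \<bar>dil TYPE('n) a\<bar> ^ CARD('n)"
proof (cases "a = 0")
  case False
  let ?c = "1 / real CARD('n option)"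
  have "(\<bar>a\<bar> powr ?c) ^ CARD('n) = \<bar>a\<bar> powr (real CARD('n) * ?c)"
    using False by (simp add: powr_power)
  also have "real CARD('n) * ?c = 1 - ?c"
    by (simp add: field_simps)
  finally have "\<bar>a\<bar> * (\<bar>a\<bar> powr ?c) ^ CARD('n) = \<bar>a\<bar> powr (1 + (1 - ?c))"
    by (simp only: powr_mult_base abs_ge_zero)
  also have "1 + (1 - ?c) = 2 - ?c" by simp
  finally show ?thesis using False
    by (simp only: dil_det_def dil_def abs_mult abs_sgn_eq if_False mult_1 abs_of_nonneg[OF powr_ge_zero])
qed (simp add: dil_det_def)

lemma abs_det_dilation_matrix:
  "\<bar>det (dilation_matrix a :: real ^ 'n::finite option ^ 'n option)\<bar> = dil_det TYPE('n) a"
proof -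
  have "det (dilation_matrix a :: real ^ 'n option ^ 'n option) =
      (\<Prod>i\<in>(UNIV :: 'n option set). if i = None then a else dil TYPE('n) a)"
    by (subst det_diagonal) (auto simp: dilation_matrix_def dil_def intro!: prod.cong)
  also have "\<dots> = a * dil TYPE('n) a ^ CARD('n)"
    by (subst prod_option) simp
  finally show ?thesis by (simp only: dil_det_eq abs_mult power_abs)
qed

lemma scales_lborel_scale_matrix:
  assumes "a \<noteq> 0" and "b \<noteq> 0"
  shows "scales_lborel (scale_matrix a b :: real ^ 'n::finite option ^ 'n option) (\<bar>a\<bar> * \<bar>b\<bar> ^ CARD('n))"
proof -
  define c where "c j = (if j = axis None 1 then a else b)" for j :: "real ^ 'n option"
  have cnz: "c j \<noteq> 0" for j using assms by (simp add: c_def)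
  have B: "(Basis :: (real ^ 'n option) set) = range (\<lambda>i. axis i 1)"
    by (auto simp: Basis_vec_def)
  have inj: "inj (\<lambda>i::'n option. axis i (1::real))"
    by (auto simp: inj_def axis_eq_axis)
  have "0 + (\<Sum>j\<in>Basis. (c j * (x \<bullet> j)) *\<^sub>R j) = scale_matrix a b *v x" for x
  proof -
    have "0 + (\<Sum>j\<in>Basis. (c j * (x \<bullet> j)) *\<^sub>R j) = (\<Sum>i\<in>UNIV. ((if i = None then a else b) * x $ i) *\<^sub>R axis i 1)"
      by (simp add: B sum.reindex[OF inj] c_def axis_eq_axis inner_axis)
    also have "\<dots> = scale_matrix a b *v x"
      by (simp add: vec_eq_iff scale_matrix_mult axis_def if_distrib cong: if_cong)
         (auto simp: split_option_all)
    finally show ?thesis .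
  qed
  hence "(lborel :: (real ^ 'n option) measure) = density (distr lborel borel ((*v) (scale_matrix a b))) (\<lambda>_. (\<Prod>j\<in>(Basis :: (real ^ 'n option) set). \<bar>c j\<bar>))"
    using lborel_affine_euclidean[of c 0, OF cnz] by (simp only:)
  also have "(\<Prod>j\<in>(Basis :: (real ^ 'n option) set). \<bar>c j\<bar>) = \<bar>a\<bar> * \<bar>b\<bar> ^ CARD('n)"
    by (simp add: B prod.reindex[OF inj] c_def axis_eq_axis prod_option)
  finally show ?thesis
    using assms by (simp add: scales_lborel_def)
qed

lemma scales_lborel_dilation:
  assumes "a \<noteq> 0"
  shows "scales_lborel (dilation_matrix a :: real ^ 'n::finite option ^ 'n option) (dil_det TYPE('n) a)"
  using assms scales_lborel_scale_matrix[of a "dil TYPE('n) a"]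
  by (simp add: dilation_matrix_eq_scale_matrix dil_det_eq dil_def sgn_zero_iff)

section \<open>Lebesgue measure split into first coordinate and tail\<close>

lemma borel_measurable_vec_lambda:
  fixes f :: "'a \<Rightarrow> real ^ 'm::finite"
  assumes "\<And>i. (\<lambda>x. f x $ i) \<in> borel_measurable M"
  shows "f \<in> borel_measurable M"
  using assms by (subst borel_measurable_euclidean_space) (auto simp: Basis_vec_def inner_axis)

lemma borel_measurable_vec_nth' [measurable]:
  fixes f :: "'a \<Rightarrow> real ^ 'm::finite"
  assumes [measurable]: "f \<in> borel_measurable M"
  shows "(\<lambda>x. f x $ i) \<in> borel_measurable M"
proof -
  have "(\<lambda>x. f x $ i) = (\<lambda>x. f x \<bullet> axis i 1)" by (simp add: inner_axis)
  thus ?thesis by simp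
qed

lemma borel_measurable_cons_vec [measurable]:
  assumes [measurable]: "f \<in> borel_measurable M" "g \<in> borel_measurable M"
  shows "(\<lambda>x. cons_vec (f x) (g x)) \<in> borel_measurable M"
proof (rule borel_measurable_vec_lambda)
  show "(\<lambda>x. cons_vec (f x) (g x) $ i) \<in> borel_measurable M" for i
    by (cases i) simp_all
qed

lemma borel_measurable_tail_vec [measurable]:
  assumes [measurable]: "f \<in> borel_measurable M"
  shows "(\<lambda>x. tail_vec (f x)) \<in> borel_measurable M"
  by (rule borel_measurable_vec_lambda) simp

lemma lborel_cons_vec:
  "(lborel :: (real ^ 'n::finite option) measure) = distr (lborel \<Otimes>\<^sub>M lborel) borel (\<lambda>(x, y). cons_vec x y)"
proof (rule lborel_eqI)
  fix l u :: "real ^ 'n option"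
  assume le: "\<And>b. b \<in> Basis \<Longrightarrow> l \<bullet> b \<le> u \<bullet> b"
  have le': "l $ i \<le> u $ i" for i
    using le[of "axis i 1"] by (auto simp: Basis_vec_def inner_axis)
  have leT: "tail_vec l \<bullet> b \<le> tail_vec u \<bullet> b" if "b \<in> Basis" for b
    using that le' by (auto simp: Basis_vec_def inner_axis)
  have "(\<lambda>(x, y). cons_vec x y) -` box l u = {l $ None <..< u $ None} \<times> box (tail_vec l) (tail_vec u)"
    by (auto simp: mem_box_cart split_option_all)
  hence "emeasure (distr (lborel \<Otimes>\<^sub>M lborel) borel (\<lambda>(x, y). cons_vec x y)) (box l u) =
      emeasure lborel {l $ None <..< u $ None} * emeasure lborel (box (tail_vec l) (tail_vec u))"
    by (simp add: emeasure_distr space_pair_measure lborel.emeasure_pair_measure_Times)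
  also have "\<dots> = ennreal (u $ None - l $ None) * ennreal (\<Prod>b\<in>Basis. (tail_vec u - tail_vec l) \<bullet> b)"
    using le' leT by (simp add: emeasure_lborel_box)
  also have "\<dots> = ennreal (\<Prod>b\<in>Basis. (u - l) \<bullet> b)"
    using le' by (simp add: ennreal_mult[symmetric] prod_nonneg axis_inverse prod_option
        Basis_vec_def UNION_singleton_eq_range prod.reindex inj_def axis_eq_axis inner_axis)
  finally show "emeasure (distr (lborel \<Otimes>\<^sub>M lborel) borel (\<lambda>(x, y). cons_vec x y)) (box l u) =
      (\<Prod>b\<in>Basis. (u - l) \<bullet> b)" .
qed simp

lemma nn_integral_lborel_cons_vec:
  assumes [measurable]: "f \<in> borel_measurable borel"
  shows "(\<integral>\<^sup>+x. f x \<partial>lborel) = (\<integral>\<^sup>+y. \<integral>\<^sup>+x. f (cons_vec x y) \<partial>lborel \<partial>lborel)"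
proof -
  have "(\<integral>\<^sup>+x. f x \<partial>lborel) = (\<integral>\<^sup>+z. f (case z of (x, y) \<Rightarrow> cons_vec x y) \<partial>(lborel \<Otimes>\<^sub>M lborel))"
    by (subst lborel_cons_vec) (simp add: nn_integral_distr)
  also have "\<dots> = (\<integral>\<^sup>+y. \<integral>\<^sup>+x. f (cons_vec x y) \<partial>lborel \<partial>lborel)"
    by (subst lborel_pair.nn_integral_snd[symmetric]) simp_all
  finally show ?thesis .
qed

text \<open>For a fixed tail a shear only translates the first coordinate; integrating that
  coordinate first leaves the measure unchanged.\<close>

lemma scales_lborel_shear: "scales_lborel (shear_matrix (s :: real ^ 'n::finite)) 1"
  unfolding scales_lborel_iff_emeasure
proof (intro conjI ballI)
  fix E :: "(real ^ 'n option) set"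
  assume [measurable]: "E \<in> sets borel"
  have [measurable]: "(*v) (shear_matrix s) -` E \<in> sets borel"
    using measurable_sets[OF borel_measurable_matrix_vector, of E "shear_matrix s"] by simp
  have "emeasure lborel ((*v) (shear_matrix s) -` E) = (\<integral>\<^sup>+x. indicator E (shear_matrix s *v x) \<partial>lborel)"
    by (simp only: indicator_vimage[unfolded comp_def, symmetric] nn_integral_indicator \<open>(*v) (shear_matrix s) -` E \<in> sets borel\<close> sets_lborel)
  also have "\<dots> = (\<integral>\<^sup>+y. \<integral>\<^sup>+x. indicator E (cons_vec (x - (- (s \<bullet> y))) y) \<partial>lborel \<partial>lborel)"
    by (subst nn_integral_lborel_cons_vec) (simp_all add: shear_matrix_mult)
  also have "\<dots> = (\<integral>\<^sup>+y. \<integral>\<^sup>+x. indicator E (cons_vec x y) \<partial>lborel \<partial>lborel)"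
    by (intro nn_integral_cong nn_integral_lborel_translate) measurable
  also have "\<dots> = emeasure lborel E"
    by (subst nn_integral_lborel_cons_vec[symmetric]) simp_all
  finally show "emeasure lborel E = ennreal 1 * emeasure lborel ((*v) (shear_matrix s) -` E)"
    by simp
qed simp

section \<open>Smooth functions with compact support\<close>

lemma borel_measurable_cnj [measurable]:
  "f \<in> borel_measurable M \<Longrightarrow> (\<lambda>x. cnj (f x)) \<in> borel_measurable M"
  by (rule borel_measurable_continuous_on[OF continuous_on_cnj[OF continuous_on_id]])

lemma iterated_partial_append:
  "iterated_partial is (iterated_partial js f) = iterated_partial (is @ js) f"
  by (induction "is") auto

lemma smooth_iterated_partial: "smooth f \<Longrightarrow> smooth (iterated_partial is f)"
  by (simp add: smooth_def iterated_partial_append)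

lemma smooth_differentiable: "smooth f \<Longrightarrow> f differentiable (at x)"
  unfolding smooth_def by (metis iterated_partial.simps(1))

lemma smooth_continuous: "smooth f \<Longrightarrow> continuous_on A f"
  by (meson continuous_at_imp_continuous_on differentiable_imp_continuous_within smooth_differentiable)

lemma smooth_borel:
  assumes "smooth f" and [measurable]: "g \<in> borel_measurable M"
  shows "(\<lambda>x. f (g x)) \<in> borel_measurable M"
  by (rule borel_measurable_continuous_on[OF smooth_continuous[OF assms(1)] assms(2)])

definition partial :: "'m::finite \<Rightarrow> (real ^ 'm \<Rightarrow> complex) \<Rightarrow> real ^ 'm \<Rightarrow> complex" where
  "partial i f x = frechet_derivative f (at x) (axis i 1)"

lemma smooth_partial: "smooth f \<Longrightarrow> smooth (partial i f)"
  using smooth_iterated_partial[of f "[i]"] by (simp add: partial_def[abs_def])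

lemma not_in_supp: "x \<notin> supp f \<Longrightarrow> f x = 0"
  using closure_subset[of "support_on UNIV f"] by (auto simp: supp_def support_on_def)

text \<open>Off the closed support the function is locally 0, so its derivative vanishes there and
  the support cannot grow.\<close>

lemma smooth_compact_support_partial:
  assumes "smooth_compact_support f"
  shows "smooth_compact_support (partial i f)"
proof -
  have "partial i f x = 0" if "x \<notin> supp f" for x
  proof -
    have "open (- supp f)" by (simp add: supp_def open_Compl)
    hence "(f has_derivative (\<lambda>_. 0)) (at x)"
      using has_derivative_transform_within_open[of "\<lambda>_. 0" "\<lambda>_. 0" x UNIV "- supp f" f] that
      by (auto simp: not_in_supp)
    thus ?thesis by (simp add: partial_def frechet_derivative_at[symmetric])
  qed
  hence "support_on UNIV (partial i f) \<subseteq> supp f" by (auto simp: support_on_def)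
  hence "supp (partial i f) \<subseteq> supp f" by (auto simp: supp_def closure_minimal)
  moreover have "compact (supp f)" "smooth f" using assms by (auto simp: smooth_compact_support_def)
  ultimately have "compact (supp (partial i f))"
    using compact_Int_closed[of "supp f" "supp (partial i f)"] by (simp add: supp_def inf.absorb2)
  thus ?thesis using \<open>smooth f\<close> smooth_partial by (auto simp: smooth_compact_support_def)
qed

lemma smooth_compact_support_smooth: "smooth_compact_support f \<Longrightarrow> smooth f"
  by (simp add: smooth_compact_support_def)

lemma compact_support_radius:
  assumes "smooth_compact_support f"
  obtains B where "B > 0" and "\<And>x. f x \<noteq> 0 \<Longrightarrow> norm x \<le> B"
proof -
  have "bounded (supp f)" using assms by (auto simp: smooth_compact_support_def compact_imp_bounded)
  then obtain B where "B > 0" "\<forall>x\<in>supp f. norm x \<le> B" using bounded_pos by blast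
  thus ?thesis using that not_in_supp by metis
qed

lemma compact_support_bounded:
  assumes "smooth_compact_support f"
  obtains M where "M \<ge> 0" and "\<And>x. norm (f x) \<le> M"
proof -
  have "bounded (f ` supp f)"
    using assms by (intro compact_imp_bounded compact_continuous_image smooth_continuous)
      (auto simp: smooth_compact_support_def)
  then obtain M where "M > 0" "\<forall>x\<in>supp f. norm (f x) \<le> M"
    unfolding bounded_pos by auto
  thus ?thesis using that[of M] not_in_supp by (metis less_imp_le norm_zero)
qed

lemma integrable_compact_support:
  assumes "smooth_compact_support f"
  shows "integrable lborel f"
proof -
  have "compact (supp f)" "smooth f" using assms by (auto simp: smooth_compact_support_def)
  hence "integrable lborel (\<lambda>x. indicator (supp f) x *\<^sub>R f x)"
    by (intro borel_integrable_compact smooth_continuous)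
  moreover have "indicator (supp f) x *\<^sub>R f x = f x" for x
    by (auto simp: indicator_def not_in_supp)
  ultimately show ?thesis by simp
qed

text \<open>The mean value inequality on a segment, where only the derivative in the direction of
  the segment has to be bounded.\<close>

lemma norm_diff_le_directional:
  fixes F :: "'a::real_normed_vector \<Rightarrow> 'b::real_inner"
  assumes F: "\<And>x. (F has_derivative F' x) (at x)" and M: "\<And>x. norm (F' x e) \<le> M" and "h \<ge> 0"
  shows "norm (F (x + h *\<^sub>R e) - F x) \<le> M * h"
proof -
  have d: "((\<lambda>t. F (x + t *\<^sub>R e)) has_derivative (\<lambda>t. F' (x + t0 *\<^sub>R e) (t *\<^sub>R e))) (at t0 within {0..h})" for t0
    by (rule has_derivative_at_withinI)
       (rule has_derivative_compose[OF _ F], auto intro!: derivative_eq_intros)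
  have "onorm (\<lambda>t. F' (x + t0 *\<^sub>R e) (t *\<^sub>R e)) \<le> M" for t0
  proof (rule onorm_bound)
    show "0 \<le> M" using M norm_ge_zero order_trans by blast
    have "linear (F' (x + t0 *\<^sub>R e))" by (rule has_derivative_linear[OF F])
    thus "norm (F' (x + t0 *\<^sub>R e) (t *\<^sub>R e)) \<le> M * norm t" for t
      using M[of "x + t0 *\<^sub>R e"] by (simp add: linear_cmul mult.commute[of M] mult_left_mono)
  qed
  hence "norm ((\<lambda>t. F (x + t *\<^sub>R e)) h - (\<lambda>t. F (x + t *\<^sub>R e)) 0) \<le> M * norm (h - 0)"
    using \<open>h \<ge> 0\<close> d by (intro differentiable_bound[of "{0..h}"]) auto
  thus ?thesis using \<open>h \<ge> 0\<close> by simp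
qed

text \<open>By translation invariance every difference quotient in the direction \<open>e\<close>
  has integral 0, and the quotients converge to the derivative under a common integrable bound. This
  takes the place of Fubini and one-dimensional integration by parts.\<close>

lemma integral_directional_derivative_eq_zero:
  fixes F :: "'a::euclidean_space \<Rightarrow> complex"
  assumes F: "\<And>x. (F has_derivative F' x) (at x)"
    and B: "\<And>x. F x \<noteq> 0 \<Longrightarrow> norm x \<le> B"
    and M: "\<And>x. norm (F' x e) \<le> M"
  shows "(LINT x|lborel. F' x e) = 0"
proof -
  define h where "h n = 1 / real (Suc n)" for n
  have h: "h n > 0" "h n \<le> 1" for n by (simp_all add: h_def)
  have h0: "h \<longlonglongrightarrow> 0" unfolding h_def[abs_def] by (rule LIMSEQ_Suc[OF lim_1_over_n])
  have cont: "continuous_on A F" for A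
    by (intro continuous_at_imp_continuous_on ballI has_derivative_continuous[OF F])
  have [measurable]: "F \<in> borel_measurable borel"
    by (rule borel_measurable_continuous_onI[OF cont])
  let ?D = "\<lambda>n x. (F (x + h n *\<^sub>R e) - F x) /\<^sub>R h n"
  have Fint: "integrable lborel F"
  proof -
    have "integrable lborel (\<lambda>x. indicator (cball 0 B) x *\<^sub>R F x)"
      by (intro borel_integrable_compact cont) simp
    moreover have "indicator (cball 0 B) x *\<^sub>R F x = F x" for x
      using B[of x] by (auto simp: indicator_def)
    ultimately show ?thesis by simp
  qed
  have zero: "(LINT x|lborel. ?D n x) = 0" for n
  proof -
    have "integrable lborel (\<lambda>x. F (x + h n *\<^sub>R e))"
      using integrable_lborel_translate[OF Fint, of "- (h n *\<^sub>R e)"] by simp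
    moreover note Fint
    moreover have "(LINT x|lborel. F (x + h n *\<^sub>R e)) = (LINT x|lborel. F x)"
      using integral_lborel_translate[of F "- (h n *\<^sub>R e)"] by simp
    ultimately have "(LINT x|lborel. F (x + h n *\<^sub>R e) - F x) = 0"
      by (simp only: Bochner_Integration.integral_diff diff_self)
    thus ?thesis by (simp only: integral_scaleR_right scaleR_zero_right)
  qed
  have lim: "(\<lambda>n. ?D n x) \<longlonglongrightarrow> F' x e" for x
  proof -
    have "((\<lambda>t. F (x + t *\<^sub>R e)) has_derivative (\<lambda>t. F' (x + 0 *\<^sub>R e) (t *\<^sub>R e))) (at 0)"
      by (rule has_derivative_compose[OF _ F], auto intro!: derivative_eq_intros)
    moreover have "linear (F' x)" by (rule has_derivative_linear[OF F])
    ultimately have "((\<lambda>t. F (x + t *\<^sub>R e)) has_vector_derivative F' x e) (at 0)"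
      by (simp add: has_vector_derivative_def linear_cmul)
    hence "((\<lambda>t. (F (x + t *\<^sub>R e) - F x) /\<^sub>R t) \<longlongrightarrow> F' x e) (at 0)"
    proof -
      assume "((\<lambda>t. F (x + t *\<^sub>R e)) has_vector_derivative F' x e) (at 0)"
      hence "((\<lambda>t. norm ((F (x + t *\<^sub>R e) - F x - t *\<^sub>R F' x e) /\<^sub>R \<bar>t\<bar>)) \<longlongrightarrow> 0) (at 0)"
        by (intro tendsto_norm_zero) (simp add: has_vector_derivative_def has_derivative_at_within)
      moreover have "norm ((F (x + t *\<^sub>R e) - F x - t *\<^sub>R F' x e) /\<^sub>R \<bar>t\<bar>) =
          norm ((F (x + t *\<^sub>R e) - F x) /\<^sub>R t - F' x e)" if "t \<noteq> 0" for t
      proof -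
        have "(F (x + t *\<^sub>R e) - F x) /\<^sub>R t - F' x e = (F (x + t *\<^sub>R e) - F x - t *\<^sub>R F' x e) /\<^sub>R t"
          using that by (simp add: scaleR_diff_right)
        thus ?thesis by simp
      qed
      hence "eventually (\<lambda>t. norm ((F (x + t *\<^sub>R e) - F x - t *\<^sub>R F' x e) /\<^sub>R \<bar>t\<bar>) =
          norm ((F (x + t *\<^sub>R e) - F x) /\<^sub>R t - F' x e)) (at 0)"
        by (simp add: eventually_at_filter)
      ultimately have "((\<lambda>t. norm ((F (x + t *\<^sub>R e) - F x) /\<^sub>R t - F' x e)) \<longlongrightarrow> 0) (at 0)"
        by (rule Lim_transform_eventually)
      thus ?thesis by (rule LIM_zero_cancel[OF tendsto_norm_zero_cancel])
    qed
    moreover have "filterlim h (at 0) sequentially"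
      using h0 by (simp add: filterlim_at h_def)
    ultimately show ?thesis by (rule filterlim_compose)
  qed
  have "(\<lambda>n. LINT x|lborel. ?D n x) \<longlonglongrightarrow> (LINT x|lborel. F' x e)"
  proof (rule integral_dominated_convergence)
    \<comment> \<open>As \<open>h n\<close> \<le> 1, for x outside the ball of this radius both x
      and x + \<open>h n\<close> e have norm above \<open>B\<close>, where \<open>F\<close> is
      0.\<close>
    let ?R = "B + norm e"
    show "integrable lborel (\<lambda>x. indicator (cball 0 ?R) x *\<^sub>R M :: real)"
      by (intro integrable_scaleR_left integrable_real_indicator emeasure_bounded_finite) auto
    show "AE x in lborel. norm (?D n x) \<le> indicator (cball 0 ?R) x *\<^sub>R M" for n
    proof (intro AE_I2)
      fix x
      have "norm (?D n x) \<le> M"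
        using norm_diff_le_directional[of F F' e M "h n" x] F M h[of n]
        by (simp add: divide_simps mult.commute)
      moreover have "?D n x = 0" if "norm x > ?R"
      proof -
        have "norm x \<le> norm (x + h n *\<^sub>R e) + norm (h n *\<^sub>R e)"
          using norm_triangle_ineq4[of "x + h n *\<^sub>R e" "h n *\<^sub>R e"] by simp
        moreover have "norm (h n *\<^sub>R e) \<le> norm e" using h[of n] by (simp add: mult_left_le_one_le)
        ultimately have "norm (x + h n *\<^sub>R e) > B" using that by linarith
        moreover have "norm x > B" using that norm_ge_zero[of e] by linarith
        ultimately have "F (x + h n *\<^sub>R e) = 0" "F x = 0" using B by (meson not_le)+
        thus ?thesis by simp
      qed
      ultimately show "norm (?D n x) \<le> indicator (cball 0 ?R) x *\<^sub>R M"
        by (auto simp: indicator_def not_le)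
    qed
    show "(\<lambda>x. F' x e) \<in> borel_measurable lborel"
      by (rule borel_measurable_LIMSEQ_metric[of ?D, OF _ lim]) measurable
    show "AE x in lborel. (\<lambda>n. ?D n x) \<longlonglongrightarrow> F' x e" using lim by simp
  qed measurable
  hence "(\<lambda>n. 0) \<longlonglongrightarrow> (LINT x|lborel. F' x e)" unfolding zero .
  thus ?thesis by (simp add: LIMSEQ_const_iff)
qed

section \<open>Decay of oscillatory integrals\<close>

definition osc :: "(real ^ 'm::finite \<Rightarrow> complex) \<Rightarrow> (real ^ 'm \<Rightarrow> complex) \<Rightarrow> real ^ 'm ^ 'm \<Rightarrow> real ^ 'm \<Rightarrow> complex" where
  "osc f g L \<tau> = (LINT \<eta>|lborel. f (L *v \<eta>) * cnj (g \<eta>) * cis (- 2 * pi * (\<tau> \<bullet> \<eta>)))"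

lemma smooth_has_derivative:
  "smooth f \<Longrightarrow> (f has_derivative frechet_derivative f (at x)) (at x)"
  using smooth_differentiable frechet_derivative_works by blast

lemma smooth_borel_matrix:
  assumes "smooth f"
  shows "(\<lambda>x. f (L *v x)) \<in> borel_measurable borel"
  by (rule smooth_borel[OF assms]) simp

text \<open>Integrability comes from \<open>g\<close> alone and \<open>f\<close> is merely bounded,
  so \<open>L\<close> is arbitrary and may even be singular.\<close>

lemma integrable_osc:
  assumes f: "smooth_compact_support f" and g: "smooth_compact_support g"
  shows "integrable lborel (\<lambda>\<eta>. f (L *v \<eta>) * cnj (g \<eta>) * cis (- 2 * pi * (\<tau> \<bullet> \<eta>)))"
proof -
  obtain M where M: "M \<ge> 0" "\<And>x. norm (f x) \<le> M" using compact_support_bounded[OF f] by blast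
  have sm: "smooth f" "smooth g" using f g by (simp_all add: smooth_compact_support_def)
  have [measurable]: "(\<lambda>\<eta>. f (L *v \<eta>)) \<in> borel_measurable borel" "g \<in> borel_measurable borel"
    using smooth_borel_matrix[OF sm(1)] smooth_borel[OF sm(2), of "\<lambda>x. x" borel] by simp_all
  show ?thesis
  proof (rule Bochner_Integration.integrable_bound)
    show "integrable lborel (\<lambda>\<eta>. M *\<^sub>R g \<eta>)" using integrable_compact_support[OF g] by simp
    show "AE \<eta> in lborel. norm (f (L *v \<eta>) * cnj (g \<eta>) * cis (- 2 * pi * (\<tau> \<bullet> \<eta>))) \<le> norm (M *\<^sub>R g \<eta>)"
      using M by (intro AE_I2) (simp add: norm_mult mult_right_mono)
  qed measurable
qed

lemma norm_osc_le:
  assumes f: "smooth_compact_support f" and g: "smooth_compact_support g"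
  obtains C where "\<And>L \<tau>. norm (osc f g L \<tau>) \<le> C"
proof -
  obtain M where M: "M \<ge> 0" "\<And>x. norm (f x) \<le> M" using compact_support_bounded[OF f] by blast
  have "norm (osc f g L \<tau>) \<le> (LINT \<eta>|lborel. M * norm (g \<eta>))" for L \<tau>
    unfolding osc_def
    by (rule order_trans[OF integral_norm_bound integral_mono_AE'])
       (use integrable_compact_support[OF g] M in \<open>auto simp: norm_mult mult_right_mono\<close>)
  thus ?thesis by (rule that)
qed

text \<open>The derivative of the whole integrand in direction \<open>j\<close> has integral 0. Its
  phase part gives the left side, and the chain rule gives column \<open>j\<close> of
  \<open>L\<close> with the partial derivatives of \<open>f\<close>. The matrix enters the right
  side only through these linear coefficients and the integrals themselves, which is what makes
  uniform bounds possible.\<close>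

lemma osc_by_parts:
  assumes f: "smooth_compact_support f" and g: "smooth_compact_support g"
  shows "\<i> * of_real (2 * pi * \<tau> $ j) * osc f g L \<tau> =
    (\<Sum>i\<in>UNIV. of_real (L $ i $ j) * osc (partial i f) g L \<tau>) + osc f (partial j g) L \<tau>"
proof -
  have sm: "smooth f" "smooth g" using f g by (simp_all add: smooth_compact_support_def)
  let ?e = "\<lambda>\<eta>. cis (- 2 * pi * (\<tau> \<bullet> \<eta>))"
  let ?F = "\<lambda>\<eta>. f (L *v \<eta>) * cnj (g \<eta>) * ?e \<eta>"
  define F' where "F' \<eta> v =
     (frechet_derivative f (at (L *v \<eta>)) (L *v v) * cnj (g \<eta>) + f (L *v \<eta>) * cnj (frechet_derivative g (at \<eta>) v)) * ?e \<eta>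
     + f (L *v \<eta>) * cnj (g \<eta>) * (?e \<eta> * (- \<i> * of_real (2 * pi * (\<tau> \<bullet> v))))" for \<eta> v
  have lin: "bounded_linear ((*v) L)" by (simp add: linear_conv_bounded_linear[symmetric])
  have der: "(?F has_derivative F' \<eta>) (at \<eta>)" for \<eta>
  proof -
    have df: "((\<lambda>\<eta>. f (L *v \<eta>)) has_derivative (\<lambda>v. frechet_derivative f (at (L *v \<eta>)) (L *v v))) (at \<eta>)"
      by (rule has_derivative_compose[OF bounded_linear.has_derivative[OF lin has_derivative_ident] smooth_has_derivative[OF sm(1)]])
    have dg: "((\<lambda>\<eta>. cnj (g \<eta>)) has_derivative (\<lambda>v. cnj (frechet_derivative g (at \<eta>) v))) (at \<eta>)"
      by (rule bounded_linear.has_derivative[OF bounded_linear_cnj smooth_has_derivative[OF sm(2)]])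
    have de: "(?e has_derivative (\<lambda>v. ?e \<eta> * (- \<i> * of_real (2 * pi * (\<tau> \<bullet> v))))) (at \<eta>)"
    proof -
      have "((\<lambda>\<eta>. \<i> * of_real (- 2 * pi * (\<tau> \<bullet> \<eta>))) has_derivative (\<lambda>v. - \<i> * of_real (2 * pi * (\<tau> \<bullet> v)))) (at \<eta>)"
        by (auto intro!: derivative_eq_intros bounded_linear.has_derivative[OF bounded_linear_of_real])
      from has_derivative_compose[OF this DERIV_exp[unfolded has_field_derivative_def]]
      show ?thesis by (simp add: cis_conv_exp)
    qed
    show ?thesis
      by (rule has_derivative_eq_rhs[OF has_derivative_mult[OF has_derivative_mult[OF df dg] de]])
         (simp add: F'_def fun_eq_iff algebra_simps)
  qed
  have col: "L *v axis j 1 = (\<Sum>i\<in>UNIV. L $ i $ j *\<^sub>R axis i 1)"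
    by (simp add: vec_eq_iff matrix_vector_mult_def axis_def if_distrib cong: if_cong)
  have part: "F' \<eta> (axis j 1) = (\<Sum>i\<in>UNIV. of_real (L $ i $ j) * (partial i f (L *v \<eta>) * cnj (g \<eta>) * ?e \<eta>))
      + f (L *v \<eta>) * cnj (partial j g \<eta>) * ?e \<eta> - \<i> * of_real (2 * pi * \<tau> $ j) * ?F \<eta>" for \<eta>
  proof -
    have lin: "linear (frechet_derivative f (at (L *v \<eta>)))"
      using smooth_has_derivative[OF sm(1)] by (rule has_derivative_linear)
    have "frechet_derivative f (at (L *v \<eta>)) (L *v axis j 1) =
        (\<Sum>i\<in>UNIV. of_real (L $ i $ j) * partial i f (L *v \<eta>))"
      unfolding col linear_sum[OF lin] linear_cmul[OF lin] by (simp add: scaleR_conv_of_real partial_def)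
    thus ?thesis
      by (simp add: F'_def inner_axis partial_def distrib_right distrib_left sum_distrib_right sum_distrib_left mult_ac)
  qed
  obtain Bg where Bg: "\<And>x. g x \<noteq> 0 \<Longrightarrow> norm x \<le> Bg" using compact_support_radius[OF g] by blast
  have int1: "integrable lborel (\<lambda>\<eta>. partial i f (L *v \<eta>) * cnj (g \<eta>) * ?e \<eta>)" for i
    by (rule integrable_osc[OF smooth_compact_support_partial[OF f] g])
  have int2: "integrable lborel (\<lambda>\<eta>. f (L *v \<eta>) * cnj (partial j g \<eta>) * ?e \<eta>)"
    by (rule integrable_osc[OF f smooth_compact_support_partial[OF g]])
  have int3: "integrable lborel ?F" by (rule integrable_osc[OF f g])
  \<comment> \<open>This bound depends on \<open>L\<close> and \<tau>, which is harmless: it only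
    dominates the difference quotients of this one integrand.\<close>
  have bd: "\<exists>M. \<forall>\<eta>. norm (F' \<eta> (axis j 1)) \<le> M"
  proof -
    obtain Mf where Mf: "\<And>x. norm (f x) \<le> Mf" using compact_support_bounded[OF f] by blast
    obtain Mg where Mg: "\<And>x. norm (g x) \<le> Mg" using compact_support_bounded[OF g] by blast
    obtain Mg' where Mg': "\<And>x. norm (partial j g x) \<le> Mg'"
      using compact_support_bounded[OF smooth_compact_support_partial[OF g]] by blast
    have "\<forall>i. \<exists>M. \<forall>x. norm (partial i f x) \<le> M"
      using compact_support_bounded[OF smooth_compact_support_partial[OF f]] by metis
    then obtain Mf' where Mf': "\<And>i x. norm (partial i f x) \<le> Mf' i" by metis
    have "norm (F' \<eta> (axis j 1)) \<le> (\<Sum>i\<in>UNIV. \<bar>L $ i $ j\<bar> * (Mf' i * Mg)) + Mf * Mg' + 2 * pi * \<bar>\<tau> $ j\<bar> * (Mf * Mg)" for \<eta>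
    proof -
      have p: "norm (a * cnj b * cis c) \<le> A * B'" if "norm a \<le> A" "norm b \<le> B'" for a b c A B'
        using that norm_ge_zero[of a] norm_ge_zero[of b] by (simp add: norm_mult mult_mono')
      have "norm (\<Sum>i\<in>UNIV. of_real (L $ i $ j) * (partial i f (L *v \<eta>) * cnj (g \<eta>) * ?e \<eta>)) \<le>
         (\<Sum>i\<in>UNIV. \<bar>L $ i $ j\<bar> * (Mf' i * Mg))"
        by (rule sum_norm_le, subst norm_mult, simp only: norm_of_real)
           (intro mult_left_mono p Mf' Mg abs_ge_zero)
      moreover have "norm (f (L *v \<eta>) * cnj (partial j g \<eta>) * ?e \<eta>) \<le> Mf * Mg'"
        by (intro p Mf Mg')
      moreover have "norm (\<i> * of_real (2 * pi * \<tau> $ j) * ?F \<eta>) \<le> 2 * pi * \<bar>\<tau> $ j\<bar> * (Mf * Mg)"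
        using mult_left_mono[OF p[OF Mf Mg], of "2 * pi * \<bar>\<tau> $ j\<bar>" "L *v \<eta>" \<eta> "- 2 * pi * (\<tau> \<bullet> \<eta>)"]
        by (simp add: norm_mult abs_mult)
      ultimately show ?thesis
        unfolding part by (meson norm_triangle_le norm_triangle_le_diff order_trans add_mono order_refl)
    qed
    thus ?thesis by blast
  qed
  have "(LINT \<eta>|lborel. F' \<eta> (axis j 1)) = 0"
  proof -
    obtain M where M: "\<And>\<eta>. norm (F' \<eta> (axis j 1)) \<le> M" using bd by blast
    show ?thesis
      by (rule integral_directional_derivative_eq_zero[OF der _ M, where B = Bg]) (use Bg in auto)
  qed
  moreover have "(LINT \<eta>|lborel. F' \<eta> (axis j 1)) =
    (\<Sum>i\<in>UNIV. of_real (L $ i $ j) * osc (partial i f) g L \<tau>) + osc f (partial j g) L \<tau>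
      - \<i> * of_real (2 * pi * \<tau> $ j) * osc f g L \<tau>"
    unfolding part osc_def using int1 int2 int3
    by (simp add: Bochner_Integration.integral_sum)
  ultimately show ?thesis by simp
qed

text \<open>\<open>f\<close> and \<open>g\<close> are generalised in the induction because each
  integration by parts replaces one of them by a partial derivative. The new constant is a sum of
  those for the derivatives, weighted by \<open>M\<close>, and so is independent of \<open>L\<close>
  and \<tau>.\<close>

lemma osc_decay_list:
  assumes "smooth_compact_support f" and "smooth_compact_support g" and "M \<ge> 0"
  shows "\<exists>C\<ge>0. \<forall>L \<tau>. (\<forall>i j. \<bar>L $ i $ j\<bar> \<le> M) \<longrightarrow> (\<Prod>j\<leftarrow>js. \<bar>\<tau> $ j\<bar>) * norm (osc f g L \<tau>) \<le> C"
  using assms(1,2)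
proof (induction js arbitrary: f g)
  case Nil
  then obtain C where "\<And>L \<tau>. norm (osc f g L \<tau>) \<le> C" using norm_osc_le by blast
  thus ?case by (intro exI[of _ "max 0 C"]) (simp add: le_max_iff_disj)
next
  case (Cons j js)
  let ?P = "\<lambda>\<tau>. \<Prod>j\<leftarrow>js. \<bar>\<tau> $ j\<bar>"
  have "\<forall>i. \<exists>C\<ge>0. \<forall>L \<tau>. (\<forall>i j. \<bar>L $ i $ j\<bar> \<le> M) \<longrightarrow> ?P \<tau> * norm (osc (partial i f) g L \<tau>) \<le> C"
    using Cons.IH[OF smooth_compact_support_partial[OF Cons.prems(1)] Cons.prems(2)] by blast
  then obtain C where C: "\<And>i. C i \<ge> 0"
    "\<And>i L \<tau>. \<forall>i j. \<bar>L $ i $ j\<bar> \<le> M \<Longrightarrow> ?P \<tau> * norm (osc (partial i f) g L \<tau>) \<le> C i" by metis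
  obtain C' where C': "C' \<ge> 0"
    "\<And>L \<tau>. \<forall>i j. \<bar>L $ i $ j\<bar> \<le> M \<Longrightarrow> ?P \<tau> * norm (osc f (partial j g) L \<tau>) \<le> C'"
    using Cons.IH[OF Cons.prems(1) smooth_compact_support_partial[OF Cons.prems(2)]] by metis
  have "\<bar>\<tau> $ j\<bar> * ?P \<tau> * norm (osc f g L \<tau>) \<le> (\<Sum>i\<in>UNIV. M * C i) + C'" if L: "\<forall>i j. \<bar>L $ i $ j\<bar> \<le> M" for L \<tau>
  proof -
    have P: "?P \<tau> \<ge> 0" by (induction js) auto
    have "2 * pi * (\<bar>\<tau> $ j\<bar> * norm (osc f g L \<tau>)) = norm (\<i> * of_real (2 * pi * \<tau> $ j) * osc f g L \<tau>)"
      by (simp add: norm_mult abs_mult)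
    also have "\<dots> \<le> (\<Sum>i\<in>UNIV. M * norm (osc (partial i f) g L \<tau>)) + norm (osc f (partial j g) L \<tau>)"
      unfolding osc_by_parts[OF Cons.prems]
      by (intro norm_triangle_mono sum_norm_le order_refl) (use L in \<open>simp add: norm_mult mult_right_mono\<close>)
    finally have "?P \<tau> * (2 * pi * (\<bar>\<tau> $ j\<bar> * norm (osc f g L \<tau>))) \<le>
        ?P \<tau> * ((\<Sum>i\<in>UNIV. M * norm (osc (partial i f) g L \<tau>)) + norm (osc f (partial j g) L \<tau>))"
      using P by (intro mult_left_mono)
    also have "\<dots> = (\<Sum>i\<in>UNIV. M * (?P \<tau> * norm (osc (partial i f) g L \<tau>))) + ?P \<tau> * norm (osc f (partial j g) L \<tau>)"
      by (simp add: distrib_left sum_distrib_left mult_ac)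
    also have "\<dots> \<le> (\<Sum>i\<in>UNIV. M * C i) + C'"
      using C(2)[OF L] C'(2)[OF L] \<open>M \<ge> 0\<close> by (intro add_mono sum_mono mult_left_mono) auto
    finally have "2 * pi * (\<bar>\<tau> $ j\<bar> * ?P \<tau> * norm (osc f g L \<tau>)) \<le> (\<Sum>i\<in>UNIV. M * C i) + C'"
      by (simp add: mult_ac)
    moreover have "1 * (\<bar>\<tau> $ j\<bar> * ?P \<tau> * norm (osc f g L \<tau>)) \<le> 2 * pi * (\<bar>\<tau> $ j\<bar> * ?P \<tau> * norm (osc f g L \<tau>))"
      using pi_gt3 P by (intro mult_right_mono) auto
    ultimately show ?thesis by linarith
  qed
  moreover have "(\<Sum>i\<in>UNIV. M * C i) + C' \<ge> 0"
    using C(1) C'(1) \<open>M \<ge> 0\<close> by (intro add_nonneg_nonneg sum_nonneg) auto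
  ultimately show ?case by (intro exI[of _ "(\<Sum>i\<in>UNIV. M * C i) + C'"]) simp
qed

text \<open>The exponent 1 in each coordinate corresponds to one integration by parts per
  coordinate; already its q-th power is integrable for q > 1.\<close>

definition decay :: "real ^ 'm::finite \<Rightarrow> real" where
  "decay \<tau> = (\<Prod>j\<in>UNIV. 1 / max 1 \<bar>\<tau> $ j\<bar>)"

lemma decay_pos: "decay \<tau> > 0"
  unfolding decay_def by (intro prod_pos) auto

lemma decay_borel [measurable]: "decay \<in> borel_measurable borel"
  unfolding decay_def[abs_def] by measurable

theorem osc_decay:
  assumes f: "smooth_compact_support f" and g: "smooth_compact_support g" and "M \<ge> 0"
  obtains C where "C \<ge> 0" and "\<And>L \<tau>. (\<And>i j. \<bar>L $ i $ j\<bar> \<le> M) \<Longrightarrow> norm (osc f g L \<tau>) \<le> C * decay \<tau>"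
proof -
  have "\<forall>A :: 'a set. \<exists>C\<ge>0. \<forall>L \<tau>. (\<forall>i j. \<bar>L $ i $ j\<bar> \<le> M) \<longrightarrow> (\<Prod>j\<in>A. \<bar>\<tau> $ j\<bar>) * norm (osc f g L \<tau>) \<le> C"
  proof
    fix A :: "'a set"
    obtain xs where xs: "set xs = A" "distinct xs" using finite_distinct_list[of A] by auto
    have "(\<Prod>j\<leftarrow>xs. \<bar>\<tau> $ j\<bar>) = (\<Prod>j\<in>A. \<bar>\<tau> $ j\<bar>)" for \<tau> :: "real ^ 'a"
      using prod.distinct_set_conv_list[OF xs(2), of "\<lambda>j. \<bar>\<tau> $ j\<bar>"] xs(1) by simp
    thus "\<exists>C\<ge>0. \<forall>L \<tau>. (\<forall>i j. \<bar>L $ i $ j\<bar> \<le> M) \<longrightarrow> (\<Prod>j\<in>A. \<bar>\<tau> $ j\<bar>) * norm (osc f g L \<tau>) \<le> C"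
      using osc_decay_list[OF assms, of xs] by simp
  qed
  then obtain C where C: "\<And>A. C A \<ge> 0"
    "\<And>A L \<tau>. \<forall>i j. \<bar>L $ i $ j\<bar> \<le> M \<Longrightarrow> (\<Prod>j\<in>A. \<bar>\<tau> $ j\<bar>) * norm (osc f g L \<tau>) \<le> C A" by metis
  show ?thesis
  proof (rule that)
    show "(\<Sum>A\<in>UNIV. C A) \<ge> 0" by (intro sum_nonneg C(1))
    fix L :: "real ^ 'a ^ 'a" and \<tau> :: "real ^ 'a" assume L: "\<And>i j. \<bar>L $ i $ j\<bar> \<le> M"
    \<comment> \<open>Integrating by parts only in the coordinates where the entry of \<tau> is at
      least 1 in absolute value produces exactly the product of the maxima. This set varies with
      \<tau>, so the constant sums over all subsets.\<close>
    let ?A = "{j. 1 \<le> \<bar>\<tau> $ j\<bar>}"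
    have "(\<Prod>j\<in>UNIV. max 1 \<bar>\<tau> $ j\<bar>) = (\<Prod>j\<in>?A. \<bar>\<tau> $ j\<bar>)"
      by (rule prod.mono_neutral_cong_right) (auto simp: max_def)
    hence "(\<Prod>j\<in>UNIV. max 1 \<bar>\<tau> $ j\<bar>) * norm (osc f g L \<tau>) \<le> C ?A"
      using C(2)[of L \<tau> ?A] L by simp
    also have "\<dots> \<le> (\<Sum>A\<in>UNIV. C A)"
      by (rule member_le_sum) (auto simp: C(1))
    finally have "(\<Prod>j\<in>UNIV. max 1 \<bar>\<tau> $ j\<bar>) * norm (osc f g L \<tau>) \<le> (\<Sum>A\<in>UNIV. C A)" .
    moreover have "(\<Prod>j\<in>UNIV. max 1 \<bar>\<tau> $ j\<bar>) > 0" by (intro prod_pos) auto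
    ultimately show "norm (osc f g L \<tau>) \<le> (\<Sum>A\<in>UNIV. C A) * decay \<tau>"
      by (simp add: decay_def prod_dividef pos_le_divide_eq mult.commute)
  qed
qed


lemma nn_integral_max_powr_finite:
  fixes q :: real
  assumes "q > 1"
  shows "(\<integral>\<^sup>+t. ennreal ((1 / max 1 \<bar>t\<bar>) powr q) \<partial>lborel) < \<infinity>"
proof -
  let ?g = "\<lambda>t::real. ennreal (t powr (- q)) * indicator {1..} t"
  have g: "(\<integral>\<^sup>+t. ?g t \<partial>lborel) < \<infinity>"
  proof -
    have "(\<integral>\<^sup>+t. ?g t \<partial>lborel) = ennreal (0 - 1 powr (1 - q) / (1 - q))"
    proof (rule nn_integral_FTC_atLeast[where F = "\<lambda>x. x powr (1 - q) / (1 - q)"])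
      show "((\<lambda>x. x powr (1 - q) / (1 - q)) has_real_derivative x powr (- q)) (at x)" if "1 \<le> x" for x
        using that assms by (auto intro!: derivative_eq_intros)
      have "((\<lambda>x. x powr (1 - q)) \<longlongrightarrow> 0) at_top"
        using assms by (intro tendsto_neg_powr filterlim_ident) auto
      from tendsto_divide[OF this tendsto_const[of "1 - q"]] assms
      show "((\<lambda>x. x powr (1 - q) / (1 - q)) \<longlongrightarrow> 0) at_top" by simp
    qed auto
    thus ?thesis by simp
  qed
  have g': "(\<integral>\<^sup>+t. ?g (- t) \<partial>lborel) < \<infinity>"
    using nn_integral_real_affine[of ?g "-1" 0] g by simp
  have i: "(\<integral>\<^sup>+t. indicator {-1..1::real} t \<partial>lborel) < (\<infinity> :: ennreal)"
    by simp
  have "(\<integral>\<^sup>+t. ennreal ((1 / max 1 \<bar>t\<bar>) powr q) \<partial>lborel) \<le>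
      (\<integral>\<^sup>+t. (indicator {-1..1::real} t + ?g t) + ?g (- t) \<partial>lborel)"
  proof (rule nn_integral_mono)
    fix t :: real
    have inv: "(1 / u) powr q = u powr (- q)" for u :: real
      by (simp add: powr_minus powr_divide inverse_eq_divide)
    consider "\<bar>t\<bar> \<le> 1" | "t > 1" | "t < -1" by linarith
    thus "ennreal ((1 / max 1 \<bar>t\<bar>) powr q) \<le> (indicator {-1..1::real} t + ?g t) + ?g (- t)"
    proof cases
      case 1
      hence "max 1 \<bar>t\<bar> = 1" by simp
      hence "ennreal ((1 / max 1 \<bar>t\<bar>) powr q) = 1" by simp
      moreover have "indicator {-1..1::real} t = (1 :: ennreal)"
        using 1 by (auto simp: indicator_def abs_le_iff)
      ultimately show ?thesis by (metis add.assoc le_iff_add)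
    next
      case 2
      hence "max 1 \<bar>t\<bar> = t" by simp
      thus ?thesis using 2 by (simp add: inv)
    next
      case 3
      hence "max 1 \<bar>t\<bar> = - t" by simp
      thus ?thesis using 3 by (simp only: inv) simp
    qed
  qed
  also have "\<dots> = (\<integral>\<^sup>+t. indicator {-1..1::real} t \<partial>lborel) + (\<integral>\<^sup>+t. ?g t \<partial>lborel) + (\<integral>\<^sup>+t. ?g (- t) \<partial>lborel)"
    by (simp add: nn_integral_add)
  also have "\<dots> < \<infinity>" using i g g' by simp
  finally show ?thesis .
qed

lemma nn_integral_decay_powr_finite:
  assumes "q > 1"
  shows "(\<integral>\<^sup>+\<tau>. ennreal (decay (\<tau> :: real ^ 'm::finite) powr q) \<partial>lborel) < \<infinity>"
proof -
  have B: "(Basis :: (real ^ 'm) set) = range (\<lambda>i. axis i 1)" by (auto simp: Basis_vec_def)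
  have inj: "inj (\<lambda>i::'m. axis i (1::real))" by (auto simp: inj_def axis_eq_axis)
  have "ennreal (decay \<tau> powr q) = (\<Prod>b\<in>Basis. ennreal ((1 / max 1 \<bar>\<tau> \<bullet> b\<bar>) powr q))" for \<tau> :: "real ^ 'm"
    by (simp add: decay_def prod_powr_distrib B prod.reindex[OF inj] inner_axis prod_ennreal)
  hence "(\<integral>\<^sup>+\<tau>. ennreal (decay (\<tau> :: real ^ 'm) powr q) \<partial>lborel) =
      (\<Prod>b\<in>(Basis :: (real ^ 'm) set). \<integral>\<^sup>+t. ennreal ((1 / max 1 \<bar>t\<bar>) powr q) \<partial>lborel)"
    using nn_integral_lborel_prod[where f = "\<lambda>b t. ennreal ((1 / max 1 \<bar>t\<bar>) powr q)" and 'a = "real ^ 'm"]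
    by simp
  also have "\<dots> < \<infinity>"
    using nn_integral_max_powr_finite[OF assms] by (simp add: power_less_top_ennreal)
  finally show ?thesis .
qed

section \<open>The Fourier transform of a Schwartz function\<close>

text \<open>Integrable moments take the place of derivative bounds: the class is stable under
  multiplication by coordinates, which is what repeated differentiation of the Fourier transform
  produces.\<close>

definition rapidly_decreasing :: "(real ^ 'm::finite \<Rightarrow> complex) \<Rightarrow> bool" where
  "rapidly_decreasing f \<longleftrightarrow> f \<in> borel_measurable borel \<and> (\<forall>k. integrable lborel (\<lambda>x. norm x ^ k * norm (f x)))"

lemma fourier_eq_lborel:
  assumes [measurable]: "f \<in> borel_measurable borel"
  shows "fourier f \<omega> = (LINT x|lborel. f x * cis (- 2 * pi * (\<omega> \<bullet> x)))"
  unfolding fourier_def by (intro integral_completion) measurable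

lemma norm_cis_diff_le: "norm (cis (a + b) - cis a - \<i> * of_real b * cis a) \<le> b\<^sup>2 / 2"
proof -
  have "cis (a + b) - cis a - \<i> * of_real b * cis a = cis a * (cis b - 1 - \<i> * of_real b)"
    by (simp add: cis_mult[symmetric] algebra_simps)
  hence "norm (cis (a + b) - cis a - \<i> * of_real b * cis a) = norm (cis b - 1 - \<i> * of_real b)"
    by (simp add: norm_mult)
  also have "\<dots> \<le> b\<^sup>2 / 2"
    using iexp_approx1[of b 1] by (simp add: cis_conv_exp algebra_simps eval_nat_numeral)
  finally show ?thesis .
qed

lemma rapidly_decreasing_mult_inner:
  assumes f: "rapidly_decreasing f"
  shows "rapidly_decreasing (\<lambda>x. f x * (- 2 * pi * \<i> * of_real (v \<bullet> x)))"
  unfolding rapidly_decreasing_def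
proof (intro conjI allI)
  have [measurable]: "f \<in> borel_measurable borel" using f by (simp add: rapidly_decreasing_def)
  show "(\<lambda>x. f x * (- 2 * pi * \<i> * of_real (v \<bullet> x))) \<in> borel_measurable borel" by measurable
  fix k
  show "integrable lborel (\<lambda>x. norm x ^ k * norm (f x * (- 2 * pi * \<i> * of_real (v \<bullet> x))))"
  proof (rule Bochner_Integration.integrable_bound)
    show "integrable lborel (\<lambda>x. (2 * pi * norm v) * (norm x ^ Suc k * norm (f x)))"
      using f by (intro integrable_mult_right) (simp add: rapidly_decreasing_def del: power_Suc)
    show "AE x in lborel. norm (norm x ^ k * norm (f x * (- 2 * pi * \<i> * of_real (v \<bullet> x)))) \<le>
        norm ((2 * pi * norm v) * (norm x ^ Suc k * norm (f x)))"
    proof (rule AE_I2)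
      fix x
      have "norm (norm x ^ k * norm (f x * (- 2 * pi * \<i> * of_real (v \<bullet> x)))) = (2 * pi * norm x ^ k * norm (f x)) * \<bar>v \<bullet> x\<bar>"
        by (simp add: norm_mult abs_mult)
      also have "\<dots> \<le> (2 * pi * norm x ^ k * norm (f x)) * (norm v * norm x)"
        by (intro mult_left_mono Cauchy_Schwarz_ineq2) simp
      finally show "norm (norm x ^ k * norm (f x * (- 2 * pi * \<i> * of_real (v \<bullet> x)))) \<le>
        norm ((2 * pi * norm v) * (norm x ^ Suc k * norm (f x)))"
        by (simp add: abs_mult mult_ac)
    qed
  qed measurable
qed

lemma rapidly_decreasing_integrable:
  assumes "rapidly_decreasing f"
  shows "integrable lborel f"
proof -
  have m: "f \<in> borel_measurable borel" and "integrable lborel (\<lambda>x. norm x ^ 0 * norm (f x))"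
    using assms unfolding rapidly_decreasing_def by blast+
  hence "integrable lborel (\<lambda>x. norm (f x))" by simp
  thus ?thesis by (rule integrable_norm_cancel) (use m in simp)
qed

lemma integrable_mult_cis:
  assumes "integrable lborel f"
  shows "integrable lborel (\<lambda>x. f x * cis (c * (\<omega> \<bullet> x)))"
  by (rule Bochner_Integration.integrable_bound[OF assms]) (use assms in \<open>auto simp: norm_mult\<close>)

text \<open>The second-order Taylor remainder of the exponential, integrated against the second
  moment of \<open>f\<close>, bounds the error by a multiple of |h|^2.\<close>

lemma fourier_has_derivative:
  assumes f: "rapidly_decreasing f"
  shows "(fourier f has_derivative (\<lambda>v. fourier (\<lambda>x. f x * (- 2 * pi * \<i> * of_real (v \<bullet> x))) \<omega>)) (at \<omega>)"
proof -
  have [measurable]: "f \<in> borel_measurable borel" using f by (simp add: rapidly_decreasing_def)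
  let ?e = "\<lambda>\<omega> x. cis (- 2 * pi * (\<omega> \<bullet> x))"
  define D where "D v = (LINT x|lborel. f x * (- 2 * pi * \<i> * of_real (v \<bullet> x)) * ?e \<omega> x)" for v
  \<comment> \<open>From (2 pi (h . x))^2 / 2 and the Cauchy-Schwarz inequality, with |h|^2 taken
    out of the integral.\<close>
  define C where "C = (LINT x|lborel. (2 * pi\<^sup>2) * (norm x ^ 2 * norm (f x)))"
  have int: "integrable lborel (\<lambda>x. f x * ?e \<omega> x)" for \<omega>
    by (rule integrable_mult_cis[OF rapidly_decreasing_integrable[OF f]])
  have intD: "integrable lborel (\<lambda>x. f x * (- 2 * pi * \<i> * of_real (v \<bullet> x)) * ?e \<omega> x)" for v
    by (rule integrable_mult_cis[OF rapidly_decreasing_integrable[OF rapidly_decreasing_mult_inner[OF f]]])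
  have F: "fourier f \<omega> = (LINT x|lborel. f x * ?e \<omega> x)" for \<omega>
    by (rule fourier_eq_lborel) measurable
  have D: "fourier (\<lambda>x. f x * (- 2 * pi * \<i> * of_real (v \<bullet> x))) \<omega> = D v" for v
    unfolding D_def by (rule fourier_eq_lborel) measurable
  have linD: "linear D"
  proof (rule linearI)
    show "D (u + v) = D u + D v" for u v
      unfolding D_def using intD[of u] intD[of v]
      by (subst Bochner_Integration.integral_add[symmetric]) (auto simp: inner_add_left algebra_simps)
    show "D (c *\<^sub>R v) = c *\<^sub>R D v" for c v
      unfolding D_def by (subst integral_scaleR_right[symmetric], intro Bochner_Integration.integral_cong refl)
         (simp add: scaleR_conv_of_real[where 'a = complex] mult_ac)
  qed
  have est: "norm (fourier f (\<omega> + h) - fourier f \<omega> - D h) \<le> C * norm h ^ 2" for h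
  proof -
    let ?E = "\<lambda>x. f x * ?e (\<omega> + h) x - f x * ?e \<omega> x - f x * (- 2 * pi * \<i> * of_real (h \<bullet> x)) * ?e \<omega> x"
    have eq: "fourier f (\<omega> + h) - fourier f \<omega> - D h =
        (LINT x|lborel. ?E x)"
      unfolding F D_def using int[of \<omega>] int[of "\<omega> + h"] intD[of h] by simp
    have "norm (LINT x|lborel. ?E x) \<le> (LINT x|lborel. norm h ^ 2 * ((2 * pi\<^sup>2) * (norm x ^ 2 * norm (f x))))"
    proof (rule order_trans[OF integral_norm_bound integral_mono_AE'])
      show "integrable lborel (\<lambda>x. norm h ^ 2 * ((2 * pi\<^sup>2) * (norm x ^ 2 * norm (f x))))"
        using f by (intro integrable_mult_right) (simp add: rapidly_decreasing_def)
      show "AE x in lborel. norm (?E x)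
          \<le> norm h ^ 2 * ((2 * pi\<^sup>2) * (norm x ^ 2 * norm (f x)))"
      proof (rule AE_I2)
        fix x
        let ?a = "- 2 * pi * (\<omega> \<bullet> x)" and ?b = "- 2 * pi * (h \<bullet> x)"
        have "?E x =
            f x * (cis (?a + ?b) - cis ?a - \<i> * of_real ?b * cis ?a)"
          by (simp add: inner_add_left algebra_simps)
        hence "norm (?E x) \<le>
            norm (f x) * (?b\<^sup>2 / 2)"
          using norm_cis_diff_le[of ?a ?b] by (simp only: norm_mult) (intro mult_left_mono, auto)
        moreover have "?b\<^sup>2 / 2 \<le> 2 * pi\<^sup>2 * (norm h * norm x)\<^sup>2"
        proof -
          have "\<bar>h \<bullet> x\<bar>\<^sup>2 \<le> (norm h * norm x)\<^sup>2"
            by (intro power_mono Cauchy_Schwarz_ineq2) simp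
          thus ?thesis by (simp add: power_mult_distrib)
        qed
        hence "norm (f x) * (?b\<^sup>2 / 2) \<le> norm (f x) * (2 * pi\<^sup>2 * (norm h * norm x)\<^sup>2)"
          by (rule mult_left_mono) simp
        also have "\<dots> = norm h ^ 2 * ((2 * pi\<^sup>2) * (norm x ^ 2 * norm (f x)))"
          by (simp add: power_mult_distrib mult_ac)
        ultimately show "norm (?E x) \<le>
            norm h ^ 2 * ((2 * pi\<^sup>2) * (norm x ^ 2 * norm (f x)))"
          by linarith
      qed
    qed simp
    also have "\<dots> = C * norm h ^ 2" by (simp add: C_def)
    finally show ?thesis unfolding eq .
  qed
  have "(fourier f has_derivative D) (at \<omega>)"
    unfolding has_derivative_at
  proof
    show "bounded_linear D" using linD by (simp add: linear_conv_bounded_linear)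
    have "((\<lambda>h :: real ^ 'a. C * norm h) \<longlongrightarrow> C * norm (0 :: real ^ 'a)) (at 0)"
      by (intro tendsto_intros)
    hence lim: "((\<lambda>h :: real ^ 'a. C * norm h) \<longlongrightarrow> 0) (at 0)" by simp
    have "norm (fourier f (\<omega> + h) - fourier f \<omega> - D h) / norm h \<le> C * norm h" if "h \<noteq> 0" for h
      using est[of h] that by (simp add: divide_le_eq power2_eq_square mult.assoc)
    thus "((\<lambda>h. norm (fourier f (\<omega> + h) - fourier f \<omega> - D h) / norm h) \<longlongrightarrow> 0) (at 0)"
      by (intro tendsto_sandwich[OF _ _ tendsto_const lim]) (auto simp: eventually_at_filter)
  qed
  moreover have "(\<lambda>v. fourier (\<lambda>x. f x * (- 2 * pi * \<i> * of_real (v \<bullet> x))) \<omega>) = D"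
    by (rule ext) (rule D)
  ultimately show ?thesis by (simp only:)
qed

lemma smooth_fourier:
  assumes "rapidly_decreasing f"
  shows "smooth (fourier f)"
proof -
  \<comment> \<open>Each partial derivative is again the Fourier transform of a rapidly decreasing
    function, so the induction tracks the function under the transform.\<close>
  have "\<exists>g. rapidly_decreasing g \<and> iterated_partial is (fourier f) = fourier g" for "is"
  proof (induction "is")
    case Nil
    show ?case using assms by auto
  next
    case (Cons i "is")
    then obtain g where g: "rapidly_decreasing g" "iterated_partial is (fourier f) = fourier g" by blast
    have "frechet_derivative (fourier g) (at \<omega>) (axis i 1) =
        fourier (\<lambda>x. g x * (- 2 * pi * \<i> * of_real (axis i 1 \<bullet> x))) \<omega>" for \<omega>
      by (simp add: frechet_derivative_at[OF fourier_has_derivative[OF g(1)], symmetric])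
    thus ?case
      using rapidly_decreasing_mult_inner[OF g(1), of "axis i 1"] g(2) by auto
  qed
  hence "iterated_partial is (fourier f) differentiable (at x)" for "is" x
  proof -
    assume "\<And>is. \<exists>g. rapidly_decreasing g \<and> iterated_partial is (fourier f) = fourier g"
    then obtain g where "rapidly_decreasing g" "iterated_partial is (fourier f) = fourier g" by blast
    thus ?thesis using fourier_has_derivative[of g x] by (auto simp: differentiable_def)
  qed
  thus ?thesis by (simp add: smooth_def)
qed

lemma schwartz_rapidly_decreasing:
  fixes f :: "real ^ 'm::finite \<Rightarrow> complex"
  assumes "schwartz f"
  shows "rapidly_decreasing f"
  unfolding rapidly_decreasing_def
proof (intro conjI allI)
  have "smooth f" using assms by (simp add: schwartz_def)
  thus [measurable]: "f \<in> borel_measurable borel" using smooth_borel[of f "\<lambda>x. x" borel] by simp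
  fix k
  have bd: "\<exists>C. \<forall>x. norm x ^ k * norm (f x) \<le> C" for k
  proof -
    have "bounded (range (\<lambda>x. norm x ^ k *\<^sub>R iterated_partial [] f x))"
      using assms unfolding schwartz_def by blast
    thus ?thesis by (auto simp: bounded_iff)
  qed
  let ?d = "CARD('m)"
  \<comment> \<open>The square of the product of the d factors max(1, |x_j|) is at most 1 +
    |x|^(2d). Bounds for the orders k and k + 2d thus give a majorant by a multiple of the
    integrable square of \<open>decay\<close>.\<close>
  obtain C1 C2 where C: "\<And>x. norm x ^ k * norm (f x) \<le> C1" "\<And>x. norm x ^ (k + 2 * ?d) * norm (f x) \<le> C2"
    using bd by metis
  have C0: "C1 \<ge> 0" "C2 \<ge> 0"
  proof -
    have "0 \<le> norm (0 :: real ^ 'm) ^ j * norm (f 0)" for j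
      by (intro mult_nonneg_nonneg zero_le_power norm_ge_zero)
    thus "C1 \<ge> 0" "C2 \<ge> 0" using C[of 0] by (meson order_trans)+
  qed
  show "integrable lborel (\<lambda>x. norm x ^ k * norm (f x))"
  proof (rule Bochner_Integration.integrable_bound)
    have "integrable lborel (\<lambda>x :: real ^ 'm. decay x powr 2)"
      using nn_integral_decay_powr_finite[of 2, where 'm = 'm] by (intro integrableI_nonneg) auto
    thus "integrable lborel (\<lambda>x :: real ^ 'm. (C1 + C2) * decay x powr 2)" by simp
    show "AE x in lborel. norm (norm x ^ k * norm (f x)) \<le> norm ((C1 + C2) * decay x powr 2)"
    proof (rule AE_I2)
      fix x :: "real ^ 'm"
      let ?P = "\<Prod>j\<in>UNIV. max 1 \<bar>x $ j\<bar>"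
      have P: "?P > 0" by (intro prod_pos) auto
      have "?P \<le> (\<Prod>j\<in>(UNIV::'m set). max 1 (norm x))"
        by (intro prod_mono conjI max.mono component_le_norm_cart) auto
      hence "?P\<^sup>2 \<le> (max 1 (norm x) ^ ?d)\<^sup>2"
        using P by (intro power_mono) simp_all
      also have "\<dots> = max 1 (norm x) ^ (2 * ?d)"
        by (simp only: power_mult[symmetric] mult.commute[of _ 2])
      also have "\<dots> \<le> 1 + norm x ^ (2 * ?d)" by (auto simp: max_def)
      finally have "?P\<^sup>2 * (norm x ^ k * norm (f x)) \<le> (1 + norm x ^ (2 * ?d)) * (norm x ^ k * norm (f x))"
        by (intro mult_right_mono) auto
      also have "\<dots> = norm x ^ k * norm (f x) + norm x ^ (k + 2 * ?d) * norm (f x)"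
        by (simp add: algebra_simps power_add)
      also have "\<dots> \<le> C1 + C2" using C by (intro add_mono)
      finally have "norm x ^ k * norm (f x) \<le> (C1 + C2) * (1 / ?P\<^sup>2)"
        using zero_less_power[OF P, of 2] by (simp add: pos_le_divide_eq mult.commute)
      also have "1 / ?P\<^sup>2 = decay x powr 2"
        using decay_pos[of x] by (simp add: decay_def prod_dividef power_divide)
      finally show "norm (norm x ^ k * norm (f x)) \<le> norm ((C1 + C2) * decay x powr 2)"
        using C0 by simp
    qed
  qed measurable
qed

section \<open>The frame kernel as an oscillatory integral\<close>

text \<open>Provides a Borel representative of a generator, which itself is only Lebesgue
  measurable.\<close>

definition ift :: "('a::euclidean_space \<Rightarrow> complex) \<Rightarrow> 'a \<Rightarrow> complex" where
  "ift F x = (LINT \<omega>|lborel. F \<omega> * cis (2 * pi * (\<omega> \<bullet> x)))"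

lemma completion_ex_borel_measurable_complex:
  fixes f :: "'a \<Rightarrow> complex"
  assumes f: "f \<in> borel_measurable (completion M)"
  shows "\<exists>g\<in>borel_measurable M. AE x in M. f x = g x"
proof -
  have "(\<lambda>x. Re (f x)) \<in> borel_measurable (completion M)" "(\<lambda>x. Im (f x)) \<in> borel_measurable (completion M)"
    using f by measurable
  then obtain u v where uv: "u \<in> borel_measurable M" "AE x in M. Re (f x) = u x"
      "v \<in> borel_measurable M" "AE x in M. Im (f x) = v x"
    using completion_ex_borel_measurable_real by blast
  show ?thesis
  proof (intro bexI)
    show "AE x in M. f x = Complex (u x) (v x)"
      using uv(2,4) by eventually_elim (simp add: complex_eq_iff)
    show "(\<lambda>x. Complex (u x) (v x)) \<in> borel_measurable M"
      using uv(1,3) by (simp add: borel_measurable_complex_iff)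
  qed
qed

text \<open>A Lebesgue integrable function has a Borel version with the same transform, and the
  inversion theorem applies to that version. From here on generators can be exchanged for the
  inverse transforms of their Fourier transforms.\<close>

lemma L1_eq_ift:
  fixes f :: "'a::euclidean_space \<Rightarrow> complex"
  assumes f: "in_L1 f" and F: "integrable lborel (fourier f)"
  shows "AE x in lborel. f x = ift (fourier f) x"
    and "integrable lborel (ift (fourier f))"
    and "(LINT x|lborel. ift (fourier f) x * cis (- 2 * pi * (\<omega> \<bullet> x))) = fourier f \<omega>"
proof -
  have fint: "integrable (completion lborel) f" using f by (simp add: in_L1_def)
  obtain g where g [measurable]: "g \<in> borel_measurable lborel" and fg: "AE x in lborel. f x = g x"
    using completion_ex_borel_measurable_complex[OF borel_measurable_integrable[OF fint]] by blast
  have gm: "g \<in> borel_measurable (completion lborel)" using g by (rule measurable_completion)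
  have fm: "f \<in> borel_measurable (completion lborel)" using fint by simp
  have cm: "(\<lambda>x. cis (- 2 * pi * (\<omega> \<bullet> x))) \<in> borel_measurable (completion lborel)" for \<omega> :: 'a
    by (rule measurable_completion) measurable
  have "integrable (completion lborel) g"
    using fint by (rule integrable_cong_AE_imp[OF _ gm]) (use AE_completion[OF fg] in auto)
  hence gint: "integrable lborel g" using g by (simp add: integrable_completion)
  have Fg: "fourier f \<omega> = (LINT x|lborel. g x * cis (- 2 * pi * (\<omega> \<bullet> x)))" for \<omega>
  proof -
    have "fourier f \<omega> = (LINT x|lebesgue. g x * cis (- 2 * pi * (\<omega> \<bullet> x)))"
      unfolding fourier_def
      by (rule integral_cong_AE)
         (use AE_completion[OF fg] gm fm cm in \<open>auto intro!: borel_measurable_times\<close>)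
    thus ?thesis by (subst (asm) integral_completion) simp_all
  qed
  have inv: "AE x in lborel. g x = ift (fourier f) x"
    using fourier_inversion[OF gint] F unfolding ift_def Fg[abs_def] by simp
  show eq: "AE x in lborel. f x = ift (fourier f) x"
    using fg inv by eventually_elim simp
  have [measurable]: "fourier f \<in> borel_measurable borel" using F by auto
  have im [measurable]: "ift (fourier f) \<in> borel_measurable borel"
    unfolding ift_def[abs_def] by measurable
  show "integrable lborel (ift (fourier f))"
    using gint by (rule integrable_cong_AE_imp) (use inv in auto)
  show "(LINT x|lborel. ift (fourier f) x * cis (- 2 * pi * (\<omega> \<bullet> x))) = fourier f \<omega>"
    unfolding Fg[of \<omega>] by (rule integral_cong_AE) (use inv in auto)
qed

text \<open>Null sets stay null under affine bijections; this allows the exchange of a generator for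
  its representative inside a shifted, sheared and dilated argument.\<close>

lemma AE_lborel_affine:
  assumes A: "scales_lborel A c" and P: "AE x in lborel. P x"
  shows "AE z in lborel. P (A *v (z - t))"
proof -
  obtain N where "{x \<in> space lborel. \<not> P x} \<subseteq> N" "emeasure lborel N = 0" "N \<in> sets lborel"
    using P by (rule AE_E)
  hence N: "N \<in> sets borel" "emeasure lborel N = 0" "\<And>x. \<not> P x \<Longrightarrow> x \<in> N" by auto
  have m: "(*v) A -` N \<in> sets borel"
    using measurable_sets[OF borel_measurable_matrix_vector N(1), of A] by simp
  hence n: "(*v) A -` N \<in> null_sets lborel"
    using A N by (auto simp: scales_lborel_iff_emeasure null_sets_def)
  have "(\<integral>\<^sup>+z. indicator ((*v) A -` N) (z - t) \<partial>lborel) = (0 :: ennreal)"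
    using n m by (subst nn_integral_lborel_translate) auto
  hence "AE z in lborel. indicator ((*v) A -` N) (z - t) = (0 :: ennreal)"
    using m by (subst (asm) nn_integral_0_iff_AE) auto
  thus ?thesis
    by eventually_elim (use N(3) in \<open>auto simp: indicator_eq_0_iff\<close>)
qed

text \<open>A form of Parseval that stays within L1: only the second factor is written as an inverse
  Fourier integral. Fubini applies because \<open>f\<close> and \<open>G\<close> are integrable in
  separate variables, and the integral over z is then the transform \<open>F\<close> at the
  transposed relative matrix applied to the frequency.\<close>

lemma inner_affine_eq_osc:
  fixes T T' Ti Ti' :: "real ^ 'm::finite ^ 'm"
  assumes f: "integrable lborel f" and g: "integrable lborel (ift G)"
    and F: "\<And>\<omega>. (LINT x|lborel. f x * cis (- 2 * pi * (\<omega> \<bullet> x))) = F \<omega>"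
    and G: "integrable lborel G"
    and T: "scales_lborel T c" "T ** Ti = mat 1" "Ti ** T = mat 1"
    and T': "scales_lborel T' c'" "T' ** Ti' = mat 1" "Ti' ** T' = mat 1"
  shows "(LINT z|lborel. f (Ti' *v (z - t')) * cnj (ift G (Ti *v (z - t)))) =
    c' *\<^sub>R osc F G (transpose (Ti ** T')) (Ti *v (t' - t))"
proof -
  define W where "W = Ti' ** T"
  define V where "V = Ti ** T'"
  define \<tau> where "\<tau> = Ti *v (t' - t)"
  note [measurable] = borel_measurable_integrable[OF f, simplified] borel_measurable_integrable[OF g, simplified]
    borel_measurable_integrable[OF G, simplified]
  have c: "c > 0" using T by (simp add: scales_lborel_pos)
  have sV: "scales_lborel V (c' / c)"
    unfolding V_def using scales_lborel_mult[OF scales_lborel_inverse[OF T] T'(1)] by simp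
  have sW: "scales_lborel W (c / c')"
    unfolding W_def using scales_lborel_mult[OF scales_lborel_inverse[OF T'] T(1)] by simp
  have WV: "W *v (V *v u) = u" for u
  proof -
    have "W *v (V *v u) = Ti' *v (T *v (Ti *v (T' *v u)))"
      by (simp add: W_def V_def matrix_vector_mul_assoc[symmetric])
    also have "T *v (Ti *v (T' *v u)) = T' *v u"
      by (subst matrix_vector_mul_assoc) (simp add: T del: matrix_vector_mul_assoc)
    also have "Ti' *v (T' *v u) = u" by (simp add: matrix_vector_mul_assoc T')
    finally show ?thesis .
  qed
  \<comment> \<open>After the substitution T z + t, which straightens the second factor, the first
    one becomes a linear map of z centred at the relative translation \<tau>.\<close>
  have arg: "Ti' *v (T *v z + t - t') = W *v (z - \<tau>)" for z
  proof -
    have "W *v \<tau> = Ti' *v ((T ** Ti) *v (t' - t))"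
      by (simp add: W_def \<tau>_def matrix_vector_mul_assoc matrix_mul_assoc)
    also have "\<dots> = Ti' *v (t' - t)" by (simp add: T)
    finally have "W *v (z - \<tau>) = W *v z - Ti' *v (t' - t)"
      by (simp add: matrix_vector_mult_diff_distrib)
    also have "\<dots> = Ti' *v (T *v z) - Ti' *v (t' - t)"
      by (simp add: W_def matrix_vector_mul_assoc)
    also have "\<dots> = Ti' *v (T *v z - (t' - t))"
      by (simp only: matrix_vector_mult_diff_distrib)
    also have "T *v z - (t' - t) = T *v z + t - t'" by simp
    finally show ?thesis by simp
  qed
  let ?h = "\<lambda>z. f (Ti' *v (z - t')) * cnj (ift G (Ti *v (z - t)))"
  have "(LINT z|lborel. ?h z) = (LINT z|lborel. ?h (z + t))"
    using integral_lborel_translate[of ?h "- t"] by simp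
  also have "\<dots> = c *\<^sub>R (LINT z|lborel. ?h (T *v z + t))"
    by (rule integral_lborel_matrix[OF T(1)]) measurable
  also have "(LINT z|lborel. ?h (T *v z + t)) = (LINT z|lborel. f (W *v (z - \<tau>)) * cnj (ift G z))"
    by (simp add: arg matrix_vector_mul_assoc T)
  also have "\<dots> = (LINT z|lborel. LINT \<eta>|lborel. f (W *v (z - \<tau>)) * cnj (G \<eta>) * cis (- 2 * pi * (\<eta> \<bullet> z)))"
  proof (intro Bochner_Integration.integral_cong refl)
    fix z
    have "cnj (ift G z) = (LINT \<eta>|lborel. cnj (G \<eta> * cis (2 * pi * (\<eta> \<bullet> z))))"
      by (simp add: ift_def del: complex_cnj_mult)
    hence "f (W *v (z - \<tau>)) * cnj (ift G z) = (LINT \<eta>|lborel. f (W *v (z - \<tau>)) * cnj (G \<eta> * cis (2 * pi * (\<eta> \<bullet> z))))"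
      by (simp only: integral_mult_right_zero)
    thus "f (W *v (z - \<tau>)) * cnj (ift G z) = (LINT \<eta>|lborel. f (W *v (z - \<tau>)) * cnj (G \<eta>) * cis (- 2 * pi * (\<eta> \<bullet> z)))"
      by (simp add: cis_cnj mult.assoc)
  qed
  also have "\<dots> = (LINT \<eta>|lborel. LINT z|lborel. f (W *v (z - \<tau>)) * cnj (G \<eta>) * cis (- 2 * pi * (\<eta> \<bullet> z)))"
  proof (rule lborel_pair.Fubini_integral[symmetric])
    have "integrable lborel (\<lambda>z. f (W *v (z - \<tau>)))"
      by (rule integrable_lborel_translate[OF integrable_lborel_matrix[OF sW f]])
    moreover have "integrable lborel (\<lambda>\<eta>. cnj (G \<eta>))" using G by simp
    ultimately have "integrable (lborel \<Otimes>\<^sub>M lborel) (\<lambda>(z, \<eta>). f (W *v (z - \<tau>)) * cnj (G \<eta>))"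
      by (rule integrable_lborel_pair_mult)
    thus "integrable (lborel \<Otimes>\<^sub>M lborel) (\<lambda>(z, \<eta>). f (W *v (z - \<tau>)) * cnj (G \<eta>) * cis (- 2 * pi * (\<eta> \<bullet> z)))"
      by (rule Bochner_Integration.integrable_bound) (measurable, auto simp: norm_mult)
  qed
  \<comment> \<open>The substitution z = V u + \<tau> has Jacobian c' / c; together with the factor
    c of the earlier substitution only c' remains.\<close>
  also have "\<dots> = (LINT \<eta>|lborel. (c' / c) *\<^sub>R (F (transpose V *v \<eta>) * cnj (G \<eta>) * cis (- 2 * pi * (\<tau> \<bullet> \<eta>))))"
  proof (intro Bochner_Integration.integral_cong refl)
    fix \<eta>
    let ?k = "\<lambda>z. f (W *v (z - \<tau>)) * cnj (G \<eta>) * cis (- 2 * pi * (\<eta> \<bullet> z))"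
    have "(LINT z|lborel. ?k z) = (LINT z|lborel. ?k (z + \<tau>))"
      using integral_lborel_translate[of ?k "- \<tau>"] by simp
    also have "\<dots> = (c' / c) *\<^sub>R (LINT u|lborel. ?k (V *v u + \<tau>))"
      by (rule integral_lborel_matrix[OF sV]) measurable
    also have "(LINT u|lborel. ?k (V *v u + \<tau>)) =
      (LINT u|lborel. f u * cis (- 2 * pi * ((transpose V *v \<eta>) \<bullet> u)) * (cnj (G \<eta>) * cis (- 2 * pi * (\<tau> \<bullet> \<eta>))))"
    proof (intro Bochner_Integration.integral_cong refl)
      fix u
      have "\<eta> \<bullet> (V *v u) = (transpose V *v \<eta>) \<bullet> u"
        by (simp add: dot_lmul_matrix[symmetric] transpose_matrix_vector)
      hence "cis (- 2 * pi * (\<eta> \<bullet> (V *v u + \<tau>))) = cis (- 2 * pi * ((transpose V *v \<eta>) \<bullet> u)) * cis (- 2 * pi * (\<tau> \<bullet> \<eta>))"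
        by (simp add: cis_mult inner_add_right distrib_left inner_commute)
      thus "?k (V *v u + \<tau>) = f u * cis (- 2 * pi * ((transpose V *v \<eta>) \<bullet> u)) * (cnj (G \<eta>) * cis (- 2 * pi * (\<tau> \<bullet> \<eta>)))"
        by (simp only: add_diff_cancel_right' WV mult_ac)
    qed
    also have "\<dots> = F (transpose V *v \<eta>) * (cnj (G \<eta>) * cis (- 2 * pi * (\<tau> \<bullet> \<eta>)))"
      by (subst integral_mult_left_zero) (simp only: F)
    finally show "(LINT z|lborel. ?k z) = (c' / c) *\<^sub>R (F (transpose V *v \<eta>) * cnj (G \<eta>) * cis (- 2 * pi * (\<tau> \<bullet> \<eta>)))"
      by (simp only: mult.assoc)
  qed
  also have "\<dots> = (c' / c) *\<^sub>R osc F G (transpose V) \<tau>"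
    unfolding osc_def by (rule integral_scaleR_right)
  finally show ?thesis using c by (simp add: V_def \<tau>_def)
qed

section \<open>Algebra of shears and dilations\<close>

lemma matrix_eqI_vector: "(\<And>x. A *v x = B *v x) \<Longrightarrow> A = B"
  for A B :: "real ^ 'm::finite ^ 'k::finite"
  using matrix_eq by blast

lemma shear_matrix_inverse:
  "shear_matrix (s :: real ^ 'n::finite) ** shear_matrix (- s) = mat 1"
  "shear_matrix (- s) ** shear_matrix (s :: real ^ 'n::finite) = mat 1"
  by (rule matrix_eqI_vector, simp add: matrix_vector_mul_assoc[symmetric] shear_matrix_mult)+

lemma dil_mult: "dil TYPE('n::finite) (a * b) = dil TYPE('n) a * dil TYPE('n) b"
  by (simp add: dil_def sgn_mult abs_mult powr_mult)

lemma dil_1 [simp]: "dil TYPE('n::finite) 1 = 1"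
  by (simp add: dil_def)

lemma dil_det_1 [simp]: "dil_det TYPE('n::finite) 1 = 1"
  by (simp add: dil_det_def)

lemma dil_nonzero: "a \<noteq> 0 \<Longrightarrow> dil TYPE('n::finite) a \<noteq> 0"
  by (simp add: dil_def sgn_zero_iff)

lemma dil_det_pos: "a \<noteq> 0 \<Longrightarrow> dil_det TYPE('n::finite) a > 0"
  by (simp add: dil_det_def)

lemma dilation_matrix_mult_matrix:
  "dilation_matrix a ** dilation_matrix b = (dilation_matrix (a * b) :: real ^ 'n::finite option ^ 'n option)"
  by (rule matrix_eqI_vector)
     (simp add: matrix_vector_mul_assoc[symmetric] dilation_matrix_mult dil_mult mult.assoc)

lemma dilation_matrix_1: "dilation_matrix 1 = (mat 1 :: real ^ 'n::finite option ^ 'n option)"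
  by (rule matrix_eqI_vector) (simp add: dilation_matrix_mult)

lemma matrix_inv_unique:
  fixes A B :: "real ^ 'm::finite ^ 'm"
  assumes "A ** B = mat 1" "B ** A = mat 1"
  shows "matrix_inv A = B"
proof -
  have "A ** matrix_inv A = mat 1 \<and> matrix_inv A ** A = mat 1"
    unfolding matrix_inv_def by (rule someI[of _ B]) (use assms in simp)
  hence "matrix_inv A ** A = mat 1" ..
  have "matrix_inv A = matrix_inv A ** (A ** B)" by (simp add: assms)
  also have "\<dots> = B" using \<open>matrix_inv A ** A = mat 1\<close> by (simp add: matrix_mul_assoc)
  finally show ?thesis .
qed

lemma matrix_inv_shear: "matrix_inv (shear_matrix s) = shear_matrix (- s)"
  by (intro matrix_inv_unique shear_matrix_inverse)

lemma matrix_inv_dilation: "a \<noteq> 0 \<Longrightarrow> matrix_inv (dilation_matrix a) = (dilation_matrix (1 / a) :: real ^ 'n::finite option ^ 'n option)"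
  by (intro matrix_inv_unique) (simp_all add: dilation_matrix_mult_matrix dilation_matrix_1)

text \<open>The scale \<open>\<infinity>\<close> acts like the scale \<open>1\<close>, with \<open>\<Phi>\<close> in place of \<open>\<Psi>\<close>.\<close>

definition scale_of :: "ereal \<Rightarrow> real" where
  "scale_of a = (if a = \<infinity> then 1 else real_of_ereal a)"

definition generator :: "('b \<Rightarrow> complex) \<Rightarrow> ('b \<Rightarrow> complex) \<Rightarrow> ereal \<Rightarrow> 'b \<Rightarrow> complex" where
  "generator \<Phi> \<Psi> a = (if a = \<infinity> then \<Phi> else \<Psi>)"

text \<open>The transposed relative matrix of two parameters. Shears add up, so only the difference
  \<sigma> of the two shear vectors enters.\<close>

definition freq_matrix :: "real \<Rightarrow> real ^ 'n::finite \<Rightarrow> real \<Rightarrow> real ^ 'n option ^ 'n option" where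
  "freq_matrix \<alpha> \<sigma> \<beta> = transpose (dilation_matrix (1 / \<alpha>) ** shear_matrix \<sigma> ** dilation_matrix \<beta>)"

text \<open>The first frequency is multiplied by \<beta>/\<alpha>, so supports in that coordinate
  compare the scales. The shear acts through a multiple of the first frequency and can be bounded
  only where that frequency is bounded below.\<close>

lemma freq_matrix_mult:
  "freq_matrix \<alpha> \<sigma> \<beta> *v \<eta> = cons_vec (\<beta> * (\<eta> $ None / \<alpha>))
     (dil TYPE('n) \<beta> *\<^sub>R (dil TYPE('n) (1 / \<alpha>) *\<^sub>R tail_vec \<eta> + (\<eta> $ None / \<alpha>) *\<^sub>R (\<sigma> :: real ^ 'n::finite)))"
proof -
  let ?A = "dilation_matrix (1 / \<alpha>) ** shear_matrix \<sigma> ** dilation_matrix \<beta>"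
  let ?v = "cons_vec (\<beta> * (\<eta> $ None / \<alpha>))
     (dil TYPE('n) \<beta> *\<^sub>R (dil TYPE('n) (1 / \<alpha>) *\<^sub>R tail_vec \<eta> + (\<eta> $ None / \<alpha>) *\<^sub>R \<sigma>))"
  have "(transpose ?A *v \<eta>) \<bullet> u = ?v \<bullet> u" for u
  proof -
    have "(transpose ?A *v \<eta>) \<bullet> u = \<eta> \<bullet> (?A *v u)"
      by (simp add: dot_lmul_matrix[symmetric] transpose_matrix_vector)
    also have "\<dots> = ?v \<bullet> u"
      by (simp add: matrix_vector_mul_assoc[symmetric] dilation_matrix_mult shear_matrix_mult inner_option
          inner_add_left inner_add_right inner_commute algebra_simps)
    finally show ?thesis .
  qed
  thus ?thesis unfolding freq_matrix_def by (subst vector_eq_rdot[symmetric]) blast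
qed

lemma param_space_scale:
  "(a, s, t) \<in> param_space \<Longrightarrow> scale_of a \<noteq> 0 \<and> \<bar>scale_of a\<bar> \<le> 1"
  by (auto simp: param_space_def scale_of_def)

lemma shearlet_system_eq:
  fixes s :: "real ^ 'n::finite"
  assumes "(a, s, t) \<in> param_space"
  shows "shearlet_system \<Phi> \<Psi> (a, s, t) z = of_real (dil_det TYPE('n) (scale_of a) powr (- 1 / 2)) *
    generator \<Phi> \<Psi> a ((dilation_matrix (1 / scale_of a) ** shear_matrix (- s)) *v (z - t))"
proof (cases "a = \<infinity>")
  case True
  thus ?thesis
    by (simp add: shearlet_system_def scale_of_def generator_def matrix_inv_shear dilation_matrix_1)
next
  case False
  hence "real_of_ereal a \<noteq> 0" using param_space_scale[OF assms] by (simp add: scale_of_def)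
  thus ?thesis using False
    by (simp add: shearlet_system_def scale_of_def generator_def matrix_inv_shear matrix_inv_dilation
        abs_det_dilation_matrix matrix_vector_mul_assoc)
qed

theorem frame_kernel_eq_osc:
  fixes \<Phi> \<Psi> :: "real ^ 'n::finite option \<Rightarrow> complex"
  assumes \<Phi>: "in_L1 \<Phi>" "smooth_compact_support (fourier \<Phi>)"
    and \<Psi>: "in_L1 \<Psi>" "smooth_compact_support (fourier \<Psi>)"
    and x: "(a, s, t) \<in> param_space" and y: "(a', s', t') \<in> param_space"
  shows "frame_kernel (shearlet_system \<Phi> \<Psi>) (a, s, t) (a', s', t') =
    of_real (sqrt (dil_det TYPE('n) (scale_of a') / dil_det TYPE('n) (scale_of a))) *
    osc (fourier (generator \<Phi> \<Psi> a')) (fourier (generator \<Phi> \<Psi> a)) (freq_matrix (scale_of a) (s' - s) (scale_of a'))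
      (dilation_matrix (1 / scale_of a) *v (shear_matrix (- s) *v (t' - t)))"
proof -
  let ?\<delta> = "dil_det TYPE('n)"
  let ?g = "\<lambda>a. generator \<Phi> \<Psi> a" and ?G = "\<lambda>a. fourier (generator \<Phi> \<Psi> a)"
  let ?Ti = "\<lambda>a s. dilation_matrix (1 / scale_of a) ** shear_matrix (- s) :: real ^ 'n option ^ 'n option"
  let ?T = "\<lambda>a s. shear_matrix s ** dilation_matrix (scale_of a) :: real ^ 'n option ^ 'n option"
  have g1: "in_L1 (?g a)" "smooth_compact_support (?G a)" for a
    using \<Phi> \<Psi> by (simp_all add: generator_def)
  have G: "integrable lborel (?G a)" for a
    by (rule integrable_compact_support[OF g1(2)])
  note ift = L1_eq_ift[OF g1(1) G]
  have T: "scales_lborel (?T a s) (?\<delta> (scale_of a))" "?T a s ** ?Ti a s = mat 1" "?Ti a s ** ?T a s = mat 1"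
    "scales_lborel (?Ti a s) (1 / ?\<delta> (scale_of a))"
    if "scale_of a \<noteq> 0" for a s
  proof -
    show 1: "scales_lborel (?T a s) (?\<delta> (scale_of a))"
      using scales_lborel_mult[OF scales_lborel_shear scales_lborel_dilation[OF that]] by simp
    have "?T a s ** ?Ti a s = shear_matrix s ** (dilation_matrix (scale_of a) ** dilation_matrix (1 / scale_of a)) ** shear_matrix (- s)"
      by (simp add: matrix_mul_assoc)
    thus 2: "?T a s ** ?Ti a s = mat 1"
      using that by (simp add: dilation_matrix_mult_matrix dilation_matrix_1 shear_matrix_inverse)
    have "?Ti a s ** ?T a s = dilation_matrix (1 / scale_of a) ** (shear_matrix (- s) ** shear_matrix s) ** dilation_matrix (scale_of a)"
      by (simp add: matrix_mul_assoc)
    thus 3: "?Ti a s ** ?T a s = mat 1"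
      using that by (simp add: dilation_matrix_mult_matrix dilation_matrix_1 shear_matrix_inverse)
    show "scales_lborel (?Ti a s) (1 / ?\<delta> (scale_of a))"
      by (rule scales_lborel_inverse[OF 1 2 3])
  qed
  have nz: "scale_of a \<noteq> 0" "scale_of a' \<noteq> 0" using param_space_scale x y by blast+
  have [measurable]: "ift (?G a) \<in> borel_measurable borel" for a using ift(2)[of a] by auto
  let ?k = "of_real (?\<delta> (scale_of a') powr (- 1 / 2)) * of_real (?\<delta> (scale_of a) powr (- 1 / 2)) :: complex"
  let ?I = "\<lambda>z. ift (?G a') (?Ti a' s' *v (z - t')) * cnj (ift (?G a) (?Ti a s *v (z - t)))"
  have gm: "?g a \<in> borel_measurable lebesgue" for a
    using g1(1)[of a] by (simp add: in_L1_def)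
  have "AE z in lborel. ?g a' (?Ti a' s' *v (z - t')) = ift (?G a') (?Ti a' s' *v (z - t'))"
    by (rule AE_lborel_affine[OF T(4)[OF nz(2)] ift(1)])
  moreover have "AE z in lborel. ?g a (?Ti a s *v (z - t)) = ift (?G a) (?Ti a s *v (z - t))"
    by (rule AE_lborel_affine[OF T(4)[OF nz(1)] ift(1)])
  ultimately have ae: "AE z in lborel. ?k * ?I z =
      shearlet_system \<Phi> \<Psi> (a', s', t') z * cnj (shearlet_system \<Phi> \<Psi> (a, s, t) z)"
    by eventually_elim (simp add: shearlet_system_eq[OF x] shearlet_system_eq[OF y])
  have m1: "(\<lambda>z. ?k * ?I z) \<in> borel_measurable lebesgue"
    by (rule measurable_completion) measurable
  \<comment> \<open>Measurability is inherited from the almost everywhere equal Borel function,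
    because Lebesgue measure is complete.\<close>
  have m2: "(\<lambda>z. shearlet_system \<Phi> \<Psi> (a', s', t') z * cnj (shearlet_system \<Phi> \<Psi> (a, s, t) z)) \<in> borel_measurable lebesgue"
  proof (rule measurableI)
    fix E :: "complex set"
    assume [measurable]: "E \<in> sets borel"
    let ?S = "\<lambda>z. shearlet_system \<Phi> \<Psi> (a', s', t') z * cnj (shearlet_system \<Phi> \<Psi> (a, s, t) z)"
    show "?S -` E \<inter> space lebesgue \<in> sets lebesgue"
    proof (rule completion.in_sets_AE)
      show "(\<lambda>z. ?k * ?I z) -` E \<inter> space lebesgue \<in> sets lebesgue"
        using m1 by (rule measurable_sets) simp
      show "AE z in lebesgue. z \<in> (\<lambda>z. ?k * ?I z) -` E \<inter> space lebesgue \<longleftrightarrow> z \<in> ?S -` E \<inter> space lebesgue"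
        using AE_completion[OF ae] by eventually_elim simp
    qed simp
  qed simp
  have "frame_kernel (shearlet_system \<Phi> \<Psi>) (a, s, t) (a', s', t') = (LINT z|lebesgue. ?k * ?I z)"
    unfolding frame_kernel_def L2_inner_def
    by (rule integral_cong_AE[OF m2 m1]) (use AE_completion[OF ae] in auto)
  also have "\<dots> = ?k * (LINT z|lborel. ?I z)"
    by (subst integral_completion) simp_all
  also have "(LINT z|lborel. ?I z) = ?\<delta> (scale_of a') *\<^sub>R osc (?G a') (?G a) (transpose (?Ti a s ** ?T a' s')) (?Ti a s *v (t' - t))"
    by (rule inner_affine_eq_osc[OF ift(2) ift(2) ift(3) G T(1-3)[OF nz(1)] T(1-3)[OF nz(2)]])
  also have "?Ti a s ** ?T a' s' = dilation_matrix (1 / scale_of a) ** (shear_matrix (- s) ** shear_matrix s') ** dilation_matrix (scale_of a')"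
    by (simp add: matrix_mul_assoc)
  also have "shear_matrix (- s) ** shear_matrix s' = shear_matrix (s' - s)"
    by (rule matrix_eqI_vector) (simp add: matrix_vector_mul_assoc[symmetric] shear_matrix_mult inner_diff_left add.commute add_diff_eq)
  finally have eq: "frame_kernel (shearlet_system \<Phi> \<Psi>) (a, s, t) (a', s', t') = ?k * (?\<delta> (scale_of a') *\<^sub>R
      osc (?G a') (?G a) (freq_matrix (scale_of a) (s' - s) (scale_of a')) (?Ti a s *v (t' - t)))"
    by (simp add: freq_matrix_def)
  \<comment> \<open>The normalising factors carry the exponent -1/2 each, and the change of
    variables contributes the full determinant of the primed parameter.\<close>
  have "?\<delta> (scale_of a') powr (- 1 / 2) * ?\<delta> (scale_of a) powr (- 1 / 2) * ?\<delta> (scale_of a') =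
      sqrt (?\<delta> (scale_of a') / ?\<delta> (scale_of a))"
  proof -
    have p: "?\<delta> (scale_of a) > 0" "?\<delta> (scale_of a') > 0" using nz by (simp_all add: dil_det_pos)
    have "x powr (- 1 / 2) = 1 / sqrt x" if "x > 0" for x :: real
      using that by (simp add: powr_minus powr_half_sqrt inverse_eq_divide)
    hence "?\<delta> (scale_of a') powr (- 1 / 2) * ?\<delta> (scale_of a) powr (- 1 / 2) * ?\<delta> (scale_of a') =
        (?\<delta> (scale_of a') / sqrt (?\<delta> (scale_of a'))) / sqrt (?\<delta> (scale_of a))"
      using p by simp
    thus ?thesis using p by (simp only: real_div_sqrt less_imp_le real_sqrt_divide)
  qed
  hence "?k * of_real (?\<delta> (scale_of a')) = of_real (sqrt (?\<delta> (scale_of a') / ?\<delta> (scale_of a)))"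
    by (simp only: of_real_mult[symmetric])
  thus ?thesis unfolding eq scaleR_conv_of_real
    by (simp only: mult.assoc[symmetric] matrix_vector_mul_assoc)
qed

section \<open>Bounds for the frame kernel\<close>

lemma norm_tail_vec_le: "norm (tail_vec x) \<le> norm (x :: real ^ 'n::finite option)"
proof -
  have "tail_vec x \<bullet> tail_vec x \<le> x \<bullet> x" by (simp add: inner_option)
  thus ?thesis by (simp add: norm_eq_sqrt_inner)
qed

lemma abs_dil: "\<bar>dil TYPE('n::finite) a\<bar> = \<bar>a\<bar> powr (1 / CARD('n option))"
  by (cases "a = 0") (simp_all add: dil_def abs_mult abs_sgn_eq del: card_option)

lemma abs_dil_mono: "\<bar>a\<bar> \<le> \<bar>b\<bar> \<Longrightarrow> \<bar>dil TYPE('n::finite) a\<bar> \<le> \<bar>dil TYPE('n) b\<bar>"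
  unfolding abs_dil by (intro powr_mono2) auto

lemma dil_det_mono: "\<bar>a\<bar> \<le> \<bar>b\<bar> \<Longrightarrow> dil_det TYPE('n::finite) a \<le> dil_det TYPE('n) b"
  unfolding dil_det_def by (intro powr_mono2) (auto simp: field_simps)

lemma dil_inverse: "a \<noteq> 0 \<Longrightarrow> dil TYPE('n::finite) (1 / a) = 1 / dil TYPE('n) a"
  using dil_mult[where 'n = 'n, of a "1 / a"] dil_nonzero[where 'n = 'n, of a] by (simp add: field_simps)

text \<open>The three summands are the possible nonzero entries: the corner, the rest of the
  diagonal, and the first column, where the transposition puts the shear.\<close>

lemma freq_matrix_entry_le:
  fixes \<sigma> :: "real ^ 'n::finite"
  shows "\<bar>freq_matrix \<alpha> \<sigma> \<beta> $ i $ j\<bar> \<le>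
    \<bar>\<beta> / \<alpha>\<bar> + \<bar>dil TYPE('n) \<beta> * dil TYPE('n) (1 / \<alpha>)\<bar> + \<bar>dil TYPE('n) \<beta>\<bar> * (norm \<sigma> / \<bar>\<alpha>\<bar>)"
proof -
  have "freq_matrix \<alpha> \<sigma> \<beta> $ i $ j = (freq_matrix \<alpha> \<sigma> \<beta> *v axis j 1) $ i"
    by (simp add: matrix_vector_mult_def axis_def if_distrib cong: if_cong)
  also have "\<dots> = cons_vec (\<beta> * (axis j 1 $ None / \<alpha>))
     (dil TYPE('n) \<beta> *\<^sub>R (dil TYPE('n) (1 / \<alpha>) *\<^sub>R tail_vec (axis j 1) + (axis j 1 $ None / \<alpha>) *\<^sub>R \<sigma>)) $ i"
    by (simp only: freq_matrix_mult)
  finally have eq: "freq_matrix \<alpha> \<sigma> \<beta> $ i $ j = \<dots>" .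
  have "0 \<le> \<bar>\<beta> / \<alpha>\<bar>" "0 \<le> \<bar>dil TYPE('n) \<beta> * dil TYPE('n) (1 / \<alpha>)\<bar>" "0 \<le> \<bar>dil TYPE('n) \<beta>\<bar> * (norm \<sigma> / \<bar>\<alpha>\<bar>)"
    by simp_all
  moreover have "\<bar>dil TYPE('n) \<beta> * (\<sigma> $ k / \<alpha>)\<bar> \<le> \<bar>dil TYPE('n) \<beta>\<bar> * (norm \<sigma> / \<bar>\<alpha>\<bar>)" for k
    using component_le_norm_cart[of \<sigma> k] by (simp add: abs_mult mult_left_mono divide_right_mono)
  ultimately show ?thesis
    unfolding eq by (cases i; cases j) (auto simp: axis_def abs_mult intro: order_trans add_increasing add_increasing2)
qed

lemma osc_eq_0: "(\<And>\<eta>. g \<eta> \<noteq> 0 \<Longrightarrow> f (L *v \<eta>) = 0) \<Longrightarrow> osc f g L \<tau> = 0"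
proof -
  assume "\<And>\<eta>. g \<eta> \<noteq> 0 \<Longrightarrow> f (L *v \<eta>) = 0"
  hence "(\<lambda>\<eta>. f (L *v \<eta>) * cnj (g \<eta>) * cis (- 2 * pi * (\<tau> \<bullet> \<eta>))) = (\<lambda>_. 0)" by fastforce
  thus ?thesis unfolding osc_def by (simp only: Bochner_Integration.integral_zero)
qed

text \<open>The tail of the image frequency minus the scaled tail of \<eta> is exactly the shear
  term, and both frequencies lie within the support radius \<open>B\<close>.\<close>

lemma shear_bound:
  fixes \<sigma> :: "real ^ 'n::finite"
  assumes "f (freq_matrix \<alpha> \<sigma> \<beta> *v \<eta>) \<noteq> 0" and "g \<eta> \<noteq> 0"
    and f: "\<And>x. f x \<noteq> 0 \<Longrightarrow> norm x \<le> B" and g: "\<And>x. g x \<noteq> 0 \<Longrightarrow> norm x \<le> B"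
  shows "\<bar>dil TYPE('n) \<beta>\<bar> * (\<bar>\<eta> $ None\<bar> / \<bar>\<alpha>\<bar> * norm \<sigma>) \<le> B * (1 + \<bar>dil TYPE('n) \<beta> * dil TYPE('n) (1 / \<alpha>)\<bar>)"
    and "\<bar>\<beta> / \<alpha>\<bar> * \<bar>\<eta> $ None\<bar> \<le> B"
proof -
  let ?d = "dil TYPE('n)"
  let ?u = "freq_matrix \<alpha> \<sigma> \<beta> *v \<eta>"
  have tu: "tail_vec ?u = (?d \<beta> * ?d (1 / \<alpha>)) *\<^sub>R tail_vec \<eta> + (?d \<beta> * (\<eta> $ None / \<alpha>)) *\<^sub>R \<sigma>"
    by (simp add: freq_matrix_mult scaleR_add_right)
  have 1: "norm (tail_vec ?u) \<le> B" using f[OF assms(1)] norm_tail_vec_le order_trans by blast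
  have 2: "norm (tail_vec \<eta>) \<le> B" using g[OF assms(2)] norm_tail_vec_le order_trans by blast
  have "\<bar>?d \<beta>\<bar> * (\<bar>\<eta> $ None\<bar> / \<bar>\<alpha>\<bar> * norm \<sigma>) = norm ((?d \<beta> * (\<eta> $ None / \<alpha>)) *\<^sub>R \<sigma>)"
    by (simp add: abs_mult)
  also have "(?d \<beta> * (\<eta> $ None / \<alpha>)) *\<^sub>R \<sigma> = tail_vec ?u - (?d \<beta> * ?d (1 / \<alpha>)) *\<^sub>R tail_vec \<eta>"
    by (simp add: tu)
  also have "norm \<dots> \<le> norm (tail_vec ?u) + \<bar>?d \<beta> * ?d (1 / \<alpha>)\<bar> * norm (tail_vec \<eta>)"
    by (metis norm_scaleR norm_triangle_ineq4)
  also have "\<dots> \<le> B + \<bar>?d \<beta> * ?d (1 / \<alpha>)\<bar> * B"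
    by (intro add_mono mult_left_mono 1 2) simp
  finally show "\<bar>?d \<beta>\<bar> * (\<bar>\<eta> $ None\<bar> / \<bar>\<alpha>\<bar> * norm \<sigma>) \<le> B * (1 + \<bar>?d \<beta> * ?d (1 / \<alpha>)\<bar>)"
    by (simp add: algebra_simps)
  have "\<bar>?u $ None\<bar> \<le> B"
    using f[OF assms(1)] component_le_norm_cart[of ?u None] by linarith
  thus "\<bar>\<beta> / \<alpha>\<bar> * \<bar>\<eta> $ None\<bar> \<le> B" by (simp add: freq_matrix_mult abs_mult)
qed

text \<open>Both first frequencies have absolute value in [a0, a1], which confines \<beta>/\<alpha>.
  The admissible shears shrink like |\<alpha>| / |dil \<alpha>|, and precisely this keeps the
  entries of the relative matrix bounded although the shear is divided by \<alpha> there.\<close>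

lemma osc_bound_scale_scale:
  fixes G :: "real ^ 'n::finite option \<Rightarrow> complex"
  assumes G: "smooth_compact_support G" and a: "0 < a0" "a0 < a1"
    and supp: "\<And>\<eta>. G \<eta> \<noteq> 0 \<Longrightarrow> a0 \<le> \<bar>\<eta> $ None\<bar> \<and> \<bar>\<eta> $ None\<bar> \<le> a1"
  obtains C S where "C \<ge> 0" and "S \<ge> 0"
    and "\<And>\<alpha> \<beta> \<sigma> \<tau>. \<alpha> \<noteq> 0 \<Longrightarrow> \<beta> \<noteq> 0 \<Longrightarrow> norm (osc G G (freq_matrix \<alpha> \<sigma> \<beta>) \<tau>) \<le>
      C * decay \<tau> * indicator {a0 / a1..a1 / a0} \<bar>\<beta> / \<alpha>\<bar> * indicator (cball 0 (S * \<bar>\<alpha>\<bar> / \<bar>dil TYPE('n) \<alpha>\<bar>)) \<sigma>"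
proof -
  let ?d = "dil TYPE('n)"
  obtain B where B: "B > 0" "\<And>x. G x \<noteq> 0 \<Longrightarrow> norm x \<le> B" using compact_support_radius[OF G] by blast
  define r where "r = \<bar>?d (a0 / a1)\<bar>"
  define r' where "r' = \<bar>?d (a1 / a0)\<bar>"
  have r: "r > 0" using a dil_nonzero[where 'n = 'n, of "a0 / a1"] by (simp add: r_def)
  \<comment> \<open>\<open>shear_bound\<close> gives B (1 + \<rho>) / (\<rho> a0) for the rescaled
    shear, with \<rho> at least \<open>r\<close>.\<close>
  define S where "S = B / a0 * (1 + 1 / r)"
  have S: "S \<ge> 0" using B r a by (simp add: S_def)
  \<comment> \<open>One summand for each kind of entry in
    \<open>freq_matrix_entry_le\<close>.\<close>
  define M where "M = a1 / a0 + r' + r' * S"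
  have M: "M \<ge> 0" using a S by (simp add: M_def r'_def)
  obtain C where C: "C \<ge> 0" "\<And>L \<tau>. (\<And>i j. \<bar>L $ i $ j\<bar> \<le> M) \<Longrightarrow> norm (osc G G L \<tau>) \<le> C * decay \<tau>"
    using osc_decay[OF G G M] by blast
  have main: "norm (osc G G (freq_matrix \<alpha> \<sigma> \<beta>) \<tau>) \<le> C * decay \<tau> * indicator {a0 / a1..a1 / a0} \<bar>\<beta> / \<alpha>\<bar> *
      indicator (cball 0 (S * \<bar>\<alpha>\<bar> / \<bar>?d \<alpha>\<bar>)) \<sigma>"
    if nz: "\<alpha> \<noteq> 0" "\<beta> \<noteq> 0" for \<alpha> \<beta> \<sigma> \<tau>
  proof (cases "\<exists>\<eta>. G (freq_matrix \<alpha> \<sigma> \<beta> *v \<eta>) \<noteq> 0 \<and> G \<eta> \<noteq> 0")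
    case False
    hence "osc G G (freq_matrix \<alpha> \<sigma> \<beta>) \<tau> = 0" by (intro osc_eq_0) blast
    thus ?thesis using C decay_pos[of \<tau>] by simp
  next
    case True
    then obtain \<eta> where \<eta>: "G (freq_matrix \<alpha> \<sigma> \<beta> *v \<eta>) \<noteq> 0" "G \<eta> \<noteq> 0" by blast
    let ?h = "\<bar>\<eta> $ None\<bar>"
    have h: "a0 \<le> ?h" "?h \<le> a1" using supp[OF \<eta>(2)] by auto
    have h': "a0 \<le> \<bar>\<beta> / \<alpha>\<bar> * ?h" "\<bar>\<beta> / \<alpha>\<bar> * ?h \<le> a1"
      using supp[OF \<eta>(1)] by (simp_all add: freq_matrix_mult abs_mult)
    have "a0 \<le> \<bar>\<beta> / \<alpha>\<bar> * a1" using h'(1) h(2) by (meson abs_ge_zero mult_left_mono order_trans)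
    moreover have "\<bar>\<beta> / \<alpha>\<bar> * a0 \<le> a1" using h'(2) h(1) by (meson abs_ge_zero mult_left_mono order_trans)
    ultimately have ratio: "a0 / a1 \<le> \<bar>\<beta> / \<alpha>\<bar>" "\<bar>\<beta> / \<alpha>\<bar> \<le> a1 / a0"
      using a by (simp_all add: pos_divide_le_eq pos_le_divide_eq)
    let ?\<rho> = "\<bar>?d (\<beta> / \<alpha>)\<bar>"
    have d: "?d \<beta> = ?d \<alpha> * ?d (\<beta> / \<alpha>)" using nz by (simp add: dil_mult[symmetric])
    have dd: "?d \<beta> * ?d (1 / \<alpha>) = ?d (\<beta> / \<alpha>)" using nz by (simp add: dil_mult[symmetric])
    have \<rho>: "r \<le> ?\<rho>" "?\<rho> \<le> r'"
      unfolding r_def r'_def by (intro abs_dil_mono; use a ratio in simp)+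
    have da: "\<bar>?d \<alpha>\<bar> > 0" using nz by (simp add: dil_nonzero)
    let ?A = "\<bar>?d \<alpha>\<bar> / \<bar>\<alpha>\<bar> * norm \<sigma>"
    have "?\<rho> * ?h * ?A \<le> B * (1 + ?\<rho>)"
      using shear_bound(1)[where f = G and g = G, OF \<eta> B(2) B(2)] unfolding dd by (simp add: d abs_mult mult_ac)
    moreover have "?\<rho> * a0 * ?A \<le> ?\<rho> * ?h * ?A"
      using h by (intro mult_right_mono mult_left_mono) auto
    ultimately have "?\<rho> * a0 * ?A \<le> B * (1 + ?\<rho>)" by linarith
    hence "?A \<le> B * (1 + ?\<rho>) / (?\<rho> * a0)"
      using \<rho>(1) r a by (simp add: pos_le_divide_eq mult_ac)
    also have "\<dots> = B / a0 * (1 + 1 / ?\<rho>)"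
      using \<rho>(1) r a by (simp add: field_simps)
    also have "\<dots> \<le> S"
      unfolding S_def using \<rho>(1) r a B by (intro mult_left_mono add_left_mono divide_left_mono) auto
    finally have A: "?A \<le> S" .
    hence \<sigma>: "norm \<sigma> \<le> S * \<bar>\<alpha>\<bar> / \<bar>?d \<alpha>\<bar>"
      using da nz by (simp add: field_simps)
    have "\<bar>freq_matrix \<alpha> \<sigma> \<beta> $ i $ j\<bar> \<le> M" for i j
    proof -
      have "\<bar>?d \<beta>\<bar> * (norm \<sigma> / \<bar>\<alpha>\<bar>) = ?\<rho> * ?A" by (simp add: d abs_mult)
      also have "\<dots> \<le> r' * S" using A \<rho> r by (intro mult_mono) auto
      finally show ?thesis
        using freq_matrix_entry_le[of \<alpha> \<sigma> \<beta> i j] ratio(2) \<rho>(2) unfolding dd M_def by linarith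
    qed
    thus ?thesis using C(2)[of "freq_matrix \<alpha> \<sigma> \<beta>" \<tau>] ratio \<sigma> by simp
  qed
  show ?thesis by (rule that[OF C(1) S main])
qed

text \<open>The support of \<open>G\<close> keeps one first frequency above a0 and that of
  \<open>F\<close> keeps the other below a radius, so the finite scale stays away from 0. Both
  orders are treated because the kernel is later integrated over its second parameter only.\<close>

lemma osc_bound_inf_scale:
  fixes F G :: "real ^ 'n::finite option \<Rightarrow> complex"
  assumes F: "smooth_compact_support F" and G: "smooth_compact_support G" and a: "0 < a0"
    and supp: "\<And>\<eta>. G \<eta> \<noteq> 0 \<Longrightarrow> a0 \<le> \<bar>\<eta> $ None\<bar>"
  obtains C S \<epsilon> where "C \<ge> 0" and "S \<ge> 0" and "\<epsilon> > 0"
    and "\<And>\<beta> \<sigma> \<tau>. \<beta> \<noteq> 0 \<Longrightarrow> \<bar>\<beta>\<bar> \<le> 1 \<Longrightarrow> norm (osc G F (freq_matrix 1 \<sigma> \<beta>) \<tau>) \<le>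
      C * decay \<tau> * indicator {\<epsilon>..} \<bar>\<beta>\<bar> * indicator (cball 0 S) \<sigma>"
    and "\<And>\<alpha> \<sigma> \<tau>. \<alpha> \<noteq> 0 \<Longrightarrow> \<bar>\<alpha>\<bar> \<le> 1 \<Longrightarrow> norm (osc F G (freq_matrix \<alpha> \<sigma> 1) \<tau>) \<le>
      C * decay \<tau> * indicator {\<epsilon>..} \<bar>\<alpha>\<bar> * indicator (cball 0 S) \<sigma>"
proof -
  let ?d = "dil TYPE('n)"
  obtain BF where BF: "BF > 0" "\<And>x. F x \<noteq> 0 \<Longrightarrow> norm x \<le> BF" using compact_support_radius[OF F] by blast
  obtain BG where BG: "BG > 0" "\<And>x. G x \<noteq> 0 \<Longrightarrow> norm x \<le> BG" using compact_support_radius[OF G] by blast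
  define B where "B = max BF BG"
  have B: "B > 0" "\<And>x. F x \<noteq> 0 \<Longrightarrow> norm x \<le> B" "\<And>x. G x \<noteq> 0 \<Longrightarrow> norm x \<le> B"
    using BF BG by (auto simp: B_def le_max_iff_disj)
  define \<epsilon> where "\<epsilon> = a0 / B"
  have \<epsilon>: "\<epsilon> > 0" using a B by (simp add: \<epsilon>_def)
  define e where "e = \<bar>?d \<epsilon>\<bar>"
  have e: "e > 0" using \<epsilon> dil_nonzero[where 'n = 'n, of \<epsilon>] by (simp add: e_def)
  define S where "S = B / a0 * (1 + 1 / e)"
  have S: "S \<ge> 0" using B e a by (simp add: S_def)
  \<comment> \<open>A common bound for the entries in both orders; \<epsilon> and \<open>e\<close>
    are the lower bounds of a finite scale and of its \<open>dil\<close>.\<close>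
  define M where "M = 1 + 1 / \<epsilon> + 1 + 1 / e + S + S / \<epsilon>"
  have M: "M \<ge> 0" using e \<epsilon> S by (simp add: M_def)
  obtain C1 where C1: "C1 \<ge> 0" "\<And>L \<tau>. (\<And>i j. \<bar>L $ i $ j\<bar> \<le> M) \<Longrightarrow> norm (osc G F L \<tau>) \<le> C1 * decay \<tau>"
    using osc_decay[OF G F M] by blast
  obtain C2 where C2: "C2 \<ge> 0" "\<And>L \<tau>. (\<And>i j. \<bar>L $ i $ j\<bar> \<le> M) \<Longrightarrow> norm (osc F G L \<tau>) \<le> C2 * decay \<tau>"
    using osc_decay[OF F G M] by blast
  define C where "C = max C1 C2"
  have C: "C \<ge> 0" using C1 by (simp add: C_def)
  have C1': "norm (osc G F L \<tau>) \<le> C * decay \<tau>" if "\<And>i j. \<bar>L $ i $ j\<bar> \<le> M" for L \<tau>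
    using C1(2)[OF that, of \<tau>] decay_pos[of \<tau>] by (auto simp: C_def max_def intro: order_trans mult_right_mono)
  have C2': "norm (osc F G L \<tau>) \<le> C * decay \<tau>" if "\<And>i j. \<bar>L $ i $ j\<bar> \<le> M" for L \<tau>
    using C2(2)[OF that, of \<tau>] decay_pos[of \<tau>] by (auto simp: C_def max_def intro: order_trans mult_right_mono)
  have d1: "\<bar>?d x\<bar> \<le> 1" if "\<bar>x\<bar> \<le> 1" for x
    using abs_dil_mono[where 'n = 'n, of x 1] that by simp
  have de: "e \<le> \<bar>?d x\<bar>" if "\<epsilon> \<le> \<bar>x\<bar>" for x
    unfolding e_def using that \<epsilon> by (intro abs_dil_mono) simp
  have 1: "norm (osc G F (freq_matrix 1 \<sigma> \<beta>) \<tau>) \<le> C * decay \<tau> * indicator {\<epsilon>..} \<bar>\<beta>\<bar> * indicator (cball 0 S) \<sigma>"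
    if nz: "\<beta> \<noteq> 0" "\<bar>\<beta>\<bar> \<le> 1" for \<beta> \<sigma> \<tau>
  proof (cases "\<exists>\<eta>. G (freq_matrix 1 \<sigma> \<beta> *v \<eta>) \<noteq> 0 \<and> F \<eta> \<noteq> 0")
    case False
    hence "osc G F (freq_matrix 1 \<sigma> \<beta>) \<tau> = 0" by (intro osc_eq_0) blast
    thus ?thesis using C decay_pos[of \<tau>] by simp
  next
    case True
    then obtain \<eta> where \<eta>: "G (freq_matrix 1 \<sigma> \<beta> *v \<eta>) \<noteq> 0" "F \<eta> \<noteq> 0" by blast
    let ?h = "\<bar>\<eta> $ None\<bar>"
    have h: "?h \<le> B" using component_le_norm_cart[of \<eta> None] B(2)[OF \<eta>(2)] by linarith
    have h': "a0 \<le> \<bar>\<beta>\<bar> * ?h"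
      using supp[OF \<eta>(1)] by (simp add: freq_matrix_mult abs_mult)
    have "\<bar>\<beta>\<bar> * ?h \<le> \<bar>\<beta>\<bar> * B" using h by (intro mult_left_mono) auto
    hence \<beta>: "\<epsilon> \<le> \<bar>\<beta>\<bar>" using h' B by (simp add: \<epsilon>_def pos_divide_le_eq)
    \<comment> \<open>\<open>F\<close> may be nonzero at first frequency 0. The lower bound for
      \<eta> comes from its image under the matrix instead, since multiplication by \<beta> only
      shrinks the first coordinate.\<close>
    have "\<bar>\<beta>\<bar> * ?h \<le> 1 * ?h" using nz by (intro mult_right_mono) auto
    hence ha: "a0 \<le> ?h" using h' by simp
    let ?\<rho> = "\<bar>?d \<beta>\<bar>"
    have \<rho>: "e \<le> ?\<rho>" "?\<rho> \<le> 1" using d1 de \<beta> nz by auto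
    have "?\<rho> * (a0 * norm \<sigma>) \<le> ?\<rho> * (?h * norm \<sigma>)"
      using ha by (intro mult_right_mono mult_left_mono) auto
    also have "\<dots> \<le> B * (1 + ?\<rho>)"
      using shear_bound(1)[where f = G and g = F, OF \<eta> B(3) B(2)] by simp
    finally have "norm \<sigma> \<le> B * (1 + ?\<rho>) / (?\<rho> * a0)"
      using \<rho>(1) e a by (simp add: pos_le_divide_eq mult_ac)
    also have "\<dots> = B / a0 * (1 + 1 / ?\<rho>)"
      using \<rho>(1) e a by (simp add: field_simps)
    also have "\<dots> \<le> S"
      unfolding S_def using \<rho>(1) e a B by (intro mult_left_mono add_left_mono divide_left_mono) auto
    finally have \<sigma>: "norm \<sigma> \<le> S" .
    have "\<bar>freq_matrix 1 \<sigma> \<beta> $ i $ j\<bar> \<le> M" for i j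
    proof -
      have "?\<rho> * (norm \<sigma> / \<bar>1\<bar>) \<le> 1 * S" using \<sigma> \<rho> e by (intro mult_mono) auto
      moreover have "0 \<le> 1 / \<epsilon>" "0 \<le> 1 / e" "0 \<le> S / \<epsilon>" using \<epsilon> e S by auto
      moreover have "\<bar>freq_matrix 1 \<sigma> \<beta> $ i $ j\<bar> \<le> \<bar>\<beta>\<bar> + ?\<rho> + ?\<rho> * (norm \<sigma> / \<bar>1\<bar>)"
        using freq_matrix_entry_le[of 1 \<sigma> \<beta> i j] by simp
      ultimately show ?thesis
        using nz(2) \<rho>(2) unfolding M_def by linarith
    qed
    thus ?thesis using C1'[of "freq_matrix 1 \<sigma> \<beta>" \<tau>] \<beta> \<sigma> by simp
  qed
  have 2: "norm (osc F G (freq_matrix \<alpha> \<sigma> 1) \<tau>) \<le> C * decay \<tau> * indicator {\<epsilon>..} \<bar>\<alpha>\<bar> * indicator (cball 0 S) \<sigma>"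
    if nz: "\<alpha> \<noteq> 0" "\<bar>\<alpha>\<bar> \<le> 1" for \<alpha> \<sigma> \<tau>
  proof (cases "\<exists>\<eta>. F (freq_matrix \<alpha> \<sigma> 1 *v \<eta>) \<noteq> 0 \<and> G \<eta> \<noteq> 0")
    case False
    hence "osc F G (freq_matrix \<alpha> \<sigma> 1) \<tau> = 0" by (intro osc_eq_0) blast
    thus ?thesis using C decay_pos[of \<tau>] by simp
  next
    case True
    then obtain \<eta> where \<eta>: "F (freq_matrix \<alpha> \<sigma> 1 *v \<eta>) \<noteq> 0" "G \<eta> \<noteq> 0" by blast
    let ?h = "\<bar>\<eta> $ None\<bar>"
    have ha: "a0 \<le> ?h" by (rule supp[OF \<eta>(2)])
    have "?h \<le> B * \<bar>\<alpha>\<bar>" using shear_bound(2)[where f = F and g = G, OF \<eta> B(2) B(3)] nz by (simp add: field_simps)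
    hence \<alpha>: "\<epsilon> \<le> \<bar>\<alpha>\<bar>" using ha B by (simp add: \<epsilon>_def pos_divide_le_eq mult.commute)
    let ?\<rho> = "\<bar>?d \<alpha>\<bar>"
    have \<rho>: "e \<le> ?\<rho>" "?\<rho> \<le> 1" using d1 de \<alpha> nz by auto
    have inv: "\<bar>?d (1 / \<alpha>)\<bar> = 1 / ?\<rho>" using nz by (simp add: dil_inverse)
    have re: "1 / ?\<rho> \<le> 1 / e" using \<rho> e by (intro divide_left_mono) auto
    have "a0 * norm \<sigma> \<le> ?h / \<bar>\<alpha>\<bar> * norm \<sigma>"
    proof (intro mult_right_mono)
      have "a0 * \<bar>\<alpha>\<bar> \<le> a0 * 1" using a nz by (intro mult_left_mono) auto
      thus "a0 \<le> ?h / \<bar>\<alpha>\<bar>" using ha nz by (simp add: pos_le_divide_eq)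
    qed simp
    also have "\<dots> \<le> B * (1 + 1 / ?\<rho>)"
      using shear_bound(1)[where f = F and g = G, OF \<eta> B(2) B(3)] by (simp add: inv)
    also have "\<dots> \<le> B * (1 + 1 / e)" using re B by (intro mult_left_mono) auto
    finally have \<sigma>: "norm \<sigma> \<le> S"
      using a by (simp add: S_def pos_le_divide_eq mult.commute)
    have ia: "1 / \<bar>\<alpha>\<bar> \<le> 1 / \<epsilon>" using \<alpha> \<epsilon> by (intro divide_left_mono) auto
    have "\<bar>freq_matrix \<alpha> \<sigma> 1 $ i $ j\<bar> \<le> M" for i j
    proof -
      have "norm \<sigma> * (1 / \<bar>\<alpha>\<bar>) \<le> S * (1 / \<epsilon>)" using \<sigma> ia S by (intro mult_mono) auto
      thus ?thesis
        using freq_matrix_entry_le[of \<alpha> \<sigma> 1 i j] ia re S unfolding M_def by (simp add: inv)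
    qed
    thus ?thesis using C2'[of "freq_matrix \<alpha> \<sigma> 1" \<tau>] \<alpha> \<sigma> by simp
  qed
  show ?thesis by (rule that[OF C S \<epsilon> 1 2])
qed

text \<open>For large shears the kernel is an exact rescaling of the one at a fixed radius, because
  \<open>\<Phi>\<close> is homogeneous in the first frequency variable near \<open>0\<close>.\<close>

lemma osc_rescale:
  fixes F :: "real ^ 'n::finite option \<Rightarrow> complex"
  assumes F: "smooth_compact_support F" and B: "\<And>x. F x \<noteq> 0 \<Longrightarrow> norm x \<le> B"
    and hom: "\<And>\<kappa> u v. 0 < \<kappa> \<Longrightarrow> \<kappa> \<le> 1 \<Longrightarrow> \<bar>u\<bar> < a0 \<Longrightarrow> F (cons_vec (\<kappa> * u) v) = of_real (\<kappa> ^ m) * F (cons_vec u v)"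
    and \<kappa>: "0 < \<kappa>" "\<kappa> \<le> 1" and \<sigma>: "2 * B < \<kappa> * norm \<sigma> * a0"
  shows "osc F F (freq_matrix 1 \<sigma> 1) \<tau> =
    of_real (\<kappa> ^ (2 * m + 1)) * osc F F (freq_matrix 1 (\<kappa> *\<^sub>R \<sigma>) 1) (scale_matrix \<kappa> 1 *v \<tau>)"
proof -
  \<comment> \<open>Substituting \<eta> = D u multiplies \<sigma> by \<kappa>, as \<sigma> only
    meets the first frequency. The Jacobian \<kappa> and a factor \<kappa>^m from each
    \<open>F\<close> give the exponent 2 m + 1.\<close>
  let ?D = "scale_matrix \<kappa> 1 :: real ^ 'n option ^ 'n option"
  let ?h = "\<lambda>\<eta>. F (freq_matrix 1 \<sigma> 1 *v \<eta>) * cnj (F \<eta>) * cis (- 2 * pi * (\<tau> \<bullet> \<eta>))"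
  let ?k = "\<lambda>\<eta>. F (freq_matrix 1 (\<kappa> *\<^sub>R \<sigma>) 1 *v \<eta>) * cnj (F \<eta>) * cis (- 2 * pi * ((?D *v \<tau>) \<bullet> \<eta>))"
  have D: "scales_lborel ?D \<kappa>"
    using scales_lborel_scale_matrix[of \<kappa> 1] \<kappa> by simp
  have hm: "?h \<in> borel_measurable borel"
    using integrable_osc[OF F F, of "freq_matrix 1 \<sigma> 1" \<tau>] by auto
  have "?h (?D *v u) = of_real (\<kappa> ^ (2 * m)) * ?k u" for u
  proof -
    let ?a = "cons_vec (u $ None) (tail_vec u + (u $ None * \<kappa>) *\<^sub>R \<sigma>)"
    have prod: "F (freq_matrix 1 \<sigma> 1 *v (?D *v u)) * cnj (F (?D *v u)) =
        of_real (\<kappa> ^ (2 * m)) * (F (freq_matrix 1 (\<kappa> *\<^sub>R \<sigma>) 1 *v u) * cnj (F u))"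
    proof (cases "\<bar>u $ None\<bar> < a0")
      case True
      have "F (?D *v u) = of_real (\<kappa> ^ m) * F u"
        using hom[OF \<kappa> True, of "tail_vec u"] by (simp add: scale_matrix_mult)
      moreover have "F (freq_matrix 1 \<sigma> 1 *v (?D *v u)) = of_real (\<kappa> ^ m) * F (freq_matrix 1 (\<kappa> *\<^sub>R \<sigma>) 1 *v u)"
        using hom[OF \<kappa> True, of "tail_vec u + (u $ None * \<kappa>) *\<^sub>R \<sigma>"]
        by (simp add: scale_matrix_mult freq_matrix_mult mult.commute)
      ultimately show ?thesis by (simp add: power_mult power2_eq_square power_mult_distrib mult_ac)
    next
      case False
      have big: "norm ((u $ None * \<kappa>) *\<^sub>R \<sigma>) > 2 * B"
      proof -
        have "\<kappa> * norm \<sigma> * a0 \<le> \<kappa> * norm \<sigma> * \<bar>u $ None\<bar>" using False \<kappa> by (intro mult_left_mono) auto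
        moreover have "norm ((u $ None * \<kappa>) *\<^sub>R \<sigma>) = \<kappa> * norm \<sigma> * \<bar>u $ None\<bar>"
          using \<kappa> by (simp add: abs_mult mult_ac)
        ultimately show ?thesis using \<sigma> by linarith
      qed
      hence zero: "F x = 0 \<or> F y = 0" if "tail_vec x = tail_vec y + (u $ None * \<kappa>) *\<^sub>R \<sigma>" for x y
      proof -
        have "norm ((u $ None * \<kappa>) *\<^sub>R \<sigma>) \<le> norm (tail_vec x) + norm (tail_vec y)"
          using norm_triangle_ineq4[of "tail_vec x" "tail_vec y"] by (simp add: that)
        also have "\<dots> \<le> norm x + norm y" by (intro add_mono norm_tail_vec_le)
        finally show ?thesis using B[of x] B[of y] big by fastforce
      qed
      have "F (freq_matrix 1 \<sigma> 1 *v (?D *v u)) = 0 \<or> F (?D *v u) = 0"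
        by (rule zero) (simp add: scale_matrix_mult freq_matrix_mult mult.commute)
      moreover have "F (freq_matrix 1 (\<kappa> *\<^sub>R \<sigma>) 1 *v u) = 0 \<or> F u = 0"
        by (rule zero) (simp add: freq_matrix_mult mult.commute)
      ultimately show ?thesis by auto
    qed
    have "\<tau> \<bullet> (?D *v u) = (?D *v \<tau>) \<bullet> u"
      by (simp add: scale_matrix_mult inner_option)
    thus ?thesis by (simp only: prod mult.assoc)
  qed
  hence "(LINT \<eta>|lborel. ?h \<eta>) = \<kappa> *\<^sub>R (LINT u|lborel. of_real (\<kappa> ^ (2 * m)) * ?k u)"
    by (subst integral_lborel_matrix[OF D hm]) (simp only:)
  also have "\<dots> = of_real (\<kappa> ^ (2 * m + 1)) * (LINT u|lborel. ?k u)"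
    by (subst integral_mult_right_zero) (simp add: scaleR_conv_of_real mult_ac)
  finally show ?thesis by (simp only: osc_def)
qed

text \<open>A shear longer than \<open>R\<close> is rescaled to norm exactly \<open>R\<close>, where
  the uniform decay estimate applies; 2 m + 1 = d gives the exponent. The maximum with 1 merges this
  with the short shears, which are not rescaled.\<close>

lemma osc_bound_inf_inf:
  fixes F :: "real ^ 'n::finite option \<Rightarrow> complex"
  assumes F: "smooth_compact_support F" and a0: "0 < a0" and m: "2 * m = CARD('n)"
    and hom: "\<And>\<kappa> u v. 0 < \<kappa> \<Longrightarrow> \<kappa> \<le> 1 \<Longrightarrow> \<bar>u\<bar> < a0 \<Longrightarrow> F (cons_vec (\<kappa> * u) v) = of_real (\<kappa> ^ m) * F (cons_vec u v)"
  obtains C R where "C \<ge> 0" and "R > 0"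
    and "\<And>\<sigma> \<tau>. norm (osc F F (freq_matrix 1 \<sigma> 1) \<tau>) \<le>
      C * (1 / max 1 (norm \<sigma> / R)) ^ CARD('n option) * decay (scale_matrix (1 / max 1 (norm \<sigma> / R)) 1 *v \<tau>)"
proof -
  obtain B where B: "B > 0" "\<And>x. F x \<noteq> 0 \<Longrightarrow> norm x \<le> B" using compact_support_radius[OF F] by blast
  \<comment> \<open>The summand 1 makes the inequality 2 B < R a0 strict, as the rescaling
    requires.\<close>
  define R where "R = (2 * B + 1) / a0"
  have R: "R > 0" "2 * B < R * a0" using a0 B by (simp_all add: R_def)
  obtain C where C: "C \<ge> 0" "\<And>L \<tau>. (\<And>i j. \<bar>L $ i $ j\<bar> \<le> 2 + R) \<Longrightarrow> norm (osc F F L \<tau>) \<le> C * decay \<tau>"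
    using osc_decay[OF F F, of "2 + R"] R by auto
  have small: "norm (osc F F (freq_matrix 1 \<sigma> 1) \<tau>) \<le> C * decay \<tau>" if "norm \<sigma> \<le> R" for \<sigma> \<tau>
  proof (rule C(2))
    show "\<bar>freq_matrix 1 \<sigma> 1 $ i $ j\<bar> \<le> 2 + R" for i j
      using freq_matrix_entry_le[of 1 \<sigma> 1 i j] that by simp
  qed
  have "norm (osc F F (freq_matrix 1 \<sigma> 1) \<tau>) \<le>
      C * (1 / max 1 (norm \<sigma> / R)) ^ CARD('n option) * decay (scale_matrix (1 / max 1 (norm \<sigma> / R)) 1 *v \<tau>)" for \<sigma> \<tau>
  proof (cases "norm \<sigma> \<le> R")
    case True
    hence "max 1 (norm \<sigma> / R) = 1" using R by simp
    moreover have "scale_matrix 1 1 *v \<tau> = \<tau>" by (simp add: scale_matrix_mult)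
    ultimately show ?thesis using small[OF True, of \<tau>] by simp
  next
    case False
    let ?l = "R / norm \<sigma>"
    have l: "0 < ?l" "?l \<le> 1" "?l * norm \<sigma> = R"
    proof -
      have "0 < norm \<sigma>" "R < norm \<sigma>" using False R by auto
      thus "0 < ?l" "?l \<le> 1" "?l * norm \<sigma> = R" using R by (simp_all add: pos_divide_le_eq)
    qed
    have mx: "1 / max 1 (norm \<sigma> / R) = ?l" using False R by (simp add: max_def field_simps)
    have "osc F F (freq_matrix 1 \<sigma> 1) \<tau> =
        of_real (?l ^ (2 * m + 1)) * osc F F (freq_matrix 1 (?l *\<^sub>R \<sigma>) 1) (scale_matrix ?l 1 *v \<tau>)"
      by (rule osc_rescale[OF F B(2) hom]) (use l R in auto)
    hence "norm (osc F F (freq_matrix 1 \<sigma> 1) \<tau>) =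
        ?l ^ (2 * m + 1) * norm (osc F F (freq_matrix 1 (?l *\<^sub>R \<sigma>) 1) (scale_matrix ?l 1 *v \<tau>))"
      using l by (simp only: norm_mult norm_of_real abs_power_minus abs_of_nonneg[OF zero_le_power[OF less_imp_le]])
    also have "\<dots> \<le> ?l ^ (2 * m + 1) * (C * decay (scale_matrix ?l 1 *v \<tau>))"
      using l R by (intro mult_left_mono small) auto
    finally show ?thesis unfolding mx using m by (simp add: mult_ac)
  qed
  thus ?thesis by (rule that[OF C(1) R(1)])
qed

section \<open>Integral bounds\<close>

lemma nn_integral_lborel_matrix_comp:
  assumes A: "scales_lborel A c" and f: "f \<in> borel_measurable borel"
  shows "(\<integral>\<^sup>+x. f (A *v x) \<partial>lborel) = ennreal (1 / c) * (\<integral>\<^sup>+x. f x \<partial>lborel)"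
proof -
  have c: "c > 0" using A by (rule scales_lborel_pos)
  have "ennreal (1 / c) * (\<integral>\<^sup>+x. f x \<partial>lborel) = (ennreal (1 / c) * ennreal c) * (\<integral>\<^sup>+x. f (A *v x) \<partial>lborel)"
    by (simp only: nn_integral_lborel_matrix[OF A f] mult.assoc)
  also have "ennreal (1 / c) * ennreal c = 1" using c by (simp add: ennreal_mult[symmetric])
  finally show ?thesis by simp
qed

lemma nn_integral_cmult_translate:
  fixes s :: "'a::euclidean_space"
  assumes [measurable]: "f \<in> borel_measurable borel"
  shows "(\<integral>\<^sup>+x. c * f (x - s) \<partial>lborel) = c * (\<integral>\<^sup>+x. f x \<partial>lborel)"
  by (subst nn_integral_cmult) (simp_all add: nn_integral_lborel_translate)

definition frame_matrix_inv :: "real \<Rightarrow> real ^ 'n::finite \<Rightarrow> real ^ 'n option ^ 'n option" where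
  "frame_matrix_inv \<alpha> s = dilation_matrix (1 / \<alpha>) ** shear_matrix (- s)"

lemma dil_det_inverse: "dil_det TYPE('n::finite) (1 / \<alpha>) = 1 / dil_det TYPE('n) \<alpha>"
  by (simp add: dil_det_def powr_divide)

lemma scales_lborel_frame_matrix_inv:
  "\<alpha> \<noteq> 0 \<Longrightarrow> scales_lborel (frame_matrix_inv \<alpha> (s :: real ^ 'n::finite)) (1 / dil_det TYPE('n) \<alpha>)"
  unfolding frame_matrix_inv_def
  using scales_lborel_mult[OF scales_lborel_dilation scales_lborel_shear, of "1 / \<alpha>" "- s"]
  by (simp add: dil_det_inverse)

text \<open>Two linear substitutions: passing from t' to the relative translation has Jacobian
  \<open>dil_det\<close> of \<alpha>, and undoing the compression of its first coordinate costs the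
  factor 1/\<open>l\<close>. Without rescaling, \<open>l\<close> is 1.\<close>

lemma nn_integral_osc_powr_le:
  fixes s :: "real ^ 'n::finite"
  assumes bd: "\<And>\<tau>. norm (osc f g L \<tau>) \<le> c * decay (scale_matrix l 1 *v \<tau>)"
    and "l > 0" "c \<ge> 0" "k \<ge> 0" "\<alpha> \<noteq> 0" "q > 0"
  shows "(\<integral>\<^sup>+t'. ennreal ((k * norm (osc f g L (frame_matrix_inv \<alpha> s *v (t' - t)))) powr q) \<partial>lborel) \<le>
    ennreal (dil_det TYPE('n) \<alpha> * (k * c) powr q / l) *
    (\<integral>\<^sup>+\<tau>. ennreal (decay (\<tau> :: real ^ 'n option) powr q) \<partial>lborel)"
proof -
  let ?T = "frame_matrix_inv \<alpha> s" and ?D = "scale_matrix l 1 :: real ^ 'n option ^ 'n option"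
  let ?h = "\<lambda>x. ennreal (decay (x :: real ^ 'n option) powr q)"
  have D: "scales_lborel ?D l" using scales_lborel_scale_matrix[of l 1] \<open>l > 0\<close> by simp
  note T = scales_lborel_frame_matrix_inv[OF \<open>\<alpha> \<noteq> 0\<close>, of s]
  have pos: "dil_det TYPE('n) \<alpha> > 0" by (rule dil_det_pos[OF \<open>\<alpha> \<noteq> 0\<close>])
  have "(\<integral>\<^sup>+t'. ennreal ((k * norm (osc f g L (?T *v (t' - t)))) powr q) \<partial>lborel) \<le>
      (\<integral>\<^sup>+t'. ennreal ((k * c) powr q) * ?h (?D *v (?T *v (t' - t))) \<partial>lborel)"
  proof (intro nn_integral_mono)
    fix t'
    let ?\<tau> = "?T *v (t' - t)"
    have "k * norm (osc f g L ?\<tau>) \<le> (k * c) * decay (?D *v ?\<tau>)"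
      using mult_left_mono[OF bd \<open>k \<ge> 0\<close>] by (simp add: mult.assoc)
    hence "(k * norm (osc f g L ?\<tau>)) powr q \<le> ((k * c) * decay (?D *v ?\<tau>)) powr q"
      using \<open>k \<ge> 0\<close> \<open>q > 0\<close> by (intro powr_mono2) auto
    also have "\<dots> = (k * c) powr q * decay (?D *v ?\<tau>) powr q"
      by (simp add: powr_mult)
    finally show "ennreal ((k * norm (osc f g L ?\<tau>)) powr q) \<le> ennreal ((k * c) powr q) * ?h (?D *v ?\<tau>)"
      by (simp add: ennreal_mult[symmetric] ennreal_leI)
  qed
  also have "\<dots> = ennreal ((k * c) powr q) * (\<integral>\<^sup>+t'. ?h (?D *v (?T *v (t' - t))) \<partial>lborel)"
    by (rule nn_integral_cmult) measurable
  also have "(\<integral>\<^sup>+t'. ?h (?D *v (?T *v (t' - t))) \<partial>lborel) = (\<integral>\<^sup>+t'. ?h (?D *v (?T *v t')) \<partial>lborel)"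
    by (rule nn_integral_lborel_translate[where f = "\<lambda>x. ?h (?D *v (?T *v x))"]) measurable
  also have "\<dots> = ennreal (dil_det TYPE('n) \<alpha>) * (\<integral>\<^sup>+x. ?h (?D *v x) \<partial>lborel)"
    using nn_integral_lborel_matrix_comp[OF T, of "\<lambda>x. ?h (?D *v x)"] by simp
  also have "(\<integral>\<^sup>+x. ?h (?D *v x) \<partial>lborel) = ennreal (1 / l) * (\<integral>\<^sup>+x. ?h x \<partial>lborel)"
    by (rule nn_integral_lborel_matrix_comp[OF D]) measurable
  also have "ennreal ((k * c) powr q) * (ennreal (dil_det TYPE('n) \<alpha>) * (ennreal (1 / l) * (\<integral>\<^sup>+x. ?h x \<partial>lborel))) =
      ennreal (dil_det TYPE('n) \<alpha> * (k * c) powr q / l) * (\<integral>\<^sup>+x. ?h x \<partial>lborel)"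
  proof -
    have "dil_det TYPE('n) \<alpha> * (k * c) powr q / l = (k * c) powr q * (dil_det TYPE('n) \<alpha> * (1 / l))" by simp
    thus ?thesis using pos \<open>l > 0\<close> by (simp only: ennreal_mult mult.assoc powr_ge_zero less_imp_le mult_nonneg_nonneg divide_nonneg_nonneg zero_le_one)
  qed
  finally show ?thesis .
qed

text \<open>No polar coordinates are involved: every factor of \<open>decay\<close> at \<sigma>/R is
  at least the radial factor, so the radial power p is dominated by \<open>decay\<close> to the
  power p / \<open>CARD('n)\<close>, which exceeds 1.\<close>

lemma nn_integral_max_norm_powr_finite:
  fixes R p :: real
  assumes "R > 0" and p: "p > CARD('n::finite)"
  shows "(\<integral>\<^sup>+\<sigma>. ennreal ((max 1 (norm (\<sigma> :: real ^ 'n) / R)) powr (- p)) \<partial>lborel) < \<infinity>"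
proof -
  let ?n = "real CARD('n)"
  let ?h = "\<lambda>\<sigma> :: real ^ 'n. ennreal (decay \<sigma> powr (p / ?n))"
  have n: "?n > 0" by simp
  have "(\<integral>\<^sup>+\<sigma>. ennreal ((max 1 (norm (\<sigma> :: real ^ 'n) / R)) powr (- p)) \<partial>lborel) \<le>
      (\<integral>\<^sup>+\<sigma>. ?h ((1 / R) *\<^sub>R \<sigma>) \<partial>lborel)"
  proof (intro nn_integral_mono ennreal_leI)
    fix \<sigma> :: "real ^ 'n"
    let ?l = "max 1 (norm \<sigma> / R)"
    have l: "?l > 0" by simp
    have "(1 / ?l) ^ CARD('n) = (\<Prod>j\<in>(UNIV :: 'n set). 1 / ?l)" by simp
    also have "\<dots> \<le> decay ((1 / R) *\<^sub>R \<sigma>)"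
      unfolding decay_def
    proof (intro prod_mono conjI divide_left_mono)
      fix j
      show "max 1 \<bar>((1 / R) *\<^sub>R \<sigma>) $ j\<bar> \<le> ?l"
        using component_le_norm_cart[of \<sigma> j] \<open>R > 0\<close>
        by (intro max.mono) (auto simp: abs_mult divide_right_mono)
    qed auto
    finally have "((1 / ?l) ^ CARD('n)) powr (p / ?n) \<le> decay ((1 / R) *\<^sub>R \<sigma>) powr (p / ?n)"
      using p n by (intro powr_mono2) auto
    also have "((1 / ?l) ^ CARD('n)) powr (p / ?n) = (1 / ?l) powr (?n * (p / ?n))"
      using l by (subst powr_realpow[symmetric]) (simp_all add: powr_powr)
    also have "\<dots> = ?l powr (- p)"
      using n by (simp add: powr_divide powr_minus inverse_eq_divide)
    finally show "?l powr (- p) \<le> decay ((1 / R) *\<^sub>R \<sigma>) powr (p / ?n)" .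
  qed
  also have "\<dots> < \<infinity>"
  proof -
    have "(\<integral>\<^sup>+\<sigma>. ?h \<sigma> \<partial>lborel) = (\<integral>\<^sup>+\<sigma>. ?h \<sigma> \<partial>density (distr lborel borel (\<lambda>x :: real ^ 'n. 0 + (1 / R) *\<^sub>R x)) (\<lambda>_. \<bar>1 / R\<bar> ^ DIM(real ^ 'n)))"
      using lborel_affine[of "1 / R" "0 :: real ^ 'n"] \<open>R > 0\<close> by simp
    also have "\<dots> = ennreal (\<bar>1 / R\<bar> ^ DIM(real ^ 'n)) * (\<integral>\<^sup>+\<sigma>. ?h ((1 / R) *\<^sub>R \<sigma>) \<partial>lborel)"
      by (simp add: nn_integral_density nn_integral_distr nn_integral_cmult)
    finally have "ennreal (\<bar>1 / R\<bar> ^ DIM(real ^ 'n)) * (\<integral>\<^sup>+\<sigma>. ?h ((1 / R) *\<^sub>R \<sigma>) \<partial>lborel) < \<infinity>"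
      using nn_integral_decay_powr_finite[of "p / ?n", where 'm = 'n] p n by simp
    thus ?thesis using \<open>R > 0\<close> by (auto simp: ennreal_mult_less_top)
  qed
  finally show ?thesis .
qed

section \<open>Weighted powers of the kernel and their integrals\<close>

definition weight_ratio :: "real \<Rightarrow> real \<Rightarrow> real \<Rightarrow> real" where
  "weight_ratio r \<alpha> \<beta> = max (\<bar>\<alpha>\<bar> powr (- r) / \<bar>\<beta>\<bar> powr (- r)) (\<bar>\<beta>\<bar> powr (- r) / \<bar>\<alpha>\<bar> powr (- r))"

lemma weight_ratio_nonneg: "weight_ratio r \<alpha> \<beta> \<ge> 0"
  by (simp add: weight_ratio_def le_max_iff_disj)

lemma weight_ratio_commute: "weight_ratio r \<alpha> \<beta> = weight_ratio r \<beta> \<alpha>"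
  by (simp add: weight_ratio_def max.commute)

text \<open>The weight depends only on the quotient of the scales, so confining that quotient bounds
  it however small the scales are.\<close>

lemma weight_ratio_le:
  assumes "\<alpha> \<noteq> 0" "\<beta> \<noteq> 0" "r \<ge> 0" "c > 0" "\<bar>\<beta> / \<alpha>\<bar> \<le> c" "1 / c \<le> \<bar>\<beta> / \<alpha>\<bar>"
  shows "weight_ratio r \<alpha> \<beta> \<le> c powr r"
proof -
  have 1: "\<bar>\<alpha>\<bar> powr (- r) / \<bar>\<beta>\<bar> powr (- r) = \<bar>\<beta> / \<alpha>\<bar> powr r"
    using assms by (simp add: powr_minus powr_divide field_simps)
  have 2: "\<bar>\<beta>\<bar> powr (- r) / \<bar>\<alpha>\<bar> powr (- r) = \<bar>\<alpha> / \<beta>\<bar> powr r"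
    using assms by (simp add: powr_minus powr_divide field_simps)
  have "\<bar>\<alpha> / \<beta>\<bar> \<le> c" using assms by (simp add: field_simps)
  thus ?thesis unfolding weight_ratio_def 1 2
    using assms by (intro max.boundedI powr_mono2) auto
qed

text \<open>The q-th power of the weighted kernel in terms of real scales. The scale \<infinity> is
  represented by the value 1 together with the choice of \<open>f\<close> or
  \<open>g\<close>.\<close>

definition kernel_powr where
  "kernel_powr q r f g \<alpha> s t \<beta> s' t' = ennreal
     ((sqrt (dil_det TYPE('n) \<beta> / dil_det TYPE('n) \<alpha>) * weight_ratio r \<alpha> \<beta> *
       norm (osc f g (freq_matrix \<alpha> (s' - s) \<beta>) (frame_matrix_inv \<alpha> (s :: real ^ 'n::finite) *v (t' - t)))) powr q)"

abbreviation kernel_integral where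
  "kernel_integral q r f g \<alpha> s t \<beta> \<equiv>
     \<integral>\<^sup>+s'. \<integral>\<^sup>+t'. kernel_powr q r f g \<alpha> s t \<beta> s' t' \<partial>lborel \<partial>lborel"

definition scale_density :: "'n::finite itself \<Rightarrow> real \<Rightarrow> ennreal" where
  "scale_density _ \<beta> = ennreal (1 / \<bar>\<beta>\<bar> ^ (CARD('n option) + 1)) * indicator ({-1..1} - {0}) \<beta>"

abbreviation kernel_scale_integral where
  "kernel_scale_integral q r f g \<alpha> s t \<equiv>
     \<integral>\<^sup>+\<beta>. scale_density TYPE('n) \<beta> * kernel_integral q r f g \<alpha> (s :: real ^ 'n::finite) t \<beta> \<partial>lborel"

text \<open>With the shear confined to a ball, the translation integral is bounded by a constant and
  the shear integral by the volume of the ball.\<close>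

lemma nn_integral_kernel_powr_le:
  fixes s :: "real ^ 'n::finite"
  assumes bd: "\<And>\<sigma> \<tau>. norm (osc f g (freq_matrix \<alpha> \<sigma> \<beta>) \<tau>) \<le> c * decay \<tau> * indicator (cball 0 \<rho>) \<sigma>"
    and k: "sqrt (dil_det TYPE('n) \<beta> / dil_det TYPE('n) \<alpha>) * weight_ratio r \<alpha> \<beta> \<le> k"
    and "c \<ge> 0" "\<alpha> \<noteq> 0" "q > 0"
  shows "kernel_integral q r f g \<alpha> s t \<beta> \<le>
    ennreal (dil_det TYPE('n) \<alpha> * (k * c) powr q) *
    (\<integral>\<^sup>+\<tau>. ennreal (decay (\<tau> :: real ^ 'n option) powr q) \<partial>lborel) * emeasure lborel (cball (0 :: real ^ 'n) \<rho>)"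
proof -
  let ?I = "\<integral>\<^sup>+\<tau>. ennreal (decay (\<tau> :: real ^ 'n option) powr q) \<partial>lborel"
  let ?k = "sqrt (dil_det TYPE('n) \<beta> / dil_det TYPE('n) \<alpha>) * weight_ratio r \<alpha> \<beta>"
  let ?C = "ennreal (dil_det TYPE('n) \<alpha> * (k * c) powr q) * ?I"
  have k0: "?k \<ge> 0"
    using weight_ratio_nonneg[of r \<alpha> \<beta>] by (intro mult_nonneg_nonneg) (simp_all add: dil_det_def)
  have inner: "(\<integral>\<^sup>+t'. kernel_powr q r f g \<alpha> s t \<beta> s' t' \<partial>lborel) \<le> ?C * indicator (cball 0 \<rho>) (s' - s)" for s'
  proof -
    let ?i = "indicator (cball 0 \<rho>) (s' - s) :: real"
    have "(\<integral>\<^sup>+t'. kernel_powr q r f g \<alpha> s t \<beta> s' t' \<partial>lborel) \<le>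
        ennreal (dil_det TYPE('n) \<alpha> * (?k * (c * ?i)) powr q / 1) * ?I"
      unfolding kernel_powr_def
    proof (rule nn_integral_osc_powr_le)
      show "norm (osc f g (freq_matrix \<alpha> (s' - s) \<beta>) \<tau>) \<le> c * ?i * decay (scale_matrix 1 1 *v \<tau>)" for \<tau>
        using bd[of "s' - s" \<tau>] by (simp add: scale_matrix_mult mult_ac)
    qed (use assms k0 in auto)
    also have "\<dots> \<le> ennreal (dil_det TYPE('n) \<alpha> * (k * c) powr q * ?i) * ?I"
    proof (intro mult_right_mono ennreal_leI)
      have "(?k * c) powr q \<le> (k * c) powr q"
        using k k0 assms by (intro powr_mono2 mult_right_mono) auto
      hence le: "dil_det TYPE('n) \<alpha> * (?k * c) powr q \<le> dil_det TYPE('n) \<alpha> * (k * c) powr q"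
        by (rule mult_left_mono) (simp add: dil_det_def)
      show "dil_det TYPE('n) \<alpha> * (?k * (c * ?i)) powr q / 1 \<le> dil_det TYPE('n) \<alpha> * (k * c) powr q * ?i"
      proof (cases "s' - s \<in> cball 0 \<rho>")
        case True
        hence "?i = 1" by (rule indicator_simps)
        thus ?thesis using le by (simp only: mult_1_right div_by_1)
      next
        case False
        hence "?i = 0" by (rule indicator_simps)
        thus ?thesis by (simp only: mult_zero_right powr_0 div_by_1 order_refl)
      qed
    qed simp
    also have "\<dots> = ?C * indicator (cball 0 \<rho>) (s' - s)"
      by (auto split: split_indicator)
    finally show ?thesis .
  qed
  have "kernel_integral q r f g \<alpha> s t \<beta> \<le>
      (\<integral>\<^sup>+s'. ?C * indicator (cball 0 \<rho>) (s' - s) \<partial>lborel)"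
    by (rule nn_integral_mono) (rule inner)
  also have "\<dots> = ?C * (\<integral>\<^sup>+s'. indicator (cball 0 \<rho>) (s' :: real ^ 'n) \<partial>lborel)"
    by (intro nn_integral_cmult_translate borel_measurable_indicator borel_closed closed_cball)
  also have "\<dots> = ?C * emeasure lborel (cball (0 :: real ^ 'n) \<rho>)"
    by (subst nn_integral_indicator) simp_all
  finally show ?thesis .
qed

lemma kernel_bound_inf_inf:
  fixes F :: "real ^ 'n::finite option \<Rightarrow> complex"
  assumes F: "smooth_compact_support F" and a0: "0 < a0" and m: "2 * m = CARD('n)" and q: "q > 1"
    and hom: "\<And>\<kappa> u v. 0 < \<kappa> \<Longrightarrow> \<kappa> \<le> 1 \<Longrightarrow> \<bar>u\<bar> < a0 \<Longrightarrow> F (cons_vec (\<kappa> * u) v) = of_real (\<kappa> ^ m) * F (cons_vec u v)"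
  shows "\<exists>A<\<infinity>. \<forall>s t. kernel_integral q r F F 1 s t 1 \<le> A"
proof -
  let ?d = "CARD('n option)"
  let ?I = "\<integral>\<^sup>+\<tau>. ennreal (decay (\<tau> :: real ^ 'n option) powr q) \<partial>lborel"
  obtain C R where C: "C \<ge> 0" "R > 0"
    "\<And>\<sigma> \<tau>. norm (osc F F (freq_matrix 1 \<sigma> 1) \<tau>) \<le>
      C * (1 / max 1 (norm \<sigma> / R)) ^ ?d * decay (scale_matrix (1 / max 1 (norm \<sigma> / R)) 1 *v \<tau>)"
    using osc_bound_inf_inf[OF F a0 m hom] by blast
  let ?l = "\<lambda>\<sigma> :: real ^ 'n. max 1 (norm \<sigma> / R)"
  \<comment> \<open>d q comes from the q-th power of the gain, and 1 is lost to the compressed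
    coordinate of the translation.\<close>
  let ?p = "real ?d * q - 1"
  let ?J = "\<integral>\<^sup>+\<sigma>. ennreal (?l \<sigma> powr (- ?p)) \<partial>lborel"
  let ?A = "ennreal (C powr q) * ?I * ?J"
  have p: "?p > CARD('n)"
  proof -
    have "real ?d * 1 < real ?d * q" using q by (intro mult_strict_left_mono) auto
    moreover have "real ?d = real CARD('n) + 1" by simp
    ultimately show ?thesis by linarith
  qed
  have "?A < \<infinity>"
    using nn_integral_decay_powr_finite[OF q, where 'm = "'n option"] nn_integral_max_norm_powr_finite[OF C(2) p]
    by (simp add: ennreal_mult_less_top)
  moreover have "kernel_integral q r F F 1 s t 1 \<le> ?A" for s t
  proof -
    have inner: "(\<integral>\<^sup>+t'. kernel_powr q r F F 1 s t 1 s' t' \<partial>lborel) \<le> ennreal (C powr q) * ?I * ennreal (?l (s' - s) powr (- ?p))" for s'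
    proof -
      let ?m = "?l (s' - s)"
      have m: "?m > 0" by simp
      have "(\<integral>\<^sup>+t'. kernel_powr q r F F 1 s t 1 s' t' \<partial>lborel) \<le>
        ennreal (dil_det TYPE('n) 1 * (1 * (C * (1 / ?m) ^ ?d)) powr q / (1 / ?m)) * ?I"
      proof -
        have "sqrt (dil_det TYPE('n) 1 / dil_det TYPE('n) 1) * weight_ratio r 1 1 = 1"
          by (simp add: weight_ratio_def)
        thus ?thesis
          unfolding kernel_powr_def
          by (simp only:) (rule nn_integral_osc_powr_le[OF C(3)], use C q in auto)
      qed
      also have "dil_det TYPE('n) 1 * (1 * (C * (1 / ?m) ^ ?d)) powr q / (1 / ?m) = C powr q * ?m powr (- ?p)"
      proof -
        have "((1 / ?m) ^ ?d) powr q = (1 / ?m) powr (real ?d * q)"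
          using m by (subst powr_realpow[symmetric]) (simp_all add: powr_powr)
        also have "\<dots> = ?m powr (- (real ?d * q))"
          by (simp add: powr_divide powr_minus inverse_eq_divide)
        finally have "((1 / ?m) ^ ?d) powr q * ?m = ?m powr (- (real ?d * q)) * ?m powr 1"
          using m by simp
        also have "\<dots> = ?m powr (- (real ?d * q) + 1)" by (rule powr_add[symmetric])
        also have "- (real ?d * q) + 1 = - ?p" by simp
        finally have "((1 / ?m) ^ ?d) powr q * ?m = ?m powr (- ?p)" .
        moreover have "(1 * (C * X)) powr q / (1 / y) = C powr q * (X powr q * y)" for X y :: real
          by (simp add: powr_mult)
        ultimately show ?thesis by (simp only: dil_det_1 mult_1)
      qed
      finally show ?thesis using C by (simp add: ennreal_mult mult_ac)
    qed
    have "kernel_integral q r F F 1 s t 1 \<le>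
        (\<integral>\<^sup>+s'. ennreal (C powr q) * ?I * ennreal (?l (s' - s) powr (- ?p)) \<partial>lborel)"
      by (rule nn_integral_mono) (rule inner)
    also have "\<dots> = ?A"
      by (rule nn_integral_cmult_translate[where f = "\<lambda>\<sigma>. ennreal (?l \<sigma> powr (- ?p))"]) measurable
    finally show ?thesis .
  qed
  ultimately show ?thesis by blast
qed

lemma dil_det_le_1: "\<bar>\<alpha>\<bar> \<le> 1 \<Longrightarrow> dil_det TYPE('n::finite) \<alpha> \<le> 1"
  using dil_det_mono[where 'n = 'n, of \<alpha> 1] by simp

text \<open>Only scales between \<epsilon> and 1 interact with the scale \<infinity>, and there the
  scale density, the weight and the determinants are bounded; what remains is a bounded set of
  shears and an integrable power of \<open>decay\<close>.\<close>

lemma kernel_bound_inf_scale: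
  fixes F G :: "real ^ 'n::finite option \<Rightarrow> complex"
  assumes F: "smooth_compact_support F" and G: "smooth_compact_support G" and a: "0 < a0" and q: "q > 1"
    and r: "r \<ge> 0" and supp: "\<And>\<eta>. G \<eta> \<noteq> 0 \<Longrightarrow> a0 \<le> \<bar>\<eta> $ None\<bar>"
  shows "\<exists>A<\<infinity>. \<forall>s t. kernel_scale_integral q r G F 1 s t \<le> A"
    and "\<exists>A<\<infinity>. \<forall>\<alpha> s t. \<alpha> \<noteq> 0 \<and> \<bar>\<alpha>\<bar> \<le> 1 \<longrightarrow>
      kernel_integral q r F G \<alpha> s t 1 \<le> A"
proof -
  let ?\<delta> = "dil_det TYPE('n)" and ?d = "CARD('n option)"
  let ?I = "\<integral>\<^sup>+\<tau>. ennreal (decay (\<tau> :: real ^ 'n option) powr q) \<partial>lborel"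
  have I: "?I < \<infinity>" by (rule nn_integral_decay_powr_finite[OF q])
  obtain C S \<epsilon> where C: "C \<ge> 0" "S \<ge> 0" "\<epsilon> > 0"
    and bd1: "\<And>\<beta> \<sigma> \<tau>. \<beta> \<noteq> 0 \<Longrightarrow> \<bar>\<beta>\<bar> \<le> 1 \<Longrightarrow> norm (osc G F (freq_matrix 1 \<sigma> \<beta>) \<tau>) \<le>
      C * decay \<tau> * indicator {\<epsilon>..} \<bar>\<beta>\<bar> * indicator (cball 0 S) \<sigma>"
    and bd2: "\<And>\<alpha> \<sigma> \<tau>. \<alpha> \<noteq> 0 \<Longrightarrow> \<bar>\<alpha>\<bar> \<le> 1 \<Longrightarrow> norm (osc F G (freq_matrix \<alpha> \<sigma> 1) \<tau>) \<le>
      C * decay \<tau> * indicator {\<epsilon>..} \<bar>\<alpha>\<bar> * indicator (cball 0 S) \<sigma>"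
    using osc_bound_inf_scale[OF F G a supp] by blast
  let ?V = "emeasure lborel (cball (0 :: real ^ 'n) S)"
  have V: "?V < \<infinity>" by (rule emeasure_bounded_finite) simp
  have w: "weight_ratio r 1 \<beta> \<le> (1 / \<epsilon>) powr r" if "\<epsilon> \<le> \<bar>\<beta>\<bar>" "\<bar>\<beta>\<bar> \<le> 1" for \<beta>
  proof (rule weight_ratio_le)
    have "\<epsilon> \<le> 1" using that by linarith
    thus "\<bar>\<beta> / 1\<bar> \<le> 1 / \<epsilon>" using that C by (simp add: pos_le_divide_eq mult_le_one)
  qed (use that C r in auto)
  show "\<exists>A<\<infinity>. \<forall>s t. kernel_scale_integral q r G F 1 s t \<le> A"
  proof (intro exI conjI allI)
    let ?K = "ennreal (((1 / \<epsilon>) powr r * C) powr q) * ?I * ?V"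
    \<comment> \<open>The power of \<epsilon> bounds the scale density, and 2 is the length of
      [-1, 1].\<close>
    let ?A = "ennreal (1 / \<epsilon> ^ (?d + 1)) * ?K * 2"
    show "?A < \<infinity>" using I V by (simp add: ennreal_mult_less_top)
    fix s t
    have inner: "scale_density TYPE('n) \<beta> * kernel_integral q r G F 1 s t \<beta> \<le>
        ennreal (1 / \<epsilon> ^ (?d + 1)) * ?K * indicator {-1..1} \<beta>" for \<beta>
    proof (cases "\<beta> \<in> {-1..1} - {0}")
      case False
      thus ?thesis by (simp add: scale_density_def)
    next
      case True
      hence \<beta>: "\<beta> \<noteq> 0" "\<bar>\<beta>\<bar> \<le> 1" by auto
      show ?thesis
      proof (cases "\<epsilon> \<le> \<bar>\<beta>\<bar>")
        case False
        have "kernel_integral q r G F 1 s t \<beta> = 0"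
        proof -
          have "kernel_powr q r G F 1 s t \<beta> s' t' = 0" for s' t'
            using bd1[OF \<beta>, of "s' - s" "frame_matrix_inv 1 s *v (t' - t)"] False q
            by (simp add: kernel_powr_def)
          thus ?thesis by simp
        qed
        thus ?thesis by simp
      next
        case eb: True
        have "kernel_integral q r G F 1 s t \<beta> \<le>
            ennreal (?\<delta> 1 * ((1 / \<epsilon>) powr r * C) powr q) * ?I * ?V"
        proof (rule nn_integral_kernel_powr_le)
          show "norm (osc G F (freq_matrix 1 \<sigma> \<beta>) \<tau>) \<le> C * decay \<tau> * indicator (cball 0 S) \<sigma>" for \<sigma> \<tau>
            using bd1[OF \<beta>, of \<sigma> \<tau>] eb by simp
          have "sqrt (?\<delta> \<beta> / ?\<delta> 1) * weight_ratio r 1 \<beta> \<le> 1 * (1 / \<epsilon>) powr r"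
            using w[OF eb \<beta>(2)] dil_det_le_1[where 'n = 'n, OF \<beta>(2)]
            by (intro mult_mono weight_ratio_nonneg) auto
          thus "sqrt (?\<delta> \<beta> / ?\<delta> 1) * weight_ratio r 1 \<beta> \<le> (1 / \<epsilon>) powr r" by simp
        qed (use C q in auto)
        moreover have "scale_density TYPE('n) \<beta> \<le> ennreal (1 / \<epsilon> ^ (?d + 1))"
          using eb C True by (auto simp: scale_density_def intro!: ennreal_leI divide_left_mono power_mono mult_mono)
        ultimately have "scale_density TYPE('n) \<beta> * kernel_integral q r G F 1 s t \<beta> \<le>
            ennreal (1 / \<epsilon> ^ (?d + 1)) * ?K"
          by (intro mult_mono) simp_all
        thus ?thesis using True by simp
      qed
    qed
    have "kernel_scale_integral q r G F 1 s t \<le>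
      (\<integral>\<^sup>+\<beta>. ennreal (1 / \<epsilon> ^ (?d + 1)) * ?K * indicator {-1..1} (\<beta> :: real) \<partial>lborel)"
      by (rule nn_integral_mono) (rule inner)
    also have "\<dots> = ?A"
      by (subst nn_integral_cmult_indicator) simp_all
    finally show "kernel_scale_integral q r G F 1 s t \<le> ?A" .
  qed
  show "\<exists>A<\<infinity>. \<forall>\<alpha> s t. \<alpha> \<noteq> 0 \<and> \<bar>\<alpha>\<bar> \<le> 1 \<longrightarrow>
      kernel_integral q r F G \<alpha> s t 1 \<le> A"
  proof (intro exI conjI allI impI)
    \<comment> \<open>Now the finite scale stands in the denominator, so the normalising factor is
      bounded by its value at \<epsilon>.\<close>
    let ?k = "sqrt (1 / ?\<delta> \<epsilon>) * (1 / \<epsilon>) powr r"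
    let ?A = "ennreal (1 * (?k * C) powr q) * ?I * ?V"
    show "?A < \<infinity>" using I V by (simp add: ennreal_mult_less_top)
    fix \<alpha> :: real and s t
    assume "\<alpha> \<noteq> 0 \<and> \<bar>\<alpha>\<bar> \<le> 1"
    hence \<alpha>: "\<alpha> \<noteq> 0" "\<bar>\<alpha>\<bar> \<le> 1" by auto
    show "kernel_integral q r F G \<alpha> s t 1 \<le> ?A"
    proof (cases "\<epsilon> \<le> \<bar>\<alpha>\<bar>")
      case False
      have "kernel_powr q r F G \<alpha> s t 1 s' t' = 0" for s' t'
        using bd2[OF \<alpha>, of "s' - s" "frame_matrix_inv \<alpha> s *v (t' - t)"] False q
        by (simp add: kernel_powr_def)
      thus ?thesis by simp
    next
      case ea: True
      have "kernel_integral q r F G \<alpha> s t 1 \<le>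
            ennreal (?\<delta> \<alpha> * (?k * C) powr q) * ?I * ?V"
      proof (rule nn_integral_kernel_powr_le)
        show "norm (osc F G (freq_matrix \<alpha> \<sigma> 1) \<tau>) \<le> C * decay \<tau> * indicator (cball 0 S) \<sigma>" for \<sigma> \<tau>
          using bd2[OF \<alpha>, of \<sigma> \<tau>] ea by simp
        have "?\<delta> \<epsilon> \<le> ?\<delta> \<alpha>" using ea C by (intro dil_det_mono) simp
        moreover have "?\<delta> \<epsilon> > 0" using C by (intro dil_det_pos) simp
        ultimately have "1 / ?\<delta> \<alpha> \<le> 1 / ?\<delta> \<epsilon>" by (intro divide_left_mono) auto
        thus "sqrt (?\<delta> 1 / ?\<delta> \<alpha>) * weight_ratio r \<alpha> 1 \<le> ?k"
          using w[OF ea \<alpha>(2)] dil_det_pos[where 'n = 'n, of \<epsilon>] C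
          by (intro mult_mono weight_ratio_nonneg) (auto simp: weight_ratio_commute[of r \<alpha> 1])
      qed (use C q \<alpha> in auto)
      also have "\<dots> \<le> ?A"
        using dil_det_le_1[where 'n = 'n, OF \<alpha>(2)]
        by (intro mult_right_mono ennreal_leI) auto
      finally show ?thesis .
    qed
  qed
qed

text \<open>The powers of |\<alpha>| cancel: -(d + 1) from the density of \<beta>, which is
  comparable to \<alpha>, then 1 from the length of the interval of admissible \<beta>, and d from
  the Jacobian of the translation times the volume of the shear ball, in whose product the powers of
  dil \<alpha> cancel.\<close>

lemma kernel_bound_scale_scale:
  fixes G :: "real ^ 'n::finite option \<Rightarrow> complex"
  assumes G: "smooth_compact_support G" and a: "0 < a0" "a0 < a1" and q: "q > 1" and r: "r \<ge> 0"
    and supp: "\<And>\<eta>. G \<eta> \<noteq> 0 \<Longrightarrow> a0 \<le> \<bar>\<eta> $ None\<bar> \<and> \<bar>\<eta> $ None\<bar> \<le> a1"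
  shows "\<exists>A<\<infinity>. \<forall>\<alpha> s t. \<alpha> \<noteq> 0 \<and> \<bar>\<alpha>\<bar> \<le> 1 \<longrightarrow> kernel_scale_integral q r G G \<alpha> s t \<le> A"
proof -
  let ?\<delta> = "dil_det TYPE('n)" and ?d = "CARD('n option)" and ?D = "dil TYPE('n)"
  let ?I = "\<integral>\<^sup>+\<tau>. ennreal (decay (\<tau> :: real ^ 'n option) powr q) \<partial>lborel"
  have I: "?I < \<infinity>" by (rule nn_integral_decay_powr_finite[OF q])
  obtain C S where C: "C \<ge> 0" "S \<ge> 0"
    and bd: "\<And>\<alpha> \<beta> \<sigma> \<tau>. \<alpha> \<noteq> 0 \<Longrightarrow> \<beta> \<noteq> 0 \<Longrightarrow> norm (osc G G (freq_matrix \<alpha> \<sigma> \<beta>) \<tau>) \<le>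
      C * decay \<tau> * indicator {a0 / a1..a1 / a0} \<bar>\<beta> / \<alpha>\<bar> * indicator (cball 0 (S * \<bar>\<alpha>\<bar> / \<bar>?D \<alpha>\<bar>)) \<sigma>"
    using osc_bound_scale_scale[OF G a supp] by blast
  define e where "e = a1 / a0"
  have e: "e > 0" "1 / e = a0 / a1" using a by (simp_all add: e_def)
  define k where "k = sqrt (?\<delta> e) * e powr r"
  define v where "v = unit_ball_vol (real CARD('n))"
  have v: "v \<ge> 0" by (simp add: v_def)
  \<comment> \<open>The factors are the weighted kernel constant, the volume of the shear ball and
    the scale integral, each with its power of \<alpha> and dil \<alpha> removed.\<close>
  let ?c = "(k * C) powr q * (v * S ^ CARD('n)) * (e ^ (?d + 1) * (2 * e))"
  show ?thesis
  proof (intro exI conjI allI impI)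
    show "ennreal ?c * ?I < \<infinity>" using I by (simp add: ennreal_mult_less_top)
    fix \<alpha> :: real and s t
    assume "\<alpha> \<noteq> 0 \<and> \<bar>\<alpha>\<bar> \<le> 1"
    hence \<alpha>: "\<alpha> \<noteq> 0" "\<bar>\<alpha>\<bar> \<le> 1" by auto
    let ?\<rho> = "S * \<bar>\<alpha>\<bar> / \<bar>?D \<alpha>\<bar>"
    have \<rho>: "?\<rho> \<ge> 0" using C by simp
    let ?V = "emeasure lborel (cball (0 :: real ^ 'n) ?\<rho>)"
    have V: "?V = ennreal (v * ?\<rho> ^ CARD('n))"
      using emeasure_cball[OF \<rho>, of "0 :: real ^ 'n"] by (simp add: v_def)
    let ?K = "ennreal (?\<delta> \<alpha> * (k * C) powr q) * ?I * ?V"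
    \<comment> \<open>For confined ratios |\<beta>| is at least |\<alpha>|/\<open>e\<close>, so this
      bounds the scale density there.\<close>
    let ?w = "1 / (\<bar>\<alpha>\<bar> / e) ^ (?d + 1)"
    have inner: "scale_density TYPE('n) \<beta> * kernel_integral q r G G \<alpha> s t \<beta> \<le>
        (ennreal ?w * ?K) * indicator {- (e * \<bar>\<alpha>\<bar>)..e * \<bar>\<alpha>\<bar>} \<beta>" for \<beta>
    proof (cases "\<beta> \<in> {-1..1} - {0}")
      case False
      thus ?thesis by (simp add: scale_density_def)
    next
      case True
      hence \<beta>: "\<beta> \<noteq> 0" "\<bar>\<beta>\<bar> \<le> 1" by auto
      show ?thesis
      proof (cases "\<bar>\<beta> / \<alpha>\<bar> \<in> {a0 / a1..a1 / a0}")
        case False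
        have "kernel_powr q r G G \<alpha> s t \<beta> s' t' = 0" for s' t'
          using bd[OF \<alpha>(1) \<beta>(1), of "s' - s" "frame_matrix_inv \<alpha> s *v (t' - t)"] False q
          by (simp add: kernel_powr_def)
        thus ?thesis by simp
      next
        case eb: True
        hence ratio: "1 / e \<le> \<bar>\<beta> / \<alpha>\<bar>" "\<bar>\<beta> / \<alpha>\<bar> \<le> e" by (auto simp: e(2)) (simp add: e_def)
        have le: "\<bar>\<beta>\<bar> \<le> e * \<bar>\<alpha>\<bar>" "\<bar>\<alpha>\<bar> / e \<le> \<bar>\<beta>\<bar>"
          using ratio e(1) \<alpha> by (simp_all add: field_simps)
        have "kernel_integral q r G G \<alpha> s t \<beta> \<le> ?K"
        proof (rule nn_integral_kernel_powr_le)
          show "norm (osc G G (freq_matrix \<alpha> \<sigma> \<beta>) \<tau>) \<le> C * decay \<tau> * indicator (cball 0 ?\<rho>) \<sigma>" for \<sigma> \<tau>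
            using bd[OF \<alpha>(1) \<beta>(1), of \<sigma> \<tau>] eb by simp
          have "?\<delta> \<beta> / ?\<delta> \<alpha> = ?\<delta> (\<beta> / \<alpha>)" by (simp add: dil_det_def powr_divide)
          also have "\<dots> \<le> ?\<delta> e" using ratio e by (intro dil_det_mono) simp
          finally show "sqrt (?\<delta> \<beta> / ?\<delta> \<alpha>) * weight_ratio r \<alpha> \<beta> \<le> k"
            unfolding k_def using weight_ratio_le[OF \<alpha>(1) \<beta>(1) r e(1) ratio(2) ratio(1)]
            by (intro mult_mono weight_ratio_nonneg) (auto simp: dil_det_def)
        qed (use C q \<alpha> in auto)
        moreover have "scale_density TYPE('n) \<beta> \<le> ennreal ?w"
        proof -
          have "scale_density TYPE('n) \<beta> = ennreal (1 / \<bar>\<beta>\<bar> ^ (?d + 1))"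
            using True by (simp add: scale_density_def)
          also have "\<dots> \<le> ennreal ?w"
            using le e \<alpha> \<beta> by (intro ennreal_leI divide_left_mono power_mono mult_pos_pos zero_less_power) auto
          finally show ?thesis .
        qed
        ultimately have "scale_density TYPE('n) \<beta> * kernel_integral q r G G \<alpha> s t \<beta> \<le>
            ennreal ?w * ?K"
          by (intro mult_mono) simp_all
        moreover have "\<beta> \<in> {- (e * \<bar>\<alpha>\<bar>)..e * \<bar>\<alpha>\<bar>}" using le(1) by (simp add: abs_le_iff)
        ultimately show ?thesis by simp
      qed
    qed
    have "kernel_scale_integral q r G G \<alpha> s t \<le>
      (\<integral>\<^sup>+\<beta>. (ennreal ?w * ?K) * indicator {- (e * \<bar>\<alpha>\<bar>)..e * \<bar>\<alpha>\<bar>} \<beta> \<partial>lborel)"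
      by (rule nn_integral_mono) (rule inner)
    also have "\<dots> = (ennreal ?w * ?K) * ennreal (2 * (e * \<bar>\<alpha>\<bar>))"
      using e by (subst nn_integral_cmult_indicator) simp_all
    also have "\<dots> = ennreal (?w * (?\<delta> \<alpha> * (k * C) powr q) * (v * ?\<rho> ^ CARD('n)) * (2 * (e * \<bar>\<alpha>\<bar>))) * ?I"
    proof -
      have gen: "(ennreal w * (ennreal x * J * ennreal y)) * ennreal z = ennreal (w * x * y * z) * J"
        if "0 \<le> w" "0 \<le> x" "0 \<le> y" "0 \<le> z" for w x y z :: real and J :: ennreal
        using that by (simp add: ennreal_mult mult_ac)
      have "0 \<le> ?w" "0 \<le> ?\<delta> \<alpha> * (k * C) powr q" "0 \<le> v * ?\<rho> ^ CARD('n)" "0 \<le> 2 * (e * \<bar>\<alpha>\<bar>)"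
        using e v \<rho> by (auto simp: dil_det_def)
      thus ?thesis unfolding V by (rule gen)
    qed
    also have "?w * (?\<delta> \<alpha> * (k * C) powr q) * (v * ?\<rho> ^ CARD('n)) * (2 * (e * \<bar>\<alpha>\<bar>)) = ?c"
    proof -
      have pos: "\<bar>\<alpha>\<bar> > 0" "\<bar>?D \<alpha>\<bar> > 0" using \<alpha> dil_nonzero[where 'n = 'n, of \<alpha>] by auto
      have 1: "?w = e ^ (?d + 1) / \<bar>\<alpha>\<bar> ^ (?d + 1)" by (simp only: power_divide) simp
      have 2: "?\<rho> ^ CARD('n) = S ^ CARD('n) * \<bar>\<alpha>\<bar> ^ CARD('n) / \<bar>?D \<alpha>\<bar> ^ CARD('n)"
        by (simp only: power_divide power_mult_distrib)
      have "\<bar>\<alpha>\<bar> ^ (?d + 1) = \<bar>\<alpha>\<bar> * \<bar>\<alpha>\<bar> * \<bar>\<alpha>\<bar> ^ CARD('n)" by simp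
      hence "(1 / \<bar>\<alpha>\<bar> ^ (?d + 1)) * (\<bar>\<alpha>\<bar> * \<bar>?D \<alpha>\<bar> ^ CARD('n)) * (\<bar>\<alpha>\<bar> ^ CARD('n) / \<bar>?D \<alpha>\<bar> ^ CARD('n)) * \<bar>\<alpha>\<bar> = 1"
        using pos by simp
      moreover have "?w * (?\<delta> \<alpha> * (k * C) powr q) * (v * ?\<rho> ^ CARD('n)) * (2 * (e * \<bar>\<alpha>\<bar>)) =
        ?c * ((1 / \<bar>\<alpha>\<bar> ^ (?d + 1)) * (\<bar>\<alpha>\<bar> * \<bar>?D \<alpha>\<bar> ^ CARD('n)) * (\<bar>\<alpha>\<bar> ^ CARD('n) / \<bar>?D \<alpha>\<bar> ^ CARD('n)) * \<bar>\<alpha>\<bar>)"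
        unfolding 1 2 dil_det_eq by (simp only: times_divide_eq_right times_divide_eq_left mult_ac mult_1)
      ultimately show ?thesis by (simp only: mult_1_right)
    qed
    finally show "kernel_scale_integral q r G G \<alpha> s t \<le> ennreal ?c * ?I" .
  qed
qed

section \<open>The measure space of parameters\<close>

abbreviation param_borel :: "'n::finite param measure" where
  "param_borel \<equiv> borel \<Otimes>\<^sub>M (borel \<Otimes>\<^sub>M borel)"

text \<open>The parameter measure lives on a subspace; composing with this identity restricts
  functions that are Borel on the whole type.\<close>

lemma ident_measurable_param: "(\<lambda>x. x) \<in> measurable param_measure (param_borel :: 'n::finite param measure)"
proof -
  have "sets (param_measure :: 'n param measure) = sets (restrict_space param_borel param_space)"
    by (simp add: sets_param_measure borel_prod)
  moreover have "(\<lambda>x. x) \<in> measurable (restrict_space param_borel param_space) (param_borel :: 'n param measure)"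
    by (rule measurable_restrict_space1) simp
  ultimately show ?thesis by (simp cong: measurable_cong_sets)
qed

text \<open>Both terms are integrals over image measures of Lebesgue measures, so the identity is
  checked on sets and extended by induction over measurable functions. The order of integration
  differs from that in the measure: the translation is innermost because the kernel bounds integrate
  it first, at fixed shear and scale.\<close>

lemma nn_integral_param_measure:
  fixes f :: "'n::finite param \<Rightarrow> ennreal"
  assumes f: "f \<in> borel_measurable param_borel"
  shows "(\<integral>\<^sup>+x. f x \<partial>param_measure) = (\<integral>\<^sup>+s. \<integral>\<^sup>+t. f (\<infinity>, s, t) \<partial>lborel \<partial>lborel) +
    (\<integral>\<^sup>+a. scale_density TYPE('n) a * (\<integral>\<^sup>+s. \<integral>\<^sup>+t. f (ereal a, s, t) \<partial>lborel \<partial>lborel) \<partial>lborel)"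
proof -
  let ?B = "lborel \<Otimes>\<^sub>M lborel :: ((real ^ 'n option) \<times> (real ^ 'n)) measure"
  let ?w = "scale_density TYPE('n)"
  let ?p = "\<lambda>x. (\<infinity>, snd x, fst x)" and ?g = "\<lambda>x. (ereal (snd x), snd (fst x), fst (fst x))"
  define M1 where "M1 = distr ?B param_borel ?p"
  define M2 where "M2 = distr (density (?B \<Otimes>\<^sub>M lborel) (\<lambda>x. ?w (snd x))) param_borel ?g"
  interpret B: pair_sigma_finite "lborel :: (real ^ 'n option) measure" "lborel :: (real ^ 'n) measure" ..
  interpret B': pair_sigma_finite ?B "lborel :: real measure" ..
  have [measurable]: "?w \<in> borel_measurable borel"
    unfolding scale_density_def[abs_def] by measurable
  have [measurable]: "?p \<in> measurable ?B param_borel" "?g \<in> measurable (?B \<Otimes>\<^sub>M lborel) param_borel"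
    by measurable
  have M1: "nn_integral M1 h = (\<integral>\<^sup>+x. h (?p x) \<partial>?B)" if "h \<in> borel_measurable param_borel" for h
    unfolding M1_def by (rule nn_integral_distr) (use that in simp_all)
  have M2: "nn_integral M2 h = (\<integral>\<^sup>+x. ?w (snd x) * h (?g x) \<partial>(?B \<Otimes>\<^sub>M lborel))"
    if [measurable]: "h \<in> borel_measurable param_borel" for h
  proof -
    have "nn_integral M2 h = (\<integral>\<^sup>+x. h (?g x) \<partial>density (?B \<Otimes>\<^sub>M lborel) (\<lambda>x. ?w (snd x)))"
      unfolding M2_def by (rule nn_integral_distr) simp_all
    also have "\<dots> = (\<integral>\<^sup>+x. ?w (snd x) * h (?g x) \<partial>(?B \<Otimes>\<^sub>M lborel))"
      by (rule nn_integral_density) simp_all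
    finally show ?thesis .
  qed
  have sM: "sets M1 = sets param_borel" "sets M2 = sets param_borel"
    by (simp_all add: M1_def M2_def)
  have meas: "h \<in> borel_measurable M1" "h \<in> borel_measurable M2" "h \<in> borel_measurable param_measure"
    if "h \<in> borel_measurable param_borel" for h :: "'n param \<Rightarrow> ennreal"
    using that measurable_compose[OF ident_measurable_param that] sM by (simp_all cong: measurable_cong_sets)
  have "nn_integral param_measure f = nn_integral M1 f + nn_integral M2 f"
    using f
  proof (induction f rule: borel_measurable_induct)
    case (cong f g)
    hence "f = g" by (auto simp: space_pair_measure)
    thus ?case using cong by simp
  next
    case (set A)
    let ?J1 = "\<integral>\<^sup>+ t. \<integral>\<^sup>+ s. indicator A (\<infinity>, s, t) \<partial>lborel \<partial>lborel"
    let ?J2 = "\<integral>\<^sup>+ t. \<integral>\<^sup>+ s. \<integral>\<^sup>+ a. ?w a * indicator A (ereal a, s, t) \<partial>lborel \<partial>lborel \<partial>lborel"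
    \<comment> \<open>\<open>A\<close> may leave the parameter space, but points outside carry no
      mass: the scale density vanishes there.\<close>
    let ?E = "A \<inter> param_space"
    have E: "?E \<in> sets param_measure"
      using measurable_sets[OF ident_measurable_param set] by simp
    have m: "indicator A \<in> borel_measurable param_borel" using set by simp
    have sp: "(\<infinity>, s, t) \<in> param_space" "a \<in> {-1..1} - {0} \<Longrightarrow> (ereal a, s, t) \<in> param_space" for a s t
      by (auto simp: param_space_def)
    have [measurable]: "A \<in> sets param_borel" by (rule set)
    have "nn_integral param_measure (indicator A) = nn_integral param_measure (indicator ?E)"
      by (intro nn_integral_cong) (auto split: split_indicator)
    also have "\<dots> = emeasure param_measure ?E" using E by simp
    also have "\<dots> = ?J1 +
        ?J2"
      unfolding emeasure_param_measure[OF E]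
      by (intro arg_cong2[where f = "(+)"] nn_integral_cong)
         (auto simp: sp scale_density_def split: split_indicator)
    also have "?J1 = nn_integral M1 (indicator A)"
      unfolding M1[OF m] by (subst lborel.nn_integral_fst[symmetric]) simp_all
    also have "?J2 = nn_integral M2 (indicator A)"
    proof -
      have "(\<integral>\<^sup>+x. ?w (snd x) * indicator A (?g x) \<partial>(?B \<Otimes>\<^sub>M lborel)) =
          (\<integral>\<^sup>+x. \<integral>\<^sup>+ a. ?w a * indicator A (ereal a, snd x, fst x) \<partial>lborel \<partial>?B)"
        by (subst lborel.nn_integral_fst[symmetric]) simp_all
      also have "\<dots> = ?J2"
        by (subst lborel.nn_integral_fst[symmetric]) simp_all
      finally show ?thesis unfolding M2[OF m] by simp
    qed
    finally show ?case .
  next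
    case (mult u c)
    show ?case
      by (simp only: nn_integral_cmult[OF meas(1)[OF mult.hyps(2)]] nn_integral_cmult[OF meas(2)[OF mult.hyps(2)]]
          nn_integral_cmult[OF meas(3)[OF mult.hyps(2)]] mult.IH distrib_left)
  next
    case (add u v)
    note u = meas[OF add.hyps(1)] and v = meas[OF add.hyps(3)]
    show ?case
      by (simp only: nn_integral_add[OF v(1) u(1)] nn_integral_add[OF v(2) u(2)] nn_integral_add[OF v(3) u(3)] add.IH)
         (simp only: ac_simps)
  next
    case (seq U)
    have m: "U i \<in> borel_measurable M1" "U i \<in> borel_measurable M2" "U i \<in> borel_measurable param_measure" for i
      using meas[OF seq.hyps(1)] by auto
    have inc: "incseq (\<lambda>i. nn_integral N (U i))" for N
      using seq.hyps(3) by (auto simp: incseq_def le_fun_def intro!: nn_integral_mono)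
    have sup: "nn_integral N (\<lambda>x. SUP i. U i x) = (SUP i. nn_integral N (U i))"
      if "\<And>i. U i \<in> borel_measurable N" for N
      by (rule nn_integral_monotone_convergence_SUP[OF seq.hyps(3) that])
    have "(\<lambda>x. SUP i. U i x) = Sup (range U)" by (rule ext) (rule SUP_apply[symmetric])
    hence h: "nn_integral param_measure (Sup (range U)) = (SUP i. nn_integral param_measure (U i))"
      "nn_integral M1 (Sup (range U)) = (SUP i. nn_integral M1 (U i))"
      "nn_integral M2 (Sup (range U)) = (SUP i. nn_integral M2 (U i))"
      using sup[OF m(1)] sup[OF m(2)] sup[OF m(3)] by simp_all
    show ?case unfolding h seq.IH by (rule ennreal_SUP_add[OF inc inc])
  qed
  also have "nn_integral M1 f = (\<integral>\<^sup>+s. \<integral>\<^sup>+t. f (\<infinity>, s, t) \<partial>lborel \<partial>lborel)"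
    unfolding M1[OF f] using f by (subst lborel_pair.nn_integral_snd[symmetric]) simp_all
  also have "nn_integral M2 f = (\<integral>\<^sup>+a. scale_density TYPE('n) a * (\<integral>\<^sup>+s. \<integral>\<^sup>+t. f (ereal a, s, t) \<partial>lborel \<partial>lborel) \<partial>lborel)"
  proof -
    note [measurable] = f
    have "nn_integral M2 f = (\<integral>\<^sup>+a. \<integral>\<^sup>+x. ?w a * f (ereal a, snd x, fst x) \<partial>?B \<partial>lborel)"
      unfolding M2[OF f] by (subst B'.nn_integral_snd[symmetric]) simp_all
    also have "\<dots> = (\<integral>\<^sup>+a. ?w a * (\<integral>\<^sup>+x. f (ereal a, snd x, fst x) \<partial>?B) \<partial>lborel)"
      by (intro nn_integral_cong nn_integral_cmult) measurable
    also have "\<dots> = (\<integral>\<^sup>+a. ?w a * (\<integral>\<^sup>+s. \<integral>\<^sup>+t. f (ereal a, s, t) \<partial>lborel \<partial>lborel) \<partial>lborel)"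
      by (intro nn_integral_cong arg_cong2[where f = "(*)"] refl) (subst lborel_pair.nn_integral_snd[symmetric], simp_all)
    finally show ?thesis .
  qed
  finally show ?thesis .
qed

section \<open>Membership in the kernel space\<close>

lemma borel_measurable_dil [measurable]:
  assumes [measurable]: "f \<in> borel_measurable M"
  shows "(\<lambda>x. dil TYPE('n::finite) (f x)) \<in> borel_measurable M"
proof -
  have "dil TYPE('n) a = (if a > 0 then a powr (1 / CARD('n option)) else if a < 0 then - ((- a) powr (1 / CARD('n option))) else 0)" for a
    by (simp add: dil_def sgn_if del: card_option)
  thus ?thesis by simp
qed

lemma borel_measurable_dil_det [measurable]:
  assumes [measurable]: "f \<in> borel_measurable M"
  shows "(\<lambda>x. dil_det TYPE('n::finite) (f x)) \<in> borel_measurable M"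
  unfolding dil_det_def by measurable

lemma borel_measurable_scale_of [measurable]:
  assumes [measurable]: "f \<in> borel_measurable M"
  shows "(\<lambda>x. scale_of (f x)) \<in> borel_measurable M"
  unfolding scale_of_def by measurable

lemma borel_measurable_weight_ratio [measurable]:
  assumes [measurable]: "f \<in> borel_measurable M" "g \<in> borel_measurable M"
  shows "(\<lambda>x. weight_ratio r (f x) (g x)) \<in> borel_measurable M"
  unfolding weight_ratio_def by measurable

text \<open>The kernel without its normalising factor, extended to all pairs of points;
  \<open>F\<close> and \<open>G\<close> stand for the Fourier transforms of the two
  generators.\<close>

definition kernel_osc where
  "kernel_osc F G = (\<lambda>((a, s, t), (a', s', t')). osc (generator F G a') (generator F G a)
     (freq_matrix (scale_of a) (s' - s) (scale_of a')) (frame_matrix_inv (scale_of a) s *v (t' - t)))"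

text \<open>Explicit coordinates replace the matrix actions, and a case distinction on the scale
  replaces the choice of generator. The integrand is then visibly jointly measurable, hence so is
  the integral in its parameters.\<close>

lemma borel_measurable_kernel_osc [measurable]:
  fixes F G :: "real ^ 'n::finite option \<Rightarrow> complex"
  assumes [measurable]: "F \<in> borel_measurable borel" "G \<in> borel_measurable borel"
  shows "kernel_osc F G \<in> borel_measurable (param_borel \<Otimes>\<^sub>M param_borel)"
proof -
  let ?D = "dil TYPE('n)"
  define L where "L \<alpha> \<sigma> \<beta> \<eta> = cons_vec (\<beta> * (\<eta> $ None / \<alpha>))
     (?D \<beta> *\<^sub>R (?D (1 / \<alpha>) *\<^sub>R tail_vec \<eta> + (\<eta> $ None / \<alpha>) *\<^sub>R \<sigma>))" for \<alpha> \<sigma> \<beta> and \<eta> :: "real ^ 'n option"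
  define V where "V \<alpha> s t = cons_vec ((1 / \<alpha>) * (t $ None + (- s) \<bullet> tail_vec t)) (?D (1 / \<alpha>) *\<^sub>R tail_vec t)"
    for \<alpha> s and t :: "real ^ 'n option"
  have "kernel_osc F G = (\<lambda>z. LINT \<eta>|lborel.
      (if fst (snd z) = \<infinity> then F (L (scale_of (fst (fst z))) (fst (snd (snd z)) - fst (snd (fst z))) (scale_of (fst (snd z))) \<eta>)
        else G (L (scale_of (fst (fst z))) (fst (snd (snd z)) - fst (snd (fst z))) (scale_of (fst (snd z))) \<eta>)) *
      cnj (if fst (fst z) = \<infinity> then F \<eta> else G \<eta>) *
      cis (- 2 * pi * (V (scale_of (fst (fst z))) (fst (snd (fst z))) (snd (snd (snd z)) - snd (snd (fst z))) \<bullet> \<eta>)))"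
    (is "_ = ?R")
  proof
    fix z
    show "kernel_osc F G z = ?R z"
    by (cases z; cases "fst (snd z) = \<infinity>"; cases "fst (fst z) = \<infinity>")
       (simp_all add: kernel_osc_def case_prod_beta osc_def generator_def L_def V_def freq_matrix_mult frame_matrix_inv_def
          matrix_vector_mul_assoc[symmetric] dilation_matrix_mult shear_matrix_mult del: matrix_vector_mul_assoc)
  qed
  thus ?thesis unfolding L_def V_def by (simp only:) measurable
qed

lemma frame_kernel_hermitian: "frame_kernel \<psi> y x = cnj (frame_kernel \<psi> x y)"
  unfolding frame_kernel_def L2_inner_def
  by (subst Bochner_Integration.integral_cnj[symmetric]) (simp add: mult.commute)

lemma kernel_weight_scale_weight:
  "kernel_weight (scale_weight r) (a, s, t) (a', s', t') = weight_ratio r (scale_of a) (scale_of a')"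
  by (simp add: kernel_weight_def scale_weight_def weight_ratio_def scale_of_def)

lemma kernel_weight_commute: "kernel_weight v x y = kernel_weight v y x"
  by (simp add: kernel_weight_def max.commute)

lemma ennreal_powr_mono: "c \<le> C \<Longrightarrow> p > 0 \<Longrightarrow> ennreal_powr c p \<le> ennreal_powr C p"
  by (cases "C = \<infinity>")
     (auto simp: ennreal_powr_def top_unique less_top[symmetric] intro!: ennreal_leI powr_mono2 enn2real_mono)

lemma ennreal_powr_less_top: "C < \<infinity> \<Longrightarrow> ennreal_powr C p < \<infinity>"
  by (simp add: ennreal_powr_def)

lemma borel_measurable_ennreal_powr [measurable]:
  assumes [measurable]: "f \<in> borel_measurable M"
  shows "(\<lambda>x. ennreal_powr (f x) p) \<in> borel_measurable M"
  unfolding ennreal_powr_def by measurable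

theorem theorem3p9:
  fixes a0 a1 r q :: real
    and b :: "real ^ 'n::finite"
    and \<Phi> \<Psi> :: "real ^ 'n option \<Rightarrow> complex"
  assumes "CARD('n option) \<ge> 3" and "odd CARD('n option)"
    and "0 < a0" and "a0 < a1" and "\<forall>i. b $ i > 0" and "r \<ge> 0"
    and "in_L1 \<Psi>" and "in_L2 \<Psi>" and "admissible_shearlet \<Psi>" and "schwartz \<Psi>"
    and "supp (fourier \<Psi>) \<subseteq>
           {\<xi>. \<xi> $ None \<in> {-a1..-a0} \<union> {a0..a1} \<and> tail_vec \<xi> \<in> cbox (- b) b}"
    and "in_L1 \<Phi>" and "in_L2 \<Phi>"
    and "\<forall>\<xi>1 \<xi>'. fourier \<Phi> (cons_vec \<xi>1 \<xi>') =
           of_real (\<xi>1 ^ ((CARD('n option) - 1) div 2) *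
             sqrt (LINT \<omega>1 : - {-\<bar>\<xi>1\<bar>..\<bar>\<xi>1\<bar>} | lborel.
               (norm (fourier \<Psi> (cons_vec \<omega>1 \<xi>')))\<^sup>2 / \<bar>\<omega>1\<bar> ^ CARD('n option)))"
    and "AE y in lborel.
           (LINT \<sigma>|lborel. (norm (fourier \<Phi> (cons_vec y \<sigma>)))\<^sup>2 / \<bar>y\<bar> ^ (CARD('n option) - 1)) +
           (LINT \<xi>'|lborel. (LINT \<xi>1 : {-\<bar>y\<bar>..\<bar>y\<bar>} | lborel.
             (norm (fourier \<Psi> (cons_vec \<xi>1 \<xi>')))\<^sup>2 / \<bar>\<xi>1\<bar> ^ CARD('n option))) = 1"
    and "smooth_compact_support (fourier \<Phi>)"
    and "q > 1"
  shows "frame_kernel (shearlet_system \<Phi> \<Psi>)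
           \<in> weighted_kernel_space param_measure q (kernel_weight (scale_weight r))"
proof -
  let ?F = "fourier \<Phi>" and ?G = "fourier \<Psi>" and ?\<delta> = "dil_det TYPE('n)"
  let ?M = "param_measure :: 'n param measure"
  let ?K = "frame_kernel (shearlet_system \<Phi> \<Psi>)"
  let ?k = "\<lambda>x y. ennreal (norm (?K x y * of_real (kernel_weight (scale_weight r) x y)) powr q)"
  \<comment> \<open>In odd dimension the integer division is exact, so 2 m is the dimension of the
    shear.\<close>
  define m where "m = (CARD('n option) - 1) div 2"
  have m: "2 * m = CARD('n)" using \<open>odd CARD('n option)\<close> by (auto simp: m_def)
  have supp: "a0 \<le> \<bar>\<eta> $ None\<bar> \<and> \<bar>\<eta> $ None\<bar> \<le> a1" if "?G \<eta> \<noteq> 0" for \<eta>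
  proof -
    have "\<eta> \<in> supp ?G" using that not_in_supp by blast
    hence "\<eta> $ None \<in> {-a1..-a0} \<union> {a0..a1}" using assms(11) by blast
    thus ?thesis using assms(3,4) by auto
  qed
  \<comment> \<open>Smoothness of the transform comes from the rapid decrease of
    \<open>\<Psi>\<close>, and its closed support lies in a bounded box.\<close>
  have G: "smooth_compact_support ?G"
    unfolding smooth_compact_support_def
  proof
    show "smooth ?G" by (intro smooth_fourier schwartz_rapidly_decreasing) fact
    have "bounded (supp ?G)"
      unfolding bounded_iff
    proof (intro exI ballI)
      fix \<xi> assume "\<xi> \<in> supp ?G"
      hence \<xi>: "\<xi> $ None \<in> {-a1..-a0} \<union> {a0..a1}" "tail_vec \<xi> \<in> cbox (- b) b" using assms(11) by auto
      have "norm \<xi> \<le> (\<Sum>i\<in>UNIV. \<bar>\<xi> $ i\<bar>)" by (rule norm_le_l1_cart)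
      also have "\<dots> = \<bar>\<xi> $ None\<bar> + (\<Sum>k\<in>UNIV. \<bar>\<xi> $ Some k\<bar>)" by (rule sum_option)
      also have "\<dots> \<le> a1 + (\<Sum>k\<in>UNIV. b $ k)"
      proof (intro add_mono sum_mono)
        show "\<bar>\<xi> $ None\<bar> \<le> a1" using \<xi>(1) assms(3,4) by auto
        show "\<bar>\<xi> $ Some k\<bar> \<le> b $ k" for k
          using \<xi>(2) by (simp add: mem_box_cart abs_le_iff minus_le_iff)
      qed
      finally show "norm \<xi> \<le> a1 + (\<Sum>k\<in>UNIV. b $ k)" .
    qed
    thus "compact (supp ?G)" by (simp add: compact_eq_bounded_closed supp_def)
  qed
  have F: "smooth_compact_support ?F" by fact
  \<comment> \<open>For |x| < a0 the removed interval misses the support of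
    \<open>fourier \<Psi>\<close>, so the square root is the same at \<kappa> u and at u and only
    the monomial changes.\<close>
  have hom: "?F (cons_vec (\<kappa> * u) v) = of_real (\<kappa> ^ m) * ?F (cons_vec u v)"
    if \<kappa>: "0 < \<kappa>" "\<kappa> \<le> 1" and u: "\<bar>u\<bar> < a0" for \<kappa> u v
  proof -
    let ?f = "\<lambda>\<omega>. (norm (?G (cons_vec \<omega> v)))\<^sup>2 / \<bar>\<omega>\<bar> ^ CARD('n option)"
    have int: "(LINT \<omega>1 : - {-\<bar>x\<bar>..\<bar>x\<bar>} | lborel. ?f \<omega>1) = (LINT \<omega>1|lborel. ?f \<omega>1)" if "\<bar>x\<bar> < a0" for x
      unfolding set_lebesgue_integral_def
    proof (intro Bochner_Integration.integral_cong refl)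
      fix \<omega>
      show "indicator (- {-\<bar>x\<bar>..\<bar>x\<bar>}) \<omega> *\<^sub>R ?f \<omega> = ?f \<omega>"
      proof (cases "\<omega> \<in> {-\<bar>x\<bar>..\<bar>x\<bar>}")
        case True
        hence "\<bar>\<omega>\<bar> < a0" using that by auto
        hence "?G (cons_vec \<omega> v) = 0" using supp[of "cons_vec \<omega> v"] by force
        thus ?thesis by simp
      qed simp
    qed
    have "\<bar>\<kappa> * u\<bar> \<le> 1 * \<bar>u\<bar>" unfolding abs_mult using \<kappa> by (intro mult_right_mono) auto
    hence "\<bar>\<kappa> * u\<bar> < a0" using u by simp
    thus ?thesis
      using assms(14) int[of "\<kappa> * u"] int[OF u] unfolding m_def[symmetric]
      by (simp only: power_mult_distrib of_real_mult mult.assoc)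
  qed
  note Fm = smooth_borel[OF smooth_compact_support_smooth[OF F], of "\<lambda>x. x" borel, simplified]
  note Gm = smooth_borel[OF smooth_compact_support_smooth[OF G], of "\<lambda>x. x" borel, simplified]
  note [measurable] = borel_measurable_kernel_osc[OF Fm Gm]
  have gen: "fourier (generator \<Phi> \<Psi> a) = generator ?F ?G a" for a by (simp add: generator_def)
  \<comment> \<open>\<open>K\<close> and \<open>N\<close> are Borel on all pairs of points and agree
    with the kernel and its weighted q-th power on the parameter space, so measurability is
    established for them first.\<close>
  define K where "K z = of_real (sqrt (?\<delta> (scale_of (fst (snd z))) / ?\<delta> (scale_of (fst (fst z))))) * kernel_osc ?F ?G z" for z
  define N where "N z = ennreal ((sqrt (?\<delta> (scale_of (fst (snd z))) / ?\<delta> (scale_of (fst (fst z)))) *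
      weight_ratio r (scale_of (fst (fst z))) (scale_of (fst (snd z))) * norm (kernel_osc ?F ?G z)) powr q)" for z
  have [measurable]: "K \<in> borel_measurable (param_borel \<Otimes>\<^sub>M param_borel)"
    "N \<in> borel_measurable (param_borel \<Otimes>\<^sub>M param_borel)"
    unfolding K_def[abs_def] N_def[abs_def] by measurable
  have K_eq: "?K x y = K (x, y)" if "x \<in> param_space" "y \<in> param_space" for x y
  proof -
    obtain a s t a' s' t' where [simp]: "x = (a, s, t)" "y = (a', s', t')" by (metis prod_cases3)
    show ?thesis
      using that frame_kernel_eq_osc[OF \<open>in_L1 \<Phi>\<close> F \<open>in_L1 \<Psi>\<close> G, of a s t a' s' t']
      by (simp add: K_def kernel_osc_def gen frame_matrix_inv_def matrix_vector_mul_assoc)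
  qed
  have N_eq: "?k x y = N (x, y)"
    if "x \<in> param_space" "y \<in> param_space" for x y
  proof -
    obtain a s t a' s' t' where [simp]: "x = (a, s, t)" "y = (a', s', t')" by (metis prod_cases3)
    have "?\<delta> c \<ge> 0" for c by (simp add: dil_det_def)
    thus ?thesis
      unfolding K_eq[OF that]
      by (simp add: K_def N_def kernel_weight_scale_weight norm_mult weight_ratio_nonneg mult_ac)
  qed
  have N_powr: "N ((a, s, t), (a', s', t')) = kernel_powr q r (generator ?F ?G a') (generator ?F ?G a)
      (scale_of a) s t (scale_of a') s' t'" for a s t a' s' t'
    by (simp add: N_def kernel_powr_def kernel_osc_def)
  \<comment> \<open>The integral over the second parameter, again as a Borel function on the whole
    type; bounding the essential supremum asks for measurability besides the pointwise
    bound.\<close>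
  define J where "J x = (\<integral>\<^sup>+s'. \<integral>\<^sup>+t'. N (x, (\<infinity>, s', t')) \<partial>lborel \<partial>lborel) +
      (\<integral>\<^sup>+\<beta>. scale_density TYPE('n) \<beta> * (\<integral>\<^sup>+s'. \<integral>\<^sup>+t'. N (x, (ereal \<beta>, s', t')) \<partial>lborel \<partial>lborel) \<partial>lborel)" for x
  have [measurable]: "scale_density TYPE('n) \<in> borel_measurable borel"
    unfolding scale_density_def[abs_def] by measurable
  have J_m: "J \<in> borel_measurable param_borel"
    unfolding J_def[abs_def] by measurable
  have J_eq: "(\<integral>\<^sup>+y. ?k x y \<partial>?M) = J x"
    if "x \<in> param_space" for x
  proof -
    have "(\<integral>\<^sup>+y. ?k x y \<partial>?M) = (\<integral>\<^sup>+y. N (x, y) \<partial>?M)"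
      by (intro nn_integral_cong N_eq that) simp
    also have "\<dots> = J x"
      unfolding J_def
      by (intro nn_integral_param_measure measurable_compose[OF measurable_Pair1' \<open>N \<in> _\<close>])
         (simp add: space_pair_measure)
    finally show ?thesis .
  qed
  obtain A1 where A1: "A1 < \<infinity>" "\<And>s t. kernel_integral q r ?F ?F 1 s t 1 \<le> A1"
    using kernel_bound_inf_inf[OF F \<open>0 < a0\<close> m \<open>q > 1\<close> hom, of r] by blast
  obtain A2 where A2: "A2 < \<infinity>" "\<And>s t. kernel_scale_integral q r ?G ?F 1 s t \<le> A2"
    using kernel_bound_inf_scale(1)[OF F G \<open>0 < a0\<close> \<open>q > 1\<close> \<open>r \<ge> 0\<close>] supp by blast
  obtain A3 where A3: "A3 < \<infinity>" "\<And>\<alpha> s t. \<alpha> \<noteq> 0 \<Longrightarrow> \<bar>\<alpha>\<bar> \<le> 1 \<Longrightarrow>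
      kernel_integral q r ?F ?G \<alpha> s t 1 \<le> A3"
    using kernel_bound_inf_scale(2)[OF F G \<open>0 < a0\<close> \<open>q > 1\<close> \<open>r \<ge> 0\<close>] supp by blast
  obtain A4 where A4: "A4 < \<infinity>" "\<And>\<alpha> s t. \<alpha> \<noteq> 0 \<Longrightarrow> \<bar>\<alpha>\<bar> \<le> 1 \<Longrightarrow> kernel_scale_integral q r ?G ?G \<alpha> s t \<le> A4"
    using kernel_bound_scale_scale[OF G \<open>0 < a0\<close> \<open>a0 < a1\<close> \<open>q > 1\<close> \<open>r \<ge> 0\<close> supp] by blast
  \<comment> \<open>A first parameter at scale \<infinity> uses A1 and A2, one at a finite scale A3
    and A4; in each pair the two bounds belong to the scale \<infinity> and to the finite scales of
    the second parameter.\<close>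
  let ?A = "(A1 + A2) + (A3 + A4)"
  have A: "?A < \<infinity>" using A1(1) A2(1) A3(1) A4(1) by simp
  have J_le: "J x \<le> ?A" if px: "x \<in> param_space" for x
  proof -
    obtain a s t where x: "x = (a, s, t)" by (metis prod_cases3)
    have gs: "generator ?F ?G (ereal \<beta>) = ?G" "scale_of (ereal \<beta>) = \<beta>" "generator ?F ?G \<infinity> = ?F" "scale_of \<infinity> = 1" for \<beta>
      by (simp_all add: generator_def scale_of_def)
    show ?thesis
    proof (cases "a = \<infinity>")
      case True
      have "J x \<le> A1 + A2"
        unfolding J_def x True N_powr gs by (intro add_mono A1 A2)
      thus ?thesis by (rule order_trans) simp
    next
      case False
      then obtain \<alpha> where \<alpha>: "a = ereal \<alpha>" using px unfolding x by (auto simp: param_space_def)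
      have "\<alpha> \<noteq> 0" "\<bar>\<alpha>\<bar> \<le> 1"
        using px param_space_scale[of a s t] by (simp_all add: x \<alpha> gs)
      hence "J x \<le> A3 + A4"
        unfolding J_def x \<alpha> N_powr gs by (intro add_mono A3 A4)
      thus ?thesis by (rule order_trans) simp
    qed
  qed
  let ?I = "\<lambda>x. \<integral>\<^sup>+y. ?k x y \<partial>?M"
  have ess: "esssup ?M (\<lambda>x. ennreal_powr (?I x) (1 / q)) < \<infinity>"
  proof -
    have "esssup ?M (\<lambda>x. ennreal_powr (?I x) (1 / q)) \<le> ennreal_powr ?A (1 / q)"
    proof (rule esssup_I)
      have "(\<lambda>x. ennreal_powr (J x) (1 / q)) \<in> borel_measurable ?M"
        using measurable_compose[OF ident_measurable_param J_m] by (intro borel_measurable_ennreal_powr) simp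
      thus "(\<lambda>x. ennreal_powr (?I x) (1 / q)) \<in> borel_measurable ?M"
        by (subst measurable_cong[where g = "\<lambda>x. ennreal_powr (J x) (1 / q)"]) (simp_all add: J_eq)
      show "AE x in ?M. ennreal_powr (?I x) (1 / q) \<le> ennreal_powr ?A (1 / q)"
        using J_le \<open>q > 1\<close> by (intro AE_I2 ennreal_powr_mono) (simp_all add: J_eq)
    qed
    also have "\<dots> < \<infinity>" by (rule ennreal_powr_less_top[OF A])
    finally show ?thesis .
  qed
  \<comment> \<open>Swapping the arguments conjugates the kernel and leaves the weight unchanged, so
    both suprema in the norm are the same.\<close>
  have sym: "(\<integral>\<^sup>+x. ?k x y \<partial>?M) = ?I y" for y
    by (intro nn_integral_cong) (simp add: frame_kernel_hermitian[of _ _ y] kernel_weight_commute[of _ _ y] norm_mult)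
  have "kernel_norm ?M q (\<lambda>x y. ?K x y * of_real (kernel_weight (scale_weight r) x y)) < \<infinity>"
    using ess by (simp add: kernel_norm_def sym)
  moreover have "(\<lambda>(x, y). ?K x y) \<in> borel_measurable (?M \<Otimes>\<^sub>M ?M)"
  proof -
    have "(\<lambda>z. (fst z, snd z)) \<in> measurable (?M \<Otimes>\<^sub>M ?M) (param_borel \<Otimes>\<^sub>M param_borel)"
      by (intro measurable_Pair measurable_compose[OF measurable_fst ident_measurable_param]
          measurable_compose[OF measurable_snd ident_measurable_param])
    hence "(\<lambda>z. K (fst z, snd z)) \<in> borel_measurable (?M \<Otimes>\<^sub>M ?M)"
      by (rule measurable_compose) measurable
    thus ?thesis
      by (subst measurable_cong[where g = "\<lambda>z. K (fst z, snd z)"]) (auto simp: space_pair_measure K_eq)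
  qed
  ultimately show ?thesis by (simp add: weighted_kernel_space_def)
qed

end
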